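(* Let $(U,P)$ be a suitable weak solution of the stationary Navier--Stokes equations in $\mathbb R^5$ satisfying $$\mathfrak M(U,P):=\sup_{R>0}R^{-2}\int_{B_R}|U|^3\,dx+\sup_{R>0}R^{-2}\int_{B_R}|P|^{3/2}\,dx<\infty .$$ If $$H=\frac{|U|^2}{2}+P\le0\quad\text{a.e. in }\mathbb R^5,$$ then $U=P=0$ in $\mathbb R^5$ (almost everywhere).
   Context: $B_R\subset\mathbb R^5$ is the open ball of radius $R$ centered at the origin. A pair $(U,P)$ is a suitable weak solution of the stationary Navier--Stokes equations in an open set $G\subset\mathbb R^5$ if $U\in H^1_{\rm loc}(G;\mathbb R^5)$, $P\in L^{3/2}_{\rm loc}(G)$, the equations $-\Delta U+\operatorname{div}(U\otimes U)+\nabla P=0$, $\operatorname{div}U=0$ hold in $\mathcal D'(G)$, and for every nonnegative $\phi\in C_c^\infty(G)$ $$\int_G|\nabla U|^2\phi\,dx\le\int_G\frac{|U|^2}{2}\Delta\phi\,dx+\int_G\Bigl(\frac{|U|^2}{2}+P\Bigr)U\cdot\nabla\phi\,dx .$$ *)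

theory Defs
  imports "HOL-Analysis.Analysis"
begin

section \<open>Smooth compactly supported functions\<close>

definition partial_deriv :: "'n::finite \<Rightarrow> (real^'n \<Rightarrow> real) \<Rightarrow> real^'n \<Rightarrow> real" where
  "partial_deriv i f x = frechet_derivative f (at x) (axis i 1)"

definition grad :: "(real^'n::finite \<Rightarrow> real) \<Rightarrow> real^'n \<Rightarrow> real^'n" where
  "grad f x = (\<chi> i. partial_deriv i f x)"

definition laplacian :: "(real^'n::finite \<Rightarrow> real) \<Rightarrow> real^'n \<Rightarrow> real" where
  "laplacian f x = (\<Sum>i\<in>UNIV. partial_deriv i (partial_deriv i f) x)"

text \<open>Differentiability is required explicitly because \<^const>\<open>frechet_derivative\<close> is a total function
  with unspecified values where no derivative exists.\<close>

fun C_diff :: "nat \<Rightarrow> (real^'n::finite \<Rightarrow> real) \<Rightarrow> bool" where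
  "C_diff 0 f \<longleftrightarrow> continuous_on UNIV f"
| "C_diff (Suc k) f \<longleftrightarrow> (\<forall>x. f differentiable (at x)) \<and> (\<forall>i. C_diff k (partial_deriv i f))"

text \<open>The space \<open>C\<^sub>c\<^sup>\<infinity>(G)\<close>; its elements are regarded as functions on the whole space, extended by zero.\<close>

definition test_functions :: "(real^'n::finite) set \<Rightarrow> (real^'n \<Rightarrow> real) set" where
  "test_functions G = {\<phi>. (\<forall>k. C_diff k \<phi>) \<and> compact (closure {x. \<phi> x \<noteq> 0}) \<and> closure {x. \<phi> x \<noteq> 0} \<subseteq> G}"


section \<open>Local Lebesgue and Sobolev spaces, distributions\<close>

definition L_loc :: "real \<Rightarrow> (real^'n::finite) set \<Rightarrow> (real^'n \<Rightarrow> 'b::euclidean_space) \<Rightarrow> bool" where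
  "L_loc p G f \<longleftrightarrow> set_borel_measurable lebesgue G f \<and>
     (\<forall>K. compact K \<and> K \<subseteq> G \<longrightarrow> set_integrable lebesgue K (\<lambda>x. norm (f x) powr p))"

type_synonym 'n distr = "(real^'n \<Rightarrow> real) \<Rightarrow> real"

text \<open>The distribution on \<open>G\<close> induced by a locally integrable function.\<close>

definition distr_of :: "(real^'n::finite) set \<Rightarrow> (real^'n \<Rightarrow> real) \<Rightarrow> 'n distr" where
  "distr_of G f \<phi> = (LINT x:G|lebesgue. f x * \<phi> x)"

definition distr_deriv :: "'n::finite \<Rightarrow> 'n distr \<Rightarrow> 'n distr" where
  "distr_deriv i T \<phi> = - T (partial_deriv i \<phi>)"

text \<open>\<open>D x $ i $ j\<close> is the weak derivative of the \<open>i\<close>-th component of \<open>f\<close> in direction \<open>j\<close>.\<close>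

definition has_weak_gradient ::
  "(real^'n::finite) set \<Rightarrow> (real^'n \<Rightarrow> real^'m::finite) \<Rightarrow> (real^'n \<Rightarrow> real^'n^'m) \<Rightarrow> bool" where
  "has_weak_gradient G f D \<longleftrightarrow> L_loc 1 G f \<and> L_loc 1 G D \<and>
     (\<forall>i j. \<forall>\<phi>\<in>test_functions G.
        distr_deriv j (distr_of G (\<lambda>x. f x $ i)) \<phi> = distr_of G (\<lambda>x. D x $ i $ j) \<phi>)"

definition H1_loc :: "(real^'n::finite) set \<Rightarrow> (real^'n \<Rightarrow> real^'m::finite) \<Rightarrow> bool" where
  "H1_loc G f \<longleftrightarrow> L_loc 2 G f \<and> (\<exists>D. has_weak_gradient G f D \<and> L_loc 2 G D)"


section \<open>Suitable weak solutions of the stationary Navier--Stokes equations\<close>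

text \<open>The momentum equation, componentwise:
  \<open>- \<Sum>\<^sub>j \<partial>\<^sub>j \<partial>\<^sub>j U\<^sub>i + \<Sum>\<^sub>j \<partial>\<^sub>j (U\<^sub>i U\<^sub>j) + \<partial>\<^sub>i P = 0\<close>.\<close>

definition stationary_NS :: "(real^5) set \<Rightarrow> (real^5 \<Rightarrow> real^5) \<Rightarrow> (real^5 \<Rightarrow> real) \<Rightarrow> bool" where
  "stationary_NS G U P \<longleftrightarrow>
     (\<forall>i. \<forall>\<phi>\<in>test_functions G.
        - (\<Sum>j\<in>UNIV. distr_deriv j (distr_deriv j (distr_of G (\<lambda>x. U x $ i))) \<phi>)
        + (\<Sum>j\<in>UNIV. distr_deriv j (distr_of G (\<lambda>x. U x $ i * U x $ j)) \<phi>)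
        + distr_deriv i (distr_of G P) \<phi> = 0) \<and>
     (\<forall>\<phi>\<in>test_functions G. (\<Sum>j\<in>UNIV. distr_deriv j (distr_of G (\<lambda>x. U x $ j)) \<phi>) = 0)"

text \<open>The norm on \<^typ>\<open>real^5^5\<close> is the Frobenius norm, so \<open>(norm (D x))\<^sup>2\<close> is \<open>\<Sum>\<^sub>i\<^sub>j (\<partial>\<^sub>j U\<^sub>i)\<^sup>2\<close>.
  The weak gradient is unique almost everywhere, so the local energy inequality does not depend on the
  choice of \<open>D\<close>.\<close>

definition suitable_weak_solution ::
  "(real^5) set \<Rightarrow> (real^5 \<Rightarrow> real^5) \<Rightarrow> (real^5 \<Rightarrow> real) \<Rightarrow> bool" where
  "suitable_weak_solution G U P \<longleftrightarrow>
     open G \<and> H1_loc G U \<and> L_loc (3/2) G P \<and> stationary_NS G U P \<and>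
     (\<exists>D. has_weak_gradient G U D \<and> L_loc 2 G D \<and>
       (\<forall>\<phi>\<in>test_functions G. (\<forall>x. 0 \<le> \<phi> x) \<longrightarrow>
          (LINT x:G|lebesgue. (norm (D x))\<^sup>2 * \<phi> x)
          \<le> (LINT x:G|lebesgue. (norm (U x))\<^sup>2 / 2 * laplacian \<phi> x)
            + (LINT x:G|lebesgue. ((norm (U x))\<^sup>2 / 2 + P x) * (U x \<bullet> grad \<phi> x))))"

definition scaled_bound :: "(real^5 \<Rightarrow> real^5) \<Rightarrow> (real^5 \<Rightarrow> real) \<Rightarrow> ennreal" where
  "scaled_bound U P =
     (SUP R\<in>{0<..}. ennreal (1 / R\<^sup>2) * (\<integral>\<^sup>+x\<in>ball 0 R. ennreal (norm (U x) ^ 3) \<partial>lebesgue))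
     + (SUP R\<in>{0<..}. ennreal (1 / R\<^sup>2) * (\<integral>\<^sup>+x\<in>ball 0 R. ennreal (\<bar>P x\<bar> powr (3/2)) \<partial>lebesgue))"

end

theory Submission
  imports Defs
begin

text \<open>Let \<open>h = -(|u|\<^sup>2/2 + p) \<ge> 0\<close>. Testing the momentum equation with \<open>G(|x-a|\<^sup>2) (x-a)\<close>, where \<open>G\<close> is the truncated
  Newton weight \<open>(e\<^sup>2+|x-a|\<^sup>2)\<^bsup>-3/2\<^esup>\<close>, all terms have one sign apart from the truncation error, which the
  scale-invariant bound controls. Hence \<open>\<integral> h |x-a|\<^bsup>-3\<^esup> dx\<close> is bounded uniformly in the centre \<open>a\<close>.

  The local energy inequality with weight \<open>(1+|x|\<^sup>2)\<^bsup>-1/2\<^esup>\<close> gives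
  \<open>\<integral> |\<nabla>u|\<^sup>2 (1+|x|\<^sup>2)\<^bsup>-1/2\<^esup> + |u|\<^sup>2 (1+|x|\<^sup>2)\<^bsup>-3/2\<^esup> \<le> C + \<integral> h |u| (1+|x|\<^sup>2)\<^bsup>-1\<^esup>\<close> on balls. As \<open>|x|\<^bsup>-3\<^esup>\<close> is
  the Newton kernel in dimension five, the uniform bound on the potential of \<open>h\<close> yields a trace inequality for the measure \<open>h dx\<close>
  (duality for the Riesz potential), which absorbs the flux on the right. Hence
  \<open>\<integral> |u|\<^sup>2 (1+|x|\<^sup>2)\<^bsup>-3/2\<^esup> < \<infinity>\<close>. Then the truncation error in the first identity, with \<open>a = 0\<close> and
  \<open>e = 1\<close>, tends to \<open>0\<close>, so the signed terms vanish.\<close>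

section \<open>Smooth functions\<close>

text \<open>The hypotheses are scale critical: each dyadic shell may contribute a fixed amount to
  the integrals of |u|^2 |x|^{-3} and of h |u| |x|^{-2}. The scaled bounds alone thus leave both
  logarithmically divergent, and the truncation error of the pressure identity is bounded but need
  not tend to zero. The decay has to be gained from the sign of h, through a potential bound K
  uniform in the centre. The flux is read as the pairing of h f, f = (1+|x|^2)^{-3/4}, with |v|, v =
  u (1+|x|^2)^{-1/4}. Up to a constant |v| is at most the convolution of |x|^{-4} with a majorant of
  its gradient. Moving this potential onto h f, its squared L^2 norm is a double integral of h f
  against the composed kernel |x-y|^{-3}, hence at most c K times the integral of h f^2, that is c
  K^2. Young's inequality gives flux <= t (energy) + C/t for every t > 0, so the absorption works
  whatever the size of K. Weak derivatives are visible only through test functions, so the Riesz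
  representation is proved for a regularised kernel, uniformly in the regularisation, and recovered
  almost everywhere by duality.\<close>

definition smooth :: "(real^'n::finite \<Rightarrow> real) \<Rightarrow> bool" where
  "smooth f \<longleftrightarrow> (\<forall>k. C_diff k f)"

lemma partial_deriv_eq:
  "(f has_derivative f') (at x) \<Longrightarrow> partial_deriv i f x = f' (axis i 1)"
  unfolding partial_deriv_def by (metis frechet_derivative_at)

lemma C_diff_imp_continuous: "C_diff k f \<Longrightarrow> continuous_on UNIV f"
  by (cases k) (auto simp: continuous_at_imp_continuous_on differentiable_imp_continuous_within)

lemma C_diff_Suc_imp: "C_diff (Suc k) f \<Longrightarrow> C_diff k f"
proof (induction k arbitrary: f)
  case 0
  then show ?case using C_diff_imp_continuous[of "Suc 0"] by (simp del: C_diff.simps(2))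
next
  case (Suc k)
  then show ?case by (metis C_diff.simps(2))
qed

lemma partial_deriv_add:
  assumes "f differentiable (at x)" "g differentiable (at x)"
  shows "partial_deriv i (\<lambda>x. f x + g x) x = partial_deriv i f x + partial_deriv i g x"
  using partial_deriv_eq[OF has_derivative_add[OF frechet_derivative_works[THEN iffD1, OF assms(1)]
        frechet_derivative_works[THEN iffD1, OF assms(2)]], of i]
  by (simp add: partial_deriv_def)

lemma partial_deriv_mult:
  assumes "f differentiable (at x)" "g differentiable (at x)"
  shows "partial_deriv i (\<lambda>x. f x * g x) x = f x * partial_deriv i g x + partial_deriv i f x * g x"
  using partial_deriv_eq[OF has_derivative_mult[OF frechet_derivative_works[THEN iffD1, OF assms(1)]
        frechet_derivative_works[THEN iffD1, OF assms(2)]], of i]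
  by (simp add: partial_deriv_def)

lemma partial_deriv_compose:
  assumes "(F has_real_derivative d) (at (f x))" "f differentiable (at x)"
  shows "partial_deriv i (\<lambda>x. F (f x)) x = d * partial_deriv i f x"
  using partial_deriv_eq[OF has_derivative_compose[OF frechet_derivative_works[THEN iffD1, OF assms(2)]
      assms(1)[unfolded has_field_derivative_def]], of i]
  by (simp add: partial_deriv_def)

lemma C_diff_const: "C_diff k (\<lambda>x. c)"
proof (induction k arbitrary: c)
  case (Suc k)
  have "partial_deriv i (\<lambda>x. c) = (\<lambda>x. 0)" for i :: 'a
    by (rule ext, subst partial_deriv_eq[OF has_derivative_const]) simp
  with Suc show ?case by simp
qed simp

lemma C_diff_nth: "C_diff k (\<lambda>x. x $ j)"
proof (cases k)
  case (Suc k')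
  have d: "((\<lambda>x::real^'a. x $ j) has_derivative (\<lambda>h. h $ j)) (at x)" for x
    by (rule bounded_linear_imp_has_derivative) (rule bounded_linear_vec_nth)
  have "partial_deriv i (\<lambda>x. x $ j) = (\<lambda>x. axis i 1 $ j)" for i
    by (rule ext) (rule partial_deriv_eq[OF d])
  then show ?thesis using Suc d C_diff_const by (auto simp: differentiable_def)
qed (auto intro: continuous_intros)

lemma C_diff_add: "C_diff k f \<Longrightarrow> C_diff k g \<Longrightarrow> C_diff k (\<lambda>x. f x + g x)"
proof (induction k arbitrary: f g)
  case (Suc k)
  have "partial_deriv i (\<lambda>x. f x + g x) = (\<lambda>x. partial_deriv i f x + partial_deriv i g x)" for i
    using Suc.prems by (auto simp: partial_deriv_add)
  with Suc show ?case by (auto intro: differentiable_add)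
qed (auto intro: continuous_intros)

lemma C_diff_mult: "C_diff k f \<Longrightarrow> C_diff k g \<Longrightarrow> C_diff k (\<lambda>x. f x * g x)"
proof (induction k arbitrary: f g)
  case (Suc k)
  have "partial_deriv i (\<lambda>x. f x * g x) = (\<lambda>x. f x * partial_deriv i g x + partial_deriv i f x * g x)" for i
    using Suc.prems by (auto simp: partial_deriv_mult)
  with Suc show ?case
    using C_diff_Suc_imp[OF Suc.prems(1)] C_diff_Suc_imp[OF Suc.prems(2)]
    by (auto intro!: differentiable_mult C_diff_add)
qed (auto intro: continuous_intros)

text \<open>The outer function comes as a whole sequence of successive derivatives: the chain rule
  turns \<open>F n\<close> into \<open>F (Suc n)\<close>, so the induction has to range over all
  \<open>n\<close>. Derivatives are required on \<open>S\<close> only, which admits powers that are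
  singular elsewhere.\<close>

lemma C_diff_compose:
  assumes F: "\<And>n t. t \<in> S \<Longrightarrow> (F n has_real_derivative F (Suc n) t) (at t)"
    and S: "\<And>x. f x \<in> S" and f: "C_diff k f"
  shows "C_diff k (\<lambda>x. F n (f x))"
  using f
proof (induction k arbitrary: n)
  case 0
  have "continuous_on S (F n)"
    by (meson F DERIV_isCont continuous_at_imp_continuous_on)
  then show ?case using 0 S by (auto intro!: continuous_on_compose2[where f=f and g="F n"])
next
  case (Suc k)
  have "partial_deriv i (\<lambda>x. F n (f x)) = (\<lambda>x. F (Suc n) (f x) * partial_deriv i f x)" for i
    using Suc.prems by (auto simp: partial_deriv_compose[OF F[OF S]])
  moreover have "(\<lambda>x. F n (f x)) differentiable at x" for x
  proof -
    obtain D where "(f has_derivative D) (at x)"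
      using Suc.prems by (auto simp: differentiable_def)
    from has_derivative_compose[OF this F[OF S, of n, unfolded has_field_derivative_def]]
    show ?thesis by (auto simp: differentiable_def)
  qed
  ultimately show ?case using Suc C_diff_Suc_imp[OF Suc.prems]
    by (auto intro!: C_diff_mult)
qed

lemma smooth_const [intro]: "smooth (\<lambda>x. c)"
  and smooth_nth [intro]: "smooth (\<lambda>x. x $ j)"
  and smooth_add [intro]: "smooth f \<Longrightarrow> smooth g \<Longrightarrow> smooth (\<lambda>x. f x + g x)"
  and smooth_mult [intro]: "smooth f \<Longrightarrow> smooth g \<Longrightarrow> smooth (\<lambda>x. f x * g x)"
  by (simp_all add: smooth_def C_diff_const C_diff_nth C_diff_add C_diff_mult)

lemma smooth_diff [intro]: "smooth f \<Longrightarrow> smooth g \<Longrightarrow> smooth (\<lambda>x. f x - g x)"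
  using smooth_add[of f "\<lambda>x. (-1) * g x"] smooth_mult[of "\<lambda>x. -1" g] by auto

lemma smooth_sum [intro]: "(\<And>i. i \<in> I \<Longrightarrow> smooth (f i)) \<Longrightarrow> smooth (\<lambda>x. \<Sum>i\<in>I. f i x)"
  by (induction I rule: infinite_finite_induct) auto

lemma smooth_norm_sq: "smooth (\<lambda>x. (norm (x - a))\<^sup>2)"
proof -
  have "(norm (x - a))\<^sup>2 = (\<Sum>i\<in>UNIV. (x$i - a$i) * (x$i - a$i))" for x
    by (simp add: power2_norm_eq_inner inner_vec_def)
  then show ?thesis by (simp add: smooth_sum smooth_mult smooth_diff smooth_nth smooth_const)
qed

text \<open>Smoothness is witnessed by the sequence of derivatives, which is the form in which
  \<open>C_diff_compose\<close> takes its outer function.\<close>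

definition smooth_real :: "real set \<Rightarrow> (real \<Rightarrow> real) \<Rightarrow> bool" where
  "smooth_real S F \<longleftrightarrow> (\<exists>Fs. Fs 0 = F \<and> (\<forall>n. \<forall>t\<in>S. (Fs n has_real_derivative Fs (Suc n) t) (at t)))"

lemma smooth_compose:
  assumes "smooth_real S F" "smooth f" "\<And>x. f x \<in> S"
  shows "smooth (\<lambda>x. F (f x))"
proof -
  from assms(1) obtain Fs where *: "Fs 0 = F" "\<And>n t. t \<in> S \<Longrightarrow> (Fs n has_real_derivative Fs (Suc n) t) (at t)"
    by (auto simp: smooth_real_def)
  show ?thesis
    using C_diff_compose[of S Fs f _ 0] * assms(2,3) by (auto simp: smooth_def)
qed

lemma smooth_real_powr: "smooth_real {-a<..} (\<lambda>t. (a + t) powr q)"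
proof -
  define Fs where "Fs n t = (\<Prod>i<n. q - real i) * (a + t) powr (q - real n)" for n t
  have "(Fs n has_real_derivative Fs (Suc n) t) (at t)" if "t > -a" for n t
    unfolding Fs_def using that
    by (auto intro!: derivative_eq_intros simp: algebra_simps)
  then show ?thesis unfolding smooth_real_def by (intro exI[of _ Fs]) (auto simp: Fs_def)
qed

section \<open>The flat function exp(-1/t) and the cutoff built from it\<close>

lemma exp_inverse_flat:
  fixes q :: "real poly"
  shows "((\<lambda>h. poly q (1/h) * exp (-1/h) / h) \<longlongrightarrow> 0) (at_right 0)"
proof -
  have lim: "((\<lambda>u. poly r u * exp (- u)) \<longlongrightarrow> 0) at_top" for r :: "real poly"
  proof -
    have "((\<lambda>u. \<Sum>i\<le>degree r. coeff r i * (u ^ i / exp u)) \<longlongrightarrow> (\<Sum>i\<le>degree r. coeff r i * 0)) at_top"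
      by (intro tendsto_intros tendsto_power_div_exp_0)
    moreover have "(\<Sum>i\<le>degree r. coeff r i * (u ^ i / exp u)) = poly r u * exp (- u)" for u
      by (simp add: poly_altdef sum_distrib_right exp_minus divide_inverse mult.assoc)
    ultimately show ?thesis by simp
  qed
  \<comment> \<open>With u = 1/h the extra factor 1/h is one more power of u, hence the polynomial
    \<open>pCons 0 q\<close>. It is the factor that appears in the difference quotient of
    \<open>bump_seq\<close> at 0.\<close>
  show ?thesis
    using filterlim_compose[OF lim[of "pCons 0 q"] filterlim_inverse_at_top_right]
    by (simp add: divide_inverse ac_simps)
qed

text \<open>The n-th derivative of exp(-1/t) on t > 0 is P_n(1/t) exp(-1/t). With u = 1/t, one more
  differentiation multiplies P_n - P_n' by u^2.\<close>

fun bump_poly :: "nat \<Rightarrow> real poly" where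
  "bump_poly 0 = 1"
| "bump_poly (Suc n) = [:0, 0, 1:] * (bump_poly n - pderiv (bump_poly n))"

definition bump_seq :: "nat \<Rightarrow> real \<Rightarrow> real" where
  "bump_seq n t = (if t > 0 then poly (bump_poly n) (1/t) * exp (-1/t) else 0)"

lemma bump_seq_deriv: "(bump_seq n has_real_derivative bump_seq (Suc n) t) (at t)"
proof (cases t "0::real" rule: linorder_cases)
  case less
  have "((\<lambda>t. 0) has_real_derivative 0) (at t)" by simp
  then have "(bump_seq n has_real_derivative 0) (at t)"
    by (rule has_field_derivative_transform_within_open[of _ _ _ "{..<0}"]) (use less in \<open>auto simp: bump_seq_def\<close>)
  then show ?thesis using less by (simp add: bump_seq_def)
next
  case greater
  have "((\<lambda>t. poly (bump_poly n) (1/t) * exp (-1/t)) has_real_derivative 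
      poly (bump_poly n) (1/t) * (exp (-1/t) * (1 / t^2)) + (poly (pderiv (bump_poly n)) (1/t) * (-1/t^2)) * exp (-1/t)) (at t)"
    using greater
    by (auto intro!: derivative_eq_intros DERIV_chain2[OF poly_DERIV] simp: power2_eq_square field_simps)
  also have "poly (bump_poly n) (1/t) * (exp (-1/t) * (1 / t^2)) + (poly (pderiv (bump_poly n)) (1/t) * (-1/t^2)) * exp (-1/t)
     = bump_seq (Suc n) t"
    using greater by (simp add: bump_seq_def power2_eq_square field_simps)
  finally show ?thesis
    by (rule has_field_derivative_transform_within_open[of _ _ _ "{0<..}"]) (use greater in \<open>auto simp: bump_seq_def\<close>)
next
  case equal
  have "((\<lambda>h. bump_seq n h / h) \<longlongrightarrow> 0) (at_right 0)"
    by (rule tendsto_cong[THEN iffD1, OF _ exp_inverse_flat[of "bump_poly n"]])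
      (auto simp: bump_seq_def eventually_at_filter)
  moreover have "((\<lambda>h. bump_seq n h / h) \<longlongrightarrow> 0) (at_left 0)"
    by (rule tendsto_cong[THEN iffD1, OF _ tendsto_const]) (auto simp: bump_seq_def eventually_at_filter)
  ultimately have "((\<lambda>h. bump_seq n h / h) \<longlongrightarrow> 0) (at 0)"
    by (simp add: filterlim_split_at)
  then show ?thesis using equal by (simp add: DERIV_def bump_seq_def)
qed

lemma continuous_bump_seq: "continuous_on S (bump_seq n)"
  by (meson DERIV_isCont bump_seq_deriv continuous_at_imp_continuous_on)

text \<open>A cutoff of \<open>t = (|x|/R)\<^sup>2\<close>; its derivative vanishes at \<open>0\<close>, which keeps the commutator terms
  integrable against the weights used below although the cutoff has no plateau.\<close>

definition cutoff :: "real \<Rightarrow> real" where "cutoff t = exp 1 * bump_seq 0 (1 - t\<^sup>2)"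
definition cutoff1 :: "real \<Rightarrow> real" where "cutoff1 t = exp 1 * bump_seq 1 (1 - t\<^sup>2) * (- 2 * t)"
definition cutoff2 :: "real \<Rightarrow> real" where
  "cutoff2 t = exp 1 * (bump_seq 2 (1 - t\<^sup>2) * (4 * t\<^sup>2) - 2 * bump_seq 1 (1 - t\<^sup>2))"

lemma cutoff_deriv: "(cutoff has_real_derivative cutoff1 t) (at t)"
  unfolding cutoff_def[abs_def] cutoff1_def
  by (auto intro!: derivative_eq_intros DERIV_chain2[OF bump_seq_deriv])

lemma cutoff1_deriv: "(cutoff1 has_real_derivative cutoff2 t) (at t)"
  unfolding cutoff1_def[abs_def] cutoff2_def
  by (auto intro!: derivative_eq_intros DERIV_chain2[OF bump_seq_deriv]
      simp: power2_eq_square algebra_simps simp flip: numeral_2_eq_2)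

lemma cutoff_0 [simp]: "cutoff 0 = 1"
  by (simp add: cutoff_def bump_seq_def flip: exp_add)

lemma cutoff_range: "0 \<le> cutoff t" "cutoff t \<le> 1"
  by (auto simp: cutoff_def bump_seq_def field_simps simp flip: exp_add)

lemma cutoff_outside: "\<bar>t\<bar> \<ge> 1 \<Longrightarrow> cutoff t = 0" "\<bar>t\<bar> \<ge> 1 \<Longrightarrow> cutoff1 t = 0" "\<bar>t\<bar> \<ge> 1 \<Longrightarrow> cutoff2 t = 0"
  using abs_le_square_iff[of 1 t] by (auto simp: cutoff_def cutoff1_def cutoff2_def bump_seq_def)

text \<open>The bump derivatives are bounded on [-1,1] by compactness, and the factor
  \<open>- 2 * t\<close> in \<open>cutoff1\<close> supplies the linear vanishing. Asking for
  \<open>C \<ge> 1\<close> lets first powers of the constant be absorbed into its square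
  later.\<close>

lemma cutoff_bounds:
  obtains C where "C \<ge> 1" "\<And>t. \<bar>cutoff1 t\<bar> \<le> C * \<bar>t\<bar>" "\<And>t. \<bar>cutoff2 t\<bar> \<le> C"
proof -
  have "\<exists>B>0. \<forall>t\<in>{-1..1}. \<bar>bump_seq n (1 - t\<^sup>2)\<bar> \<le> B" for n
  proof -
    have "compact ((\<lambda>t. bump_seq n (1 - t\<^sup>2)) ` {-1..1::real})"
      by (intro compact_continuous_image continuous_on_compose2[OF continuous_bump_seq[of UNIV]] continuous_intros) auto
    then obtain B where "B > 0" "\<forall>y\<in>(\<lambda>t. bump_seq n (1 - t\<^sup>2)) ` {-1..1}. norm y \<le> B"
      using compact_imp_bounded bounded_pos by metis
    then show ?thesis by auto
  qed
  then obtain B where B: "\<And>n. B n > 0" "\<And>n t. t \<in> {-1..1} \<Longrightarrow> \<bar>bump_seq n (1 - t\<^sup>2)\<bar> \<le> B n" by metis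
  define C where "C = 1 + exp 1 * (4 * B 2 + 2 * B 1)"
  have "C \<ge> 1" using B(1)[of 1] B(1)[of 2] by (simp add: C_def)
  have "\<bar>cutoff1 t\<bar> \<le> C * \<bar>t\<bar>" for t
  proof (cases "t \<in> {-1..1}")
    case True
    have "exp 1 * \<bar>bump_seq 1 (1 - t\<^sup>2)\<bar> * 2 \<le> exp 1 * B 1 * 2" using B(2)[OF True, of 1] by simp
    also have "\<dots> \<le> C" using B(1)[of 2] by (simp add: C_def algebra_simps add_increasing)
    finally have "exp 1 * \<bar>bump_seq 1 (1 - t\<^sup>2)\<bar> * 2 * \<bar>t\<bar> \<le> C * \<bar>t\<bar>" by (rule mult_right_mono) simp
    then show ?thesis by (simp add: cutoff1_def abs_mult mult.assoc)
  next
    case False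
    then have "cutoff1 t = 0" by (intro cutoff_outside) auto
    with \<open>C \<ge> 1\<close> show ?thesis by simp
  qed
  moreover have "\<bar>cutoff2 t\<bar> \<le> C" for t
  proof (cases "t \<in> {-1..1}")
    case True
    have t: "t\<^sup>2 \<le> 1" using True abs_le_square_iff[of t 1] by auto
    have "\<bar>bump_seq 2 (1 - t\<^sup>2) * (4 * t\<^sup>2)\<bar> \<le> B 2 * (4 * 1)"
      unfolding abs_mult using B(2)[OF True, of 2] t by (intro mult_mono) (auto simp: B(1) less_imp_le)
    then have "\<bar>bump_seq 2 (1 - t\<^sup>2) * (4 * t\<^sup>2) - 2 * bump_seq 1 (1 - t\<^sup>2)\<bar> \<le> 4 * B 2 + 2 * B 1"
      using B(2)[OF True, of 1] by linarith
    then have "\<bar>cutoff2 t\<bar> \<le> exp 1 * (4 * B 2 + 2 * B 1)" by (simp add: cutoff2_def abs_mult)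
    then show ?thesis by (simp add: C_def)
  qed (use cutoff_outside(3)[of t] \<open>C \<ge> 1\<close> in auto)
  ultimately show thesis using that \<open>C \<ge> 1\<close> by blast
qed

lemma smooth_real_bump: "smooth_real UNIV (bump_seq n)"
  unfolding smooth_real_def
  by (intro exI[of _ "\<lambda>k. bump_seq (n + k)"]) (use bump_seq_deriv in auto)

lemma smooth_cutoff:
  assumes "smooth f"
  shows "smooth (\<lambda>x. cutoff (f x))" "smooth (\<lambda>x. cutoff1 (f x))" 
proof -
  have *: "smooth (\<lambda>x. bump_seq n (1 - (f x)\<^sup>2))" for n
    by (rule smooth_compose[OF smooth_real_bump]) (use assms in \<open>auto simp: power2_eq_square\<close>)
  show "smooth (\<lambda>x. cutoff (f x))" unfolding cutoff_def by (intro smooth_mult smooth_const *)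
  show "smooth (\<lambda>x. cutoff1 (f x))" unfolding cutoff1_def by (intro smooth_mult smooth_const * assms)
qed

lemma smooth_powr: "smooth f \<Longrightarrow> (\<And>x. f x > 0) \<Longrightarrow> smooth (\<lambda>x. f x powr q)"
  using smooth_compose[OF smooth_real_powr[of 0 q], of f] by auto

lemma smooth_test_function:
  assumes "smooth f" "\<And>x. norm (x - a) > R \<Longrightarrow> f x = 0"
  shows "f \<in> test_functions UNIV"
proof -
  have "{x. f x \<noteq> 0} \<subseteq> cball a R" using assms(2) by (force simp: dist_norm norm_minus_commute)
  then have "bounded {x. f x \<noteq> 0}" using bounded_cball bounded_subset by blast
  then show ?thesis using assms(1) by (auto simp: test_functions_def smooth_def)
qed

text \<open>Radial functions are written in the variable |x - a|^2, which is smooth at the centre,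
  so that no derivative formula needs a case distinction at \<open>x = a\<close>.\<close>

lemma has_derivative_radial:
  assumes "(F has_real_derivative d) (at ((norm (x - a))\<^sup>2))"
  shows "((\<lambda>x::real^'n. F ((norm (x - a))\<^sup>2)) has_derivative (\<lambda>h. d * (2 * ((x - a) \<bullet> h)))) (at x)"
proof -
  have "((\<lambda>x. (norm (x - a))\<^sup>2) has_derivative (\<lambda>h. 2 * ((x - a) \<bullet> h))) (at x)"
    unfolding power2_norm_eq_inner by (auto intro!: derivative_eq_intros simp: inner_commute)
  from has_derivative_compose[OF this assms[unfolded has_field_derivative_def]]
  show ?thesis .
qed

lemma partial_deriv_radial:
  assumes "(F has_real_derivative d) (at ((norm (x - a))\<^sup>2))"
  shows "partial_deriv i (\<lambda>x::real^'n. F ((norm (x - a))\<^sup>2)) x = 2 * d * (x$i - a$i)"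
  using partial_deriv_eq[OF has_derivative_radial[OF assms]] by (simp add: inner_axis)

section \<open>Kernels on five-dimensional space\<close>

abbreviation ball_vol :: real where "ball_vol \<equiv> unit_ball_vol 5"

lemma emeasure_ball5: "r \<ge> 0 \<Longrightarrow> emeasure lborel (ball (c::real^5) r) = ennreal (ball_vol * r ^ 5)"
  using emeasure_ball[of r c] by simp

lemma ball_measurable [measurable]: "ball (a::'a::euclidean_space) r \<in> sets borel"
  by simp

lemma nn_integral_shift:
  fixes f :: "'a::euclidean_space \<Rightarrow> ennreal"
  assumes [measurable]: "f \<in> borel_measurable borel"
  shows "(\<integral>\<^sup>+x. f (x - a) \<partial>lborel) = (\<integral>\<^sup>+x. f x \<partial>lborel)"
proof -
  have "(\<integral>\<^sup>+x. f x \<partial>lborel) = (\<integral>\<^sup>+x. f x \<partial>distr lborel borel ((+) (-a)))"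
    by (simp add: lborel_distr_plus)
  also have "\<dots> = (\<integral>\<^sup>+x. f (x - a) \<partial>lborel)"
    by (subst nn_integral_distr) auto
  finally show ?thesis by simp
qed

text \<open>Sum over the shells 2^k r <= |z| < 2^{k+1} r: the volume is at most 32 (2^k r)^5
  \<open>ball_vol\<close> and the kernel at most (2^k r)^{-m}. One power beyond the dimension gives
  a geometric series of ratio at most 1/2, whence 64 = 32 * 2.\<close>

lemma kernel_outside:
  assumes r: "r > 0" and m: "m \<ge> 6"
  shows "(\<integral>\<^sup>+z. ennreal (1 / norm z ^ m) * indicator {z::real^5. r \<le> norm z} z \<partial>lborel)
    \<le> ennreal (64 * ball_vol * r ^ 5 / r ^ m)"
proof -
  define F where "F k z = ennreal (1 / (2 ^ k * r) ^ m) * indicator (ball 0 (2 ^ Suc k * r)) z" for k and z :: "real^5"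
  have [measurable]: "F k \<in> borel_measurable borel" for k unfolding F_def
    by (intro borel_measurable_times_ennreal borel_measurable_const borel_measurable_indicator) auto
  have le: "ennreal (1 / norm z ^ m) * indicator {z. r \<le> norm z} z \<le> (\<Sum>k. F k z)" for z :: "real^5"
  proof (cases "r \<le> norm z")
    case True
    have "\<exists>k. norm z < 2 ^ Suc k * r"
    proof -
      obtain k where "norm z / r < 2 ^ k" using real_arch_pow[of 2 "norm z / r"] by auto
      then have "norm z < 2 ^ k * r" using r by (simp add: field_simps)
      also have "\<dots> \<le> 2 ^ Suc k * r" using r by simp
      finally show ?thesis by blast
    qed
    \<comment> \<open>The least such \<open>k\<close> selects the shell of \<open>z\<close>:
      minimality yields the lower bound on the norm for positive \<open>k\<close>, and the
      hypothesis on \<open>z\<close> yields it for \<open>k = 0\<close>.\<close>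
    then have k: "norm z < 2 ^ Suc (LEAST k. norm z < 2 ^ Suc k * r) * r" by (rule LeastI_ex)
    define k where "k = (LEAST k. norm z < 2 ^ Suc k * r)"
    have low: "2 ^ k * r \<le> norm z"
    proof (cases k)
      case (Suc j)
      then have "\<not> norm z < 2 ^ Suc j * r" using not_less_Least[of j "\<lambda>k. norm z < 2 ^ Suc k * r"] by (auto simp: k_def)
      then show ?thesis by (simp add: Suc)
    qed (use True in auto)
    have "1 / norm z ^ m \<le> 1 / (2 ^ k * r) ^ m"
      using low r True by (intro divide_left_mono power_mono mult_pos_pos zero_less_power) auto
    then have "ennreal (1 / norm z ^ m) * indicator {z. r \<le> norm z} z \<le> F k z"
      using True k by (auto simp: F_def k_def intro!: ennreal_leI)
    also have "\<dots> \<le> (\<Sum>k. F k z)"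
      using sum_le_suminf[of "\<lambda>k. F k z" "{k}"] by auto
    finally show ?thesis .
  qed simp
  have Fk: "(\<integral>\<^sup>+z. F k z \<partial>lborel) \<le> ennreal (32 * ball_vol * r ^ 5 / r ^ m * (1/2) ^ k)" for k
  proof -
    have "(\<integral>\<^sup>+z. F k z \<partial>lborel) = ennreal (1 / (2 ^ k * r) ^ m) * ennreal (ball_vol * (2 ^ Suc k * r) ^ 5)"
      unfolding F_def using r by (subst nn_integral_cmult_indicator) (auto simp del: power_Suc simp: emeasure_ball5)
    also have "\<dots> = ennreal (1 / (2 ^ k * r) ^ m * (ball_vol * (2 ^ Suc k * r) ^ 5))"
      using r by (intro ennreal_mult[symmetric]) auto
    also have "\<dots> \<le> ennreal (32 * ball_vol * r ^ 5 / r ^ m * (1/2) ^ k)"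
    proof (rule ennreal_leI)
      have "1 / (2 ^ k * r) ^ m * (ball_vol * (2 ^ Suc k * r) ^ 5) = 32 * ball_vol * r ^ 5 / r ^ m * ((2 ^ k) ^ 5 / (2 ^ k) ^ m)"
        by (simp add: power_mult_distrib ac_simps)
      also have "\<dots> \<le> 32 * ball_vol * r ^ 5 / r ^ m * (1/2) ^ k"
      proof (rule mult_left_mono)
        have "((2::real) ^ k) ^ 6 \<le> (2 ^ k) ^ m" using m by (intro power_increasing) auto
        then have "((2::real) ^ k) ^ 5 * 2 ^ k \<le> (2 ^ k) ^ m"
          by (metis (no_types, opaque_lifting) eval_nat_numeral(2,3) mult.commute power_Suc semiring_norm(26-28) Suc_numeral power_Suc2)
        then show "((2::real) ^ k) ^ 5 / (2 ^ k) ^ m \<le> (1/2) ^ k"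
          by (simp add: field_simps power_divide)
      qed (use r in auto)
      finally show "1 / (2 ^ k * r) ^ m * (ball_vol * (2 ^ Suc k * r) ^ 5) \<le> 32 * ball_vol * r ^ 5 / r ^ m * (1/2) ^ k" .
    qed
    finally show ?thesis .
  qed
  have "(\<integral>\<^sup>+z. ennreal (1 / norm z ^ m) * indicator {z::real^5. r \<le> norm z} z \<partial>lborel) \<le> (\<integral>\<^sup>+z. (\<Sum>k. F k z) \<partial>lborel)"
    by (intro nn_integral_mono le)
  also have "\<dots> = (\<Sum>k. \<integral>\<^sup>+z. F k z \<partial>lborel)" by (rule nn_integral_suminf) simp
  also have "\<dots> \<le> (\<Sum>k. ennreal (32 * ball_vol * r ^ 5 / r ^ m * (1/2) ^ k))"
    by (intro suminf_le Fk) auto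
  also have "\<dots> = ennreal (32 * ball_vol * r ^ 5 / r ^ m * 2)"
    using r sums_mult[OF geometric_sums[of "1/2::real"], of "32 * ball_vol * r ^ 5 / r ^ m"]
    by (intro suminf_ennreal_eq) auto
  finally show ?thesis by (simp add: ac_simps)
qed

text \<open>Sum over shells shrinking to the origin. The exponent is one below the dimension, so
  shell \<open>k\<close> contributes 16 \<open>ball_vol\<close> r 2^{-k}. At the origin itself the
  integrand is 0 because 1/0 = 0.\<close>

lemma kernel_inside:
  assumes r: "r > 0"
  shows "(\<integral>\<^sup>+z. ennreal (1 / norm z ^ 4) * indicator (ball (0::real^5) r) z \<partial>lborel)
    \<le> ennreal (32 * ball_vol * r)"
proof -
  define F where "F k z = ennreal (1 / (r / 2 ^ Suc k) ^ 4) * indicator (ball 0 (r / 2 ^ k)) z" for k and z :: "real^5"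
  have [measurable]: "F k \<in> borel_measurable borel" for k unfolding F_def
    by (intro borel_measurable_times_ennreal borel_measurable_const borel_measurable_indicator) auto
  have le: "ennreal (1 / norm z ^ 4) * indicator (ball 0 r) z \<le> (\<Sum>k. F k z)" for z :: "real^5"
  proof (cases "norm z < r \<and> z \<noteq> 0")
    case True
    have "\<exists>k. r / 2 ^ Suc k \<le> norm z"
    proof -
      obtain k where "r / norm z < 2 ^ k" using real_arch_pow[of 2 "r / norm z"] by auto
      then have "r / 2 ^ k \<le> norm z" using True by (simp add: field_simps)
      moreover have "r / 2 ^ Suc k \<le> r / 2 ^ k" using r by (simp add: field_simps)
      ultimately show ?thesis by (meson order_trans)
    qed
    then have k: "r / 2 ^ Suc (LEAST k. r / 2 ^ Suc k \<le> norm z) \<le> norm z" by (rule LeastI_ex)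
    define k where "k = (LEAST k. r / 2 ^ Suc k \<le> norm z)"
    have high: "norm z < r / 2 ^ k"
    proof (cases k)
      case (Suc j)
      then have "\<not> r / 2 ^ Suc j \<le> norm z" using not_less_Least[of j "\<lambda>k. r / 2 ^ Suc k \<le> norm z"] by (auto simp: k_def)
      then show ?thesis by (simp add: Suc)
    qed (use True in auto)
    have "1 / norm z ^ 4 \<le> 1 / (r / 2 ^ Suc k) ^ 4"
      using k r True unfolding k_def[symmetric] by (intro divide_left_mono power_mono mult_pos_pos zero_less_power) auto
    then have "ennreal (1 / norm z ^ 4) * indicator (ball 0 r) z \<le> F k z"
      using True high unfolding F_def by (auto intro!: ennreal_leI simp del: power_Suc)
    also have "\<dots> \<le> (\<Sum>k. F k z)"
      using sum_le_suminf[of "\<lambda>k. F k z" "{k}"] by auto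
    finally show ?thesis .
  qed (auto simp: not_less)
  have Fk: "(\<integral>\<^sup>+z. F k z \<partial>lborel) = ennreal (16 * ball_vol * r * (1/2) ^ k)" for k
  proof -
    have "(\<integral>\<^sup>+z. F k z \<partial>lborel) = ennreal (1 / (r / 2 ^ Suc k) ^ 4) * ennreal (ball_vol * (r / 2 ^ k) ^ 5)"
      unfolding F_def using r by (subst nn_integral_cmult_indicator) (auto simp del: power_Suc simp: emeasure_ball5)
    also have "\<dots> = ennreal (1 / (r / 2 ^ Suc k) ^ 4 * (ball_vol * (r / 2 ^ k) ^ 5))"
      using r by (intro ennreal_mult[symmetric]) auto
    also have "1 / (r / 2 ^ Suc k) ^ 4 * (ball_vol * (r / 2 ^ k) ^ 5) = 16 * ball_vol * r * (1/2) ^ k"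
      using r by (simp add: field_simps power_divide power_mult_distrib eval_nat_numeral)
    finally show ?thesis .
  qed
  have "(\<integral>\<^sup>+z. ennreal (1 / norm z ^ 4) * indicator (ball (0::real^5) r) z \<partial>lborel) \<le> (\<integral>\<^sup>+z. (\<Sum>k. F k z) \<partial>(lborel :: (real^5) measure))"
    by (intro nn_integral_mono le)
  also have "\<dots> = (\<Sum>k. \<integral>\<^sup>+z. F k z \<partial>lborel)" by (rule nn_integral_suminf) simp
  also have "\<dots> = ennreal (16 * ball_vol * r * 2)"
    unfolding Fk using r sums_mult[OF geometric_sums[of "1/2::real"], of "16 * ball_vol * r"]
    by (intro suminf_ennreal_eq) auto
  finally show ?thesis by (simp add: ac_simps)
qed

text \<open>The kernel takes the value \<open>1/0 = 0\<close> on the diagonal, which is a null set.\<close>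

definition riesz :: "(real^5 \<Rightarrow> ennreal) \<Rightarrow> real^5 \<Rightarrow> ennreal" where
  "riesz g y = (\<integral>\<^sup>+x. g x * ennreal (1 / norm (x - y) ^ 4) \<partial>lborel)"

lemma riesz_measurable [measurable]:
  assumes [measurable]: "g \<in> borel_measurable borel"
  shows "riesz g \<in> borel_measurable borel"
  unfolding riesz_def by measurable

text \<open>With r half the distance of x and y, no z is closer than r to both. Near one of the
  points the other factor is at most r^{-4}, which leaves the integral of |v|^{-4} over a ball of
  radius r. Away from both points, a b <= a^2 + b^2 leaves tails of |v|^{-8}. All pieces scale like
  r^{-3}: the sum 2 * 32 + 2 * 64 = 192, together with r = |x-y|/2, gives 192 * 8 = 1536.\<close>

lemma kernel_composition:
  fixes x y :: "real^5"
  assumes "x \<noteq> y"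
  shows "(\<integral>\<^sup>+z. ennreal (1 / norm (x - z) ^ 4) * ennreal (1 / norm (y - z) ^ 4) \<partial>lborel)
    \<le> ennreal (1536 * ball_vol / norm (x - y) ^ 3)"
proof -
  define r where "r = norm (x - y) / 2"
  have r: "r > 0" using assms by (simp add: r_def)
  define A where "A v = ennreal (1 / r ^ 4) * (ennreal (1 / norm v ^ 4) * indicator (ball (0::real^5) r) v)" for v
  define B where "B v = ennreal (1 / norm v ^ 8) * indicator {v::real^5. r \<le> norm v} v" for v
  have [measurable]: "A \<in> borel_measurable borel" "B \<in> borel_measurable borel"
    unfolding A_def B_def
    by (intro borel_measurable_times_ennreal borel_measurable_const borel_measurable_indicator; measurable)+
  have le1: "ennreal (1 / a ^ 4) * ennreal (1 / b ^ 4) \<le> ennreal (1 / a ^ 8) + ennreal (1 / b ^ 8)"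
    if "a \<ge> 0" "b \<ge> 0" for a b :: real
  proof -
    define p q where "p = 1 / a ^ 4" and "q = 1 / b ^ 4"
    have pq: "p \<ge> 0" "q \<ge> 0" using that by (auto simp: p_def q_def)
    have "0 \<le> p * q" using pq by simp
    then have "p * q \<le> p\<^sup>2 + q\<^sup>2" using sum_squares_bound[of p q] by linarith
    then have "ennreal (p * q) \<le> ennreal (p\<^sup>2 + q\<^sup>2)" by (rule ennreal_leI)
    then have "ennreal p * ennreal q \<le> ennreal (p\<^sup>2) + ennreal (q\<^sup>2)"
      using pq by (simp add: ennreal_mult)
    moreover have "p\<^sup>2 = 1 / a ^ 8" "q\<^sup>2 = 1 / b ^ 8" by (simp_all add: p_def q_def power_divide)
    ultimately show ?thesis by (simp add: p_def q_def)
  qed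
  have le2: "ennreal (1 / a ^ 4) * ennreal (1 / b ^ 4) \<le> ennreal (1 / r ^ 4) * ennreal (1 / a ^ 4)"
    if "a \<ge> 0" "b \<ge> r" for a b :: real
    using that r by (subst mult.commute) (intro mult_right_mono ennreal_leI divide_left_mono power_mono; auto)
  have "ennreal (1 / norm (x - z) ^ 4) * ennreal (1 / norm (y - z) ^ 4)
      \<le> A (z - x) + A (z - y) + B (z - x) + B (z - y)" for z
  proof -
    have tri: "2 * r \<le> norm (x - z) + norm (y - z)"
      using norm_triangle_ineq[of "x - z" "z - y"] by (simp add: r_def norm_minus_commute)
    consider "norm (x - z) < r" "norm (y - z) \<ge> r" | "norm (y - z) < r" "norm (x - z) \<ge> r"
      | "norm (y - z) \<ge> r" "norm (x - z) \<ge> r"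
      using tri by linarith
    then show ?thesis
    proof cases
      case 1
      then have "ennreal (1 / norm (x - z) ^ 4) * ennreal (1 / norm (y - z) ^ 4) \<le> A (z - x)"
        using le2[of "norm (x - z)" "norm (y - z)"] by (simp add: A_def norm_minus_commute)
      then show ?thesis by (simp add: add_increasing2)
    next
      case 2
      then have "ennreal (1 / norm (x - z) ^ 4) * ennreal (1 / norm (y - z) ^ 4) \<le> A (z - y)"
        using le2[of "norm (y - z)" "norm (x - z)"] by (simp add: A_def norm_minus_commute mult.commute)
      then show ?thesis by (simp add: add_increasing add_increasing2)
    next
      case 3
      then have "ennreal (1 / norm (x - z) ^ 4) * ennreal (1 / norm (y - z) ^ 4) \<le> B (z - x) + B (z - y)"
        using le1[of "norm (x - z)" "norm (y - z)"] by (simp add: B_def norm_minus_commute)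
      also have "\<dots> \<le> (A (z - x) + A (z - y)) + (B (z - x) + B (z - y))" by (rule add_increasing) auto
      finally show ?thesis by (simp add: add.assoc)
    qed
  qed
  then have "(\<integral>\<^sup>+z. ennreal (1 / norm (x - z) ^ 4) * ennreal (1 / norm (y - z) ^ 4) \<partial>lborel)
      \<le> (\<integral>\<^sup>+z. A (z - x) + A (z - y) + B (z - x) + B (z - y) \<partial>lborel)"
    by (intro nn_integral_mono) auto
  also have "\<dots> = (\<integral>\<^sup>+z. A z \<partial>lborel) + (\<integral>\<^sup>+z. A z \<partial>lborel) + (\<integral>\<^sup>+z. B z \<partial>lborel) + (\<integral>\<^sup>+z. B z \<partial>lborel)"
    by (simp add: nn_integral_add nn_integral_shift)
  also have "\<dots> \<le> ennreal (32 * ball_vol / r ^ 3) + ennreal (32 * ball_vol / r ^ 3)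
      + ennreal (64 * ball_vol / r ^ 3) + ennreal (64 * ball_vol / r ^ 3)"
  proof -
    have "(\<integral>\<^sup>+z. A z \<partial>lborel) \<le> ennreal (1 / r ^ 4) * ennreal (32 * ball_vol * r)"
      unfolding A_def by (subst nn_integral_cmult) (auto intro!: mult_left_mono kernel_inside r)
    also have "\<dots> = ennreal (32 * ball_vol / r ^ 3)"
      using r by (subst ennreal_mult[symmetric]) (auto simp: field_simps eval_nat_numeral)
    finally have A: "(\<integral>\<^sup>+z. A z \<partial>lborel) \<le> ennreal (32 * ball_vol / r ^ 3)" .
    have "64 * ball_vol * r ^ 5 / r ^ 8 = 64 * ball_vol / r ^ 3"
      using r by (simp add: field_simps eval_nat_numeral)
    then have B: "(\<integral>\<^sup>+z. B z \<partial>lborel) \<le> ennreal (64 * ball_vol / r ^ 3)"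
      unfolding B_def using kernel_outside[OF r, of 8] by simp
    from A B show ?thesis by (intro add_mono)
  qed
  also have "\<dots> = ennreal (192 * ball_vol / r ^ 3)"
    using r by (simp flip: ennreal_plus add_divide_distrib)
  also have "192 * ball_vol / r ^ 3 = 1536 * ball_vol / norm (x - y) ^ 3"
    by (simp add: r_def power_divide)
  finally show ?thesis .
qed

section \<open>Recovering a function from the convolutions with a regularised Riesz kernel\<close>

lemma integral_affine:
  fixes f :: "'a::euclidean_space \<Rightarrow> real"
  assumes [measurable]: "f \<in> borel_measurable borel" and e: "e > 0"
  shows "(\<integral>y. f y \<partial>lborel) = e ^ DIM('a) * (\<integral>z. f (a + e *\<^sub>R z) \<partial>lborel)"
    and "integrable lborel f \<longleftrightarrow> integrable lborel (\<lambda>z. f (a + e *\<^sub>R z))"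
proof -
  have eq: "(lborel :: 'a measure) = density (distr lborel borel (\<lambda>z. a + e *\<^sub>R z)) (\<lambda>_. ennreal (e ^ DIM('a)))"
    using lborel_affine[of e a] e by (simp add: ennreal_power)
  show "(\<integral>y. f y \<partial>lborel) = e ^ DIM('a) * (\<integral>z. f (a + e *\<^sub>R z) \<partial>lborel)"
    by (subst eq, subst integral_density) (use e in \<open>auto simp: integral_distr\<close>)
  show "integrable lborel f \<longleftrightarrow> integrable lborel (\<lambda>z. f (a + e *\<^sub>R z))"
    by (subst eq, subst integrable_density) (use e in \<open>auto simp: integrable_distr_eq\<close>)
qed

text \<open>One fifth of the divergence of z (1 + |z|^2)^{-5/2}, a smoothing of the field z / |z|^5,
  whose divergence is a multiple of the Dirac mass.\<close>

definition bubble :: "real^5 \<Rightarrow> real" where "bubble z = (1 + (norm z)\<^sup>2) powr (-7/2)"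

text \<open>The rescaling e^{-5} bubble(v/e): an even approximate identity of total mass
  \<open>bubble_mass\<close> instead of 1.\<close>

definition regular_kernel :: "real \<Rightarrow> real^5 \<Rightarrow> real" where
  "regular_kernel e v = e\<^sup>2 * (e\<^sup>2 + (norm v)\<^sup>2) powr (-7/2)"

lemma bubble_measurable [measurable]: "bubble \<in> borel_measurable borel"
  unfolding bubble_def[abs_def] by measurable

lemma regular_kernel_measurable [measurable]: "regular_kernel e \<in> borel_measurable borel"
  unfolding regular_kernel_def[abs_def] by measurable

lemma regular_kernel_nonneg: "regular_kernel e v \<ge> 0"
  by (simp add: regular_kernel_def)

lemma bubble_pos: "bubble z > 0"
  unfolding bubble_def by (smt (verit) powr_gt_zero zero_le_power2)

lemma regular_kernel_scale:
  assumes "e > 0"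
  shows "e ^ 5 * regular_kernel e (e *\<^sub>R z) = bubble z"
proof -
  have "regular_kernel e (e *\<^sub>R z) = e\<^sup>2 * (e\<^sup>2 * (1 + (norm z)\<^sup>2)) powr (-7/2)"
    by (simp add: regular_kernel_def power_mult_distrib algebra_simps)
  also have "\<dots> = e\<^sup>2 * ((e\<^sup>2) powr (-7/2) * bubble z)"
    by (simp add: bubble_def powr_mult)
  also have "(e\<^sup>2) powr (-7/2) = e powr (-7)"
    using assms by (simp add: powr_powr flip: powr_numeral)
  finally have "e ^ 5 * regular_kernel e (e *\<^sub>R z) = (e powr 5 * e powr 2 * e powr (-7)) * bubble z"
    using assms by (simp add: mult.assoc)
  also have "e powr 5 * e powr 2 * e powr (-7) = 1"
    using assms by (simp add: powr_minus field_simps)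
  finally show ?thesis by simp
qed

lemma bubble_integrable: "integrable lborel bubble"
proof (rule integrableI_nonneg)
  have le: "ennreal (bubble z) \<le> indicator (ball 0 1) z + ennreal (1 / norm z ^ 7) * indicator {z. 1 \<le> norm z} z" for z
  proof (cases "norm z < 1")
    case True
    have "bubble z \<le> (1 + (norm z)\<^sup>2) powr 0" unfolding bubble_def by (intro powr_mono) auto
    then have "bubble z \<le> 1" by (simp add: add_nonneg_eq_0_iff split: if_splits)
    then show ?thesis using True by (simp add: ennreal_le_1)
  next
    case False
    have "bubble z \<le> ((norm z)\<^sup>2) powr (-7/2)" unfolding bubble_def
      using False by (intro powr_mono2') auto
    also have "\<dots> = norm z powr (-7)" using False by (simp add: powr_powr flip: powr_numeral)
    also have "\<dots> = 1 / norm z ^ 7" using False by (simp add: powr_minus_divide)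
    finally show ?thesis using False by (auto intro!: ennreal_leI)
  qed
  have "(\<integral>\<^sup>+z. ennreal (bubble z) \<partial>lborel) 
    \<le> (\<integral>\<^sup>+z. indicator (ball 0 1) z + ennreal (1 / norm z ^ 7) * indicator {z::real^5. 1 \<le> norm z} z \<partial>lborel)"
    by (intro nn_integral_mono le)
  also have "\<dots> = emeasure lborel (ball (0::real^5) 1) + (\<integral>\<^sup>+z. ennreal (1 / norm z ^ 7) * indicator {z::real^5. 1 \<le> norm z} z \<partial>lborel)"
    by (subst nn_integral_add) auto
  also have "\<dots> < \<infinity>"
    using order.strict_trans1[OF kernel_outside[of 1 7]] by (simp add: emeasure_ball5)
  finally show "(\<integral>\<^sup>+z. ennreal (bubble z) \<partial>lborel) < \<infinity>" .
qed (auto simp: bubble_pos less_imp_le)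

definition bubble_mass :: real where "bubble_mass = (\<integral>z. bubble z \<partial>lborel)"

lemma bubble_mass_pos: "bubble_mass > 0"
proof -
  have "bubble_mass \<noteq> 0"
  proof
    assume "bubble_mass = 0"
    then have "AE z in lborel. bubble z = 0"
      using integral_nonneg_eq_0_iff_AE[OF bubble_integrable] bubble_pos by (auto simp: bubble_mass_def less_imp_le)
    then have "AE z in (lborel :: (real^5) measure). False"
      by eventually_elim (metis bubble_pos less_irrefl)
    then show False by (simp add: AE_iff_measurable[OF _ refl])
  qed
  moreover have "bubble_mass \<ge> 0"
    unfolding bubble_mass_def by (rule Bochner_Integration.integral_nonneg) (simp add: bubble_pos less_imp_le)
  ultimately show ?thesis by simp
qed

lemma regular_kernel_convolution:
  assumes [measurable]: "h \<in> borel_measurable borel" and e: "e > 0"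
  shows "(\<integral>y. h y * regular_kernel e (x - y) \<partial>lborel) = (\<integral>z. h (x + e *\<^sub>R z) * bubble z \<partial>lborel)"
    and "integrable lborel (\<lambda>y. h y * regular_kernel e (x - y)) \<longleftrightarrow> integrable lborel (\<lambda>z. h (x + e *\<^sub>R z) * bubble z)"
proof -
  have *: "e ^ 5 * (h (x + e *\<^sub>R z) * regular_kernel e (- (e *\<^sub>R z))) = h (x + e *\<^sub>R z) * bubble z" for z
    using regular_kernel_scale[OF e, of z] by (simp add: regular_kernel_def mult_ac)
  show "(\<integral>y. h y * regular_kernel e (x - y) \<partial>lborel) = (\<integral>z. h (x + e *\<^sub>R z) * bubble z \<partial>lborel)"
    by (subst integral_affine(1)[OF _ e, where a=x]) (simp_all add: * flip: integral_mult_right_zero)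
  have "integrable lborel (\<lambda>z. h (x + e *\<^sub>R z) * regular_kernel e (- (e *\<^sub>R z)))
     \<longleftrightarrow> integrable lborel (\<lambda>z. e ^ 5 * (h (x + e *\<^sub>R z) * regular_kernel e (- (e *\<^sub>R z))))"
    using e by simp
  then show "integrable lborel (\<lambda>y. h y * regular_kernel e (x - y)) \<longleftrightarrow> integrable lborel (\<lambda>z. h (x + e *\<^sub>R z) * bubble z)"
    by (subst integral_affine(2)[OF _ e, where a=x]) (auto simp: *)
qed

context
  fixes w :: "real^5 \<Rightarrow> real" and g :: "real^5 \<Rightarrow> ennreal"
  assumes w: "integrable lborel w" and g [measurable]: "g \<in> borel_measurable borel"
    and g_finite: "(\<integral>\<^sup>+x. g x \<partial>lborel) < \<infinity>"
    and rep: "\<And>e y. e > 0 \<Longrightarrow> ennreal \<bar>\<integral>x. w x * regular_kernel e (x - y) \<partial>lborel\<bar> \<le> riesz g y"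
begin

private lemma w_meas [measurable]: "w \<in> borel_measurable borel"
  using w by auto

text \<open>Fubini moves the regularised kernel from \<open>w\<close> to \<open>h\<close>, and
  \<open>rep\<close> bounds the inner integral for each \<open>y\<close> by a quantity free of
  \<open>e\<close>. As e tends to 0 the mollifications of \<open>h\<close> converge pointwise to
  \<open>bubble_mass * h\<close> and stay below \<open>bubble_mass\<close>, so dominated convergence
  applies against the integrable \<open>w\<close>.\<close>

lemma continuous_pairing:
  assumes h: "continuous_on UNIV h" and b: "\<And>x. \<bar>h x\<bar> \<le> 1"
  shows "ennreal \<bar>bubble_mass * (\<integral>x. w x * h x \<partial>lborel)\<bar> \<le> (\<integral>\<^sup>+y. ennreal \<bar>h y\<bar> * riesz g y \<partial>lborel)"
proof -
  have [measurable]: "h \<in> borel_measurable borel" using h by (rule borel_measurable_continuous_onI)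
  have hb: "\<bar>h x\<bar> * bubble z \<le> bubble z" for x z
    using mult_right_mono[OF b, of "bubble z" x] bubble_pos[of z] by simp
  have bubble_abs: "\<bar>bubble z\<bar> = bubble z" for z using bubble_pos[of z] by simp
  have int_h: "integrable lborel (\<lambda>z. h (x + e *\<^sub>R z) * bubble z)" for x e
    by (rule Bochner_Integration.integrable_bound[OF bubble_integrable])
      (auto simp: abs_mult bubble_abs hb)
  have int_abs: "integrable lborel (\<lambda>z. \<bar>h (x + e *\<^sub>R z)\<bar> * bubble z)" for x e
    using integrable_abs[OF int_h[of x e]] by (simp add: abs_mult bubble_pos less_imp_le)
  have abs_le: "(\<integral>z. \<bar>h (x + e *\<^sub>R z)\<bar> * bubble z \<partial>lborel) \<le> bubble_mass" for x e
    unfolding bubble_mass_def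
    by (rule integral_mono[OF int_abs bubble_integrable]) (rule hb)
  define K where "K e x = (\<integral>y. h y * regular_kernel e (x - y) \<partial>lborel)" for e x
  have K: "K e x = (\<integral>z. h (x + e *\<^sub>R z) * bubble z \<partial>lborel)" if "e > 0" for e x
    unfolding K_def by (rule regular_kernel_convolution) (use that in auto)
  have K_le: "\<bar>K e x\<bar> \<le> bubble_mass" if "e > 0" for e x
  proof -
    have "\<bar>K e x\<bar> \<le> (\<integral>z. \<bar>h (x + e *\<^sub>R z) * bubble z\<bar> \<partial>lborel)"
      unfolding K[OF that] by (rule integral_abs_bound)
    also have "\<dots> \<le> bubble_mass" using abs_le[of x e] by (simp add: abs_mult bubble_pos less_imp_le)
    finally show ?thesis .
  qed
  have [measurable]: "K e \<in> borel_measurable borel" for e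
    unfolding K_def[abs_def] by measurable
  define eps where "eps n = inverse (real (Suc n))" for n
  have eps: "eps n > 0" "eps \<longlonglongrightarrow> 0" for n
    unfolding eps_def using LIMSEQ_inverse_real_of_nat by auto
  have lim_K: "(\<lambda>n. K (eps n) x) \<longlonglongrightarrow> bubble_mass * h x" for x
  proof -
    have "(\<lambda>n. \<integral>z. h (x + eps n *\<^sub>R z) * bubble z \<partial>lborel) \<longlonglongrightarrow> (\<integral>z. h x * bubble z \<partial>lborel)"
    proof (rule integral_dominated_convergence[where w=bubble])
      show "AE z in lborel. (\<lambda>n. h (x + eps n *\<^sub>R z) * bubble z) \<longlonglongrightarrow> h x * bubble z"
      proof (rule AE_I2)
        fix z
        have "(\<lambda>n. x + eps n *\<^sub>R z) \<longlonglongrightarrow> x + 0 *\<^sub>R z" by (intro tendsto_intros eps)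
        then have "(\<lambda>n. h (x + eps n *\<^sub>R z)) \<longlonglongrightarrow> h x"
          using h by (intro continuous_on_tendsto_compose[OF h]) auto
        then show "(\<lambda>n. h (x + eps n *\<^sub>R z) * bubble z) \<longlonglongrightarrow> h x * bubble z" by (intro tendsto_intros)
      qed
    qed (auto simp: abs_mult bubble_integrable bubble_abs hb)
    then show ?thesis by (simp add: K eps bubble_mass_def mult.commute)
  qed
  have lim: "(\<lambda>n. \<integral>x. w x * K (eps n) x \<partial>lborel) \<longlonglongrightarrow> (\<integral>x. w x * (bubble_mass * h x) \<partial>lborel)"
  proof (rule integral_dominated_convergence[where w="\<lambda>x. bubble_mass * \<bar>w x\<bar>"])
    show "integrable lborel (\<lambda>x. bubble_mass * \<bar>w x\<bar>)" using w by simp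
    show "AE x in lborel. norm (w x * K (eps n) x) \<le> bubble_mass * \<bar>w x\<bar>" for n
    proof (rule AE_I2)
      show "norm (w x * K (eps n) x) \<le> bubble_mass * \<bar>w x\<bar>" for x
        using mult_right_mono[OF K_le[OF eps(1)], of "\<bar>w x\<bar>" n x] by (simp add: abs_mult mult.commute)
    qed
    show "AE x in lborel. (\<lambda>n. w x * K (eps n) x) \<longlonglongrightarrow> w x * (bubble_mass * h x)"
      by (intro AE_I2 tendsto_intros lim_K)
  qed measurable
  have bound: "ennreal \<bar>\<integral>x. w x * K e x \<partial>lborel\<bar> \<le> (\<integral>\<^sup>+y. ennreal \<bar>h y\<bar> * riesz g y \<partial>lborel)" if e: "e > 0" for e
  proof -
    define f where "f x y = w x * (h y * regular_kernel e (x - y))" for x y :: "real^5"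
    have [measurable]: "case_prod f \<in> borel_measurable (lborel \<Otimes>\<^sub>M lborel)"
      unfolding f_def by measurable
    have int: "integrable (lborel \<Otimes>\<^sub>M lborel) (case_prod f)"
    proof (rule lborel_pair.Fubini_integrable)
      have e1: "(\<integral>y. norm (case_prod f (x, y)) \<partial>lborel) = \<bar>w x\<bar> * (\<integral>z. \<bar>h (x + e *\<^sub>R z)\<bar> * bubble z \<partial>lborel)" for x
      proof -
        have "(\<integral>y. norm (case_prod f (x, y)) \<partial>lborel) = (\<integral>y. \<bar>w x\<bar> * (\<bar>h y\<bar> * regular_kernel e (x - y)) \<partial>lborel)"
          by (simp add: f_def abs_mult regular_kernel_nonneg)
        then show ?thesis using regular_kernel_convolution(1)[OF _ e, of "\<lambda>y. \<bar>h y\<bar>" x] by simp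
      qed
      show "integrable lborel (\<lambda>x. \<integral>y. norm (case_prod f (x, y)) \<partial>lborel)"
        unfolding e1
      proof (rule Bochner_Integration.integrable_bound)
        show "integrable lborel (\<lambda>x. bubble_mass * \<bar>w x\<bar>)" using w by simp
        show "AE x in lborel. norm (\<bar>w x\<bar> * (\<integral>z. \<bar>h (x + e *\<^sub>R z)\<bar> * bubble z \<partial>lborel)) \<le> norm (bubble_mass * \<bar>w x\<bar>)"
        proof (rule AE_I2)
          fix x
          have "0 \<le> (\<integral>z. \<bar>h (x + e *\<^sub>R z)\<bar> * bubble z \<partial>lborel)"
            by (rule Bochner_Integration.integral_nonneg) (simp add: bubble_pos less_imp_le)
          then show "norm (\<bar>w x\<bar> * (\<integral>z. \<bar>h (x + e *\<^sub>R z)\<bar> * bubble z \<partial>lborel)) \<le> norm (bubble_mass * \<bar>w x\<bar>)"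
            using mult_right_mono[OF abs_le[of x e], of "\<bar>w x\<bar>"] bubble_mass_pos by (simp add: abs_mult mult.commute)
        qed
      qed measurable
      show "AE x in lborel. integrable lborel (\<lambda>y. case_prod f (x, y))"
        using regular_kernel_convolution(2)[OF _ e, of h] int_h by (auto simp: f_def)
    qed measurable
    have "(\<integral>x. w x * K e x \<partial>lborel) = (\<integral>x. \<integral>y. f x y \<partial>lborel \<partial>lborel)"
      by (simp add: f_def K_def)
    also have "\<dots> = (\<integral>y. \<integral>x. f x y \<partial>lborel \<partial>lborel)"
      using lborel_pair.Fubini_integral[OF int] by simp
    finally have eq: "(\<integral>x. w x * K e x \<partial>lborel) = (\<integral>y. \<integral>x. f x y \<partial>lborel \<partial>lborel)" .
    have "integrable lborel (\<lambda>y. \<integral>x. f x y \<partial>lborel)"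
      using lborel_pair.integrable_snd[OF int] .
    then have "ennreal (norm (\<integral>y. \<integral>x. f x y \<partial>lborel \<partial>lborel)) \<le> (\<integral>\<^sup>+y. ennreal (norm (\<integral>x. f x y \<partial>lborel)) \<partial>lborel)"
      by (rule integral_norm_bound_ennreal)
    also have "\<dots> \<le> (\<integral>\<^sup>+y. ennreal \<bar>h y\<bar> * riesz g y \<partial>lborel)"
    proof (rule nn_integral_mono)
      fix y
      have "(\<integral>x. f x y \<partial>lborel) = h y * (\<integral>x. w x * regular_kernel e (x - y) \<partial>lborel)"
        by (simp add: f_def mult_ac flip: integral_mult_right_zero)
      then have "ennreal (norm (\<integral>x. f x y \<partial>lborel)) = ennreal \<bar>h y\<bar> * ennreal \<bar>\<integral>x. w x * regular_kernel e (x - y) \<partial>lborel\<bar>"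
        by (simp add: abs_mult ennreal_mult)
      also have "\<dots> \<le> ennreal \<bar>h y\<bar> * riesz g y"
        by (intro mult_left_mono rep e) auto
      finally show "ennreal (norm (\<integral>x. f x y \<partial>lborel)) \<le> ennreal \<bar>h y\<bar> * riesz g y" .
    qed
    finally show ?thesis by (simp add: eq)
  qed
  have "(\<lambda>n. ennreal \<bar>\<integral>x. w x * K (eps n) x \<partial>lborel\<bar>) \<longlonglongrightarrow> ennreal \<bar>\<integral>x. w x * (bubble_mass * h x) \<partial>lborel\<bar>"
    by (intro tendsto_intros lim)
  then have "ennreal \<bar>\<integral>x. w x * (bubble_mass * h x) \<partial>lborel\<bar> \<le> (\<integral>\<^sup>+y. ennreal \<bar>h y\<bar> * riesz g y \<partial>lborel)"
    by (rule LIMSEQ_le_const2) (use bound eps(1) in auto)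
  moreover have "(\<integral>x. w x * (bubble_mass * h x) \<partial>lborel) = bubble_mass * (\<integral>x. w x * h x \<partial>lborel)"
    by (simp add: mult_ac flip: integral_mult_right_zero)
  ultimately show ?thesis by simp
qed

text \<open>By Tonelli it suffices that the kernel around any \<open>x\<close> has integral at most
  \<open>C\<close> over the ball: within distance one use \<open>kernel_inside\<close>, beyond it
  the kernel is at most 1. The finiteness provides the dominating function in
  \<open>bounded_pairing\<close> and permits the subtraction in
  \<open>bubble_mass_le_riesz\<close>.\<close>

lemma riesz_finite_ball: "(\<integral>\<^sup>+y. indicator (ball 0 N) y * riesz g y \<partial>lborel) < \<infinity>"
proof -
  define B where "B v = ennreal (1 / norm v ^ 4) * indicator (ball (0::real^5) 1) v" for v
  have [measurable]: "B \<in> borel_measurable borel" unfolding B_def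
    by (intro borel_measurable_times_ennreal borel_measurable_const borel_measurable_indicator; measurable)
  define C where "C = ennreal (32 * ball_vol) + emeasure lborel (ball (0::real^5) N)"
  have C: "C < \<infinity>"
    using emeasure_lborel_ball_finite[of "0::real^5" N] by (simp add: C_def)
  have le: "(\<integral>\<^sup>+y. indicator (ball 0 N) y * ennreal (1 / norm (x - y) ^ 4) \<partial>lborel) \<le> C" for x :: "real^5"
  proof -
    have "indicator (ball 0 N) y * ennreal (1 / norm (x - y) ^ 4) \<le> B (y - x) + indicator (ball 0 N) y" for y :: "real^5"
    proof (cases "norm (x - y) < 1")
      case True
      then show ?thesis by (auto simp: B_def norm_minus_commute indicator_def)
    next
      case False
      then have "1 / norm (x - y) ^ 4 \<le> 1" using frac_le[of 1 1 1 "norm (x - y) ^ 4"] one_le_power[of "norm (x - y)" 4] by simp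
      then show ?thesis by (auto simp: indicator_def ennreal_le_1 add_increasing)
    qed
    then have "(\<integral>\<^sup>+y. indicator (ball 0 N) y * ennreal (1 / norm (x - y) ^ 4) \<partial>lborel) \<le> (\<integral>\<^sup>+y. B (y - x) + indicator (ball 0 N) y \<partial>lborel)"
      by (intro nn_integral_mono) auto
    also have "\<dots> = (\<integral>\<^sup>+y. B y \<partial>lborel) + emeasure lborel (ball (0::real^5) N)"
      by (simp add: nn_integral_add nn_integral_shift)
    also have "\<dots> \<le> C" unfolding C_def B_def using kernel_inside[of 1] by (intro add_mono) auto
    finally show ?thesis .
  qed
  have "(\<integral>\<^sup>+y. indicator (ball 0 N) y * riesz g y \<partial>lborel)
     = (\<integral>\<^sup>+y. \<integral>\<^sup>+x. indicator (ball 0 N) y * (g x * ennreal (1 / norm (x - y) ^ 4)) \<partial>lborel \<partial>lborel)"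
    unfolding riesz_def by (intro nn_integral_cong nn_integral_cmult[symmetric]) measurable
  also have "\<dots> = (\<integral>\<^sup>+x. \<integral>\<^sup>+y. indicator (ball 0 N) y * (g x * ennreal (1 / norm (x - y) ^ 4)) \<partial>lborel \<partial>lborel)"
    by (rule lborel_pair.Fubini') measurable
  also have "\<dots> = (\<integral>\<^sup>+x. g x * (\<integral>\<^sup>+y. indicator (ball 0 N) y * ennreal (1 / norm (x - y) ^ 4) \<partial>lborel) \<partial>lborel)"
    by (intro nn_integral_cong, subst nn_integral_cmult[symmetric]) (auto simp: mult_ac)
  also have "\<dots> \<le> (\<integral>\<^sup>+x. g x * C \<partial>lborel)" by (intro nn_integral_mono mult_left_mono le) auto
  also have "\<dots> = (\<integral>\<^sup>+x. g x \<partial>lborel) * C" by (rule nn_integral_multc) simp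
  also have "\<dots> < \<infinity>" using C g_finite by (simp add: ennreal_mult_less_top)
  finally show ?thesis .
qed

text \<open>A measurable function is an almost everywhere limit of continuous ones. Clipping their
  values to [-1,1] and multiplying by a compactly supported factor preserves the limit
  \<open>h\<close> and dominates both sides of the continuous case.\<close>

lemma bounded_pairing:
  assumes [measurable]: "h \<in> borel_measurable borel"
    and b: "\<And>x. \<bar>h x\<bar> \<le> 1" and supp: "\<And>x. x \<notin> ball 0 N \<Longrightarrow> h x = 0"
  shows "ennreal \<bar>bubble_mass * (\<integral>x. w x * h x \<partial>lborel)\<bar> \<le> (\<integral>\<^sup>+y. ennreal \<bar>h y\<bar> * riesz g y \<partial>lborel)"
proof -
  have "h \<in> borel_measurable lebesgue" by (rule measurable_completion) simp
  then have "h measurable_on UNIV"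
    by (intro lebesgue_measurable_imp_measurable_on) auto
  then obtain Z f where Z: "negligible Z" and f: "\<And>n. continuous_on UNIV (f n)"
    and lim_f: "\<And>x. x \<notin> Z \<Longrightarrow> (\<lambda>n. f n x) \<longlonglongrightarrow> h x"
    unfolding measurable_on_def by auto
  have AE_Z: "AE x in lborel. x \<notin> Z"
    using AE_not_in[of Z lebesgue] Z by (simp only: negligible_iff_null_sets AE_completion_iff)
  \<comment> \<open>Equal to 1 on the ball of radius \<open>N\<close>, where \<open>h\<close> lives,
    and to 0 beyond radius \<open>N + 1\<close>.\<close>
  define c where "c x = max 0 (min 1 (N + 1 - norm x))" for x :: "real^5"
  define k where "k n x = c x * max (-1) (min 1 (f n x))" for n x
  have c: "0 \<le> c x" "c x \<le> 1" for x by (auto simp: c_def)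
  have cont: "continuous_on UNIV (k n)" for n
    unfolding k_def[abs_def] c_def by (intro continuous_intros f)
  then have [measurable]: "k n \<in> borel_measurable borel" for n by (rule borel_measurable_continuous_onI)
  have k1: "\<bar>k n x\<bar> \<le> 1" for n x
  proof -
    have "\<bar>k n x\<bar> \<le> 1 * 1" unfolding k_def abs_mult using c[of x] by (intro mult_mono) auto
    then show ?thesis by simp
  qed
  have k_supp: "\<bar>k n x\<bar> \<le> indicator (ball 0 (N + 1)) x" for n x
    using k1[of n x] by (auto simp: indicator_def k_def c_def)
  have lim: "(\<lambda>n. k n x) \<longlonglongrightarrow> h x" if "x \<notin> Z" for x
  proof -
    have "(\<lambda>n. k n x) \<longlonglongrightarrow> c x * max (-1) (min 1 (h x))"
      unfolding k_def by (intro tendsto_intros lim_f that)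
    also have "max (-1) (min 1 (h x)) = h x" using b[of x] by auto
    also have "c x * h x = h x" using supp[of x] by (cases "x \<in> ball 0 N") (auto simp: c_def)
    finally show ?thesis .
  qed
  have "(\<lambda>n. \<integral>x. w x * k n x \<partial>lborel) \<longlonglongrightarrow> (\<integral>x. w x * h x \<partial>lborel)"
  proof (rule integral_dominated_convergence[where w="\<lambda>x. \<bar>w x\<bar>"])
    show "AE x in lborel. (\<lambda>n. w x * k n x) \<longlonglongrightarrow> w x * h x"
      using AE_Z by eventually_elim (intro tendsto_intros lim)
    show "AE x in lborel. norm (w x * k n x) \<le> \<bar>w x\<bar>" for n
    proof (rule AE_I2)
      show "norm (w x * k n x) \<le> \<bar>w x\<bar>" for x
        using mult_left_mono[OF k1[of n x], of "\<bar>w x\<bar>"] by (simp add: abs_mult)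
    qed
  qed (use w in auto)
  then have l1: "(\<lambda>n. ennreal \<bar>bubble_mass * (\<integral>x. w x * k n x \<partial>lborel)\<bar>) \<longlonglongrightarrow> ennreal \<bar>bubble_mass * (\<integral>x. w x * h x \<partial>lborel)\<bar>"
    by (intro tendsto_intros)
  have l2: "(\<lambda>n. \<integral>\<^sup>+y. ennreal \<bar>k n y\<bar> * riesz g y \<partial>lborel) \<longlonglongrightarrow> (\<integral>\<^sup>+y. ennreal \<bar>h y\<bar> * riesz g y \<partial>lborel)"
  proof (rule nn_integral_dominated_convergence[where w="\<lambda>y. indicator (ball 0 (N + 1)) y * riesz g y"])
    show "AE y in lborel. ennreal \<bar>k n y\<bar> * riesz g y \<le> indicator (ball 0 (N + 1)) y * riesz g y" for n
    proof (intro AE_I2 mult_right_mono)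
      show "ennreal \<bar>k n y\<bar> \<le> indicator (ball 0 (N + 1)) y" for y
        using ennreal_leI[OF k_supp[of n y]] by (simp add: ennreal_indicator)
    qed auto
    show "(\<integral>\<^sup>+y. indicator (ball 0 (N + 1)) y * riesz g y \<partial>lborel) < \<infinity>" by (rule riesz_finite_ball)
    \<comment> \<open>Multiplication in \<open>ennreal\<close> is discontinuous at 0 times infinity,
      so the limit of the products needs the potential to be finite.\<close>
    have "AE y in lborel. riesz g y \<noteq> \<infinity>"
    proof -
      have "AE y in lborel. indicator (ball 0 (real n)) y * riesz g y \<noteq> \<infinity>" for n :: nat
        by (rule nn_integral_PInf_AE) (use riesz_finite_ball[of "real n"] in \<open>auto simp: less_top\<close>)
      then have "AE y in lborel. \<forall>n::nat. indicator (ball 0 (real n)) y * riesz g y \<noteq> \<infinity>"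
        by (simp add: AE_all_countable)
      then show ?thesis
      proof eventually_elim
        case (elim y)
        obtain n :: nat where "norm y < real n" using reals_Archimedean2 by blast
        then show ?case using elim[rule_format, of n] by (auto simp: indicator_def)
      qed
    qed
    with AE_Z show "AE y in lborel. (\<lambda>n. ennreal \<bar>k n y\<bar> * riesz g y) \<longlonglongrightarrow> ennreal \<bar>h y\<bar> * riesz g y"
    proof eventually_elim
      case (elim y)
      have "(\<lambda>n. ennreal \<bar>k n y\<bar>) \<longlonglongrightarrow> ennreal \<bar>h y\<bar>" by (intro tendsto_intros lim elim)
      then show ?case using elim by (intro tendsto_mult_ennreal tendsto_const) auto
    qed
  qed measurable
  show ?thesis
    by (rule LIMSEQ_le[OF l1 l2]) (use continuous_pairing[OF cont k1] in auto)
qed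

text \<open>Pair with the indicator of the set \<open>A\<close> where the inequality fails inside a
  ball. There \<open>bubble_mass * w\<close> strictly exceeds the potential, yet its integral over
  \<open>A\<close> is at most that of the potential, which is finite; hence \<open>A\<close> is
  null.\<close>

lemma bubble_mass_le_riesz: "AE y in lborel. ennreal (bubble_mass * w y) \<le> riesz g y"
proof -
  have "AE y in lborel. y \<in> ball 0 (real n) \<longrightarrow> ennreal (bubble_mass * w y) \<le> riesz g y" for n :: nat
  proof -
    define A where "A = {y \<in> ball 0 (real n). riesz g y < ennreal (bubble_mass * w y)}"
    have [measurable]: "A \<in> sets borel" unfolding A_def by measurable
    define a where "a y = ennreal (bubble_mass * w y) * indicator A y" for y
    define b where "b y = riesz g y * indicator A y" for y
    have [measurable]: "a \<in> borel_measurable borel" "b \<in> borel_measurable borel"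
      unfolding a_def b_def by measurable
    have wA: "w y > 0" if "y \<in> A" for y
    proof -
      have "ennreal (bubble_mass * w y) \<noteq> 0" using that by (auto simp: A_def)
      then have "bubble_mass * w y > 0" by (simp add: ennreal_eq_0_iff)
      then show ?thesis using bubble_mass_pos by (simp add: zero_less_mult_iff)
    qed
    have int: "integrable lborel (\<lambda>y. bubble_mass * (w y * indicator A y))"
      using integrable_real_mult_indicator[OF _ w, of A] by simp
    have "(\<integral>\<^sup>+y. a y \<partial>lborel) = (\<integral>\<^sup>+y. ennreal (bubble_mass * (w y * indicator A y)) \<partial>lborel)"
      unfolding a_def by (intro nn_integral_cong) (auto simp: indicator_def)
    also have "\<dots> = ennreal (\<integral>y. bubble_mass * (w y * indicator A y) \<partial>lborel)"
      by (rule nn_integral_eq_integral[OF int])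
        (use wA bubble_mass_pos in \<open>auto simp: indicator_def less_imp_le\<close>)
    also have "\<dots> \<le> ennreal \<bar>bubble_mass * (\<integral>y. w y * indicator A y \<partial>lborel)\<bar>"
      by (intro ennreal_leI) simp
    also have "\<dots> \<le> (\<integral>\<^sup>+y. ennreal \<bar>indicator A y\<bar> * riesz g y \<partial>lborel)"
      by (rule bounded_pairing[where N="real n"]) (auto simp: indicator_def A_def)
    also have "\<dots> = (\<integral>\<^sup>+y. b y \<partial>lborel)"
      unfolding b_def by (intro nn_integral_cong) (auto simp: indicator_def)
    finally have ab: "(\<integral>\<^sup>+y. a y \<partial>lborel) \<le> (\<integral>\<^sup>+y. b y \<partial>lborel)" .
    have "(\<integral>\<^sup>+y. b y \<partial>lborel) \<le> (\<integral>\<^sup>+y. indicator (ball 0 (real n)) y * riesz g y \<partial>lborel)"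
      unfolding b_def by (intro nn_integral_mono) (auto simp: indicator_def A_def)
    also have "\<dots> < \<infinity>" by (rule riesz_finite_ball)
    finally have fin: "(\<integral>\<^sup>+y. b y \<partial>lborel) \<noteq> \<infinity>" by auto
    have "b y \<le> a y" for y by (auto simp: a_def b_def A_def indicator_def)
    then have "(\<integral>\<^sup>+y. a y - b y \<partial>lborel) = (\<integral>\<^sup>+y. a y \<partial>lborel) - (\<integral>\<^sup>+y. b y \<partial>lborel)"
      by (intro nn_integral_diff fin) auto
    also have "\<dots> = 0" using ab fin by (simp add: diff_eq_0_iff_ennreal less_top)
    finally have "AE y in lborel. a y - b y = 0" by (subst (asm) nn_integral_0_iff_AE) auto
    then show ?thesis
    proof eventually_elim
      case (elim y)
      show ?case
      proof (rule impI, rule ccontr)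
        assume "y \<in> ball 0 (real n)" "\<not> ennreal (bubble_mass * w y) \<le> riesz g y"
        then have "y \<in> A" by (auto simp: A_def)
        then have "b y < a y" by (auto simp: a_def b_def A_def)
        then show False using elim by (meson diff_eq_0_iff_ennreal leD)
      qed
    qed
  qed
  then have "AE y in lborel. \<forall>n::nat. y \<in> ball 0 (real n) \<longrightarrow> ennreal (bubble_mass * w y) \<le> riesz g y"
    unfolding AE_all_countable by blast
  then show ?thesis
  proof eventually_elim
    case (elim y)
    obtain n :: nat where "norm y < real n" using reals_Archimedean2 by blast
    then show ?case using elim[rule_format, of n] by auto
  qed
qed

end

lemma abs_le_riesz:
  assumes "integrable lborel w" "g \<in> borel_measurable borel" "(\<integral>\<^sup>+x. g x \<partial>lborel) < \<infinity>"
    and "\<And>e y. e > 0 \<Longrightarrow> ennreal \<bar>\<integral>x. w x * regular_kernel e (x - y) \<partial>lborel\<bar> \<le> riesz g y"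
  shows "AE y in lborel. ennreal (bubble_mass * \<bar>w y\<bar>) \<le> riesz g y"
proof -
  have "AE y in lborel. ennreal (bubble_mass * - w y) \<le> riesz g y"
    by (rule bubble_mass_le_riesz) (use assms in auto)
  moreover have "AE y in lborel. ennreal (bubble_mass * w y) \<le> riesz g y"
    by (rule bubble_mass_le_riesz) (use assms in auto)
  ultimately show ?thesis
    by eventually_elim (auto simp: abs_if)
qed

section \<open>The trace inequality for the measure h dx\<close>

text \<open>Composing two Riesz kernels gives the Newton kernel, whose potential is bounded by assumption.\<close>

lemma riesz_energy:
  fixes h f :: "real^5 \<Rightarrow> real"
  assumes [measurable]: "h \<in> borel_measurable borel" "f \<in> borel_measurable borel"
    and nn: "\<And>x. h x \<ge> 0" "\<And>x. f x \<ge> 0"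
    and K: "\<And>y. (\<integral>\<^sup>+x. ennreal (h x / norm (x - y) ^ 3) \<partial>lborel) \<le> ennreal K"
  shows "(\<integral>\<^sup>+z. (riesz (\<lambda>x. ennreal (h x * f x)) z)\<^sup>2 \<partial>lborel)
    \<le> ennreal (1536 * ball_vol) * ennreal K * (\<integral>\<^sup>+x. ennreal (h x * (f x)\<^sup>2) \<partial>lborel)"
proof -
  define c where "c = 1536 * ball_vol"
  have c: "c \<ge> 0" by (simp add: c_def)
  define q where "q x = ennreal (h x * f x)" for x
  have [measurable]: "q \<in> borel_measurable borel" unfolding q_def by measurable
  define k where "k x z = ennreal (1 / norm (x - z) ^ 4)" for x z :: "real^5"
  define I where "I = (\<integral>\<^sup>+x. ennreal (h x * (f x)\<^sup>2) \<partial>lborel)"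
  define S where "S x y = ennreal (h x * (f x)\<^sup>2) * ennreal (h y / norm (y - x) ^ 3)" for x y
  have S_int: "(\<integral>\<^sup>+x. \<integral>\<^sup>+y. S x y \<partial>lborel \<partial>lborel) \<le> ennreal K * I"
  proof -
    have "(\<integral>\<^sup>+x. \<integral>\<^sup>+y. S x y \<partial>lborel \<partial>lborel) = (\<integral>\<^sup>+x. ennreal (h x * (f x)\<^sup>2) * (\<integral>\<^sup>+y. ennreal (h y / norm (y - x) ^ 3) \<partial>lborel) \<partial>lborel)"
      unfolding S_def by (intro nn_integral_cong nn_integral_cmult) measurable
    also have "\<dots> \<le> (\<integral>\<^sup>+x. ennreal (h x * (f x)\<^sup>2) * ennreal K \<partial>lborel)"
      by (intro nn_integral_mono mult_left_mono K) auto
    also have "\<dots> = ennreal K * I"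
      unfolding I_def by (subst nn_integral_multc) (auto simp: mult.commute)
    finally show ?thesis .
  qed
  have [measurable]: "case_prod S \<in> borel_measurable (borel \<Otimes>\<^sub>M borel)"
    unfolding S_def by measurable
  \<comment> \<open>A Schur test: f(x) f(y) is replaced by half the sum of squares. In each half one
    variable no longer carries \<open>f\<close>, and integrating it produces the potential of
    \<open>h\<close>, bounded by \<open>K\<close>.\<close>
  have ptw: "q x * q y * ennreal (c / norm (x - y) ^ 3) \<le> ennreal (c / 2) * (S x y + S y x)" for x y
  proof -
    have "h x * f x * (h y * f y) * (c / norm (x - y) ^ 3)
        = (c / norm (x - y) ^ 3) * h x * h y * (f x * f y)" by simp
    also have "\<dots> \<le> (c / norm (x - y) ^ 3) * h x * h y * (((f x)\<^sup>2 + (f y)\<^sup>2) / 2)"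
      using c nn sum_squares_bound[of "f x" "f y"] by (intro mult_left_mono mult_nonneg_nonneg) auto
    also have "\<dots> = c / 2 * (h x * (f x)\<^sup>2 * (h y / norm (y - x) ^ 3) + h y * (f y)\<^sup>2 * (h x / norm (x - y) ^ 3))"
      by (simp add: norm_minus_commute add_divide_distrib algebra_simps)
    finally have "ennreal (h x * f x * (h y * f y) * (c / norm (x - y) ^ 3)) \<le> ennreal \<dots>" by (rule ennreal_leI)
    also have "ennreal (h x * f x * (h y * f y) * (c / norm (x - y) ^ 3)) = q x * q y * ennreal (c / norm (x - y) ^ 3)"
      using nn c by (simp add: q_def ennreal_mult del: times_divide_eq_right times_divide_eq_left)
    also have "ennreal (c / 2 * (h x * (f x)\<^sup>2 * (h y / norm (y - x) ^ 3) + h y * (f y)\<^sup>2 * (h x / norm (x - y) ^ 3)))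
       = ennreal (c / 2) * (S x y + S y x)"
      using nn c by (simp add: S_def ennreal_mult del: times_divide_eq_right times_divide_eq_left)
    finally show ?thesis .
  qed
  have "(\<integral>\<^sup>+z. (riesz q z)\<^sup>2 \<partial>lborel) = (\<integral>\<^sup>+z. \<integral>\<^sup>+x. \<integral>\<^sup>+y. (q x * k x z) * (q y * k y z) \<partial>lborel \<partial>lborel \<partial>lborel)"
  proof (rule nn_integral_cong)
    fix z
    have "(riesz q z)\<^sup>2 = (\<integral>\<^sup>+x. q x * k x z \<partial>lborel) * (\<integral>\<^sup>+y. q y * k y z \<partial>lborel)"
      by (simp add: riesz_def k_def power2_eq_square)
    also have "\<dots> = (\<integral>\<^sup>+x. (q x * k x z) * (\<integral>\<^sup>+y. q y * k y z \<partial>lborel) \<partial>lborel)"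
      by (rule nn_integral_multc[symmetric]) (simp add: k_def)
    also have "\<dots> = (\<integral>\<^sup>+x. \<integral>\<^sup>+y. (q x * k x z) * (q y * k y z) \<partial>lborel \<partial>lborel)"
      by (intro nn_integral_cong nn_integral_cmult[symmetric]) (simp add: k_def)
    finally show "(riesz q z)\<^sup>2 = (\<integral>\<^sup>+x. \<integral>\<^sup>+y. (q x * k x z) * (q y * k y z) \<partial>lborel \<partial>lborel)" .
  qed
  also have "\<dots> = (\<integral>\<^sup>+x. \<integral>\<^sup>+z. \<integral>\<^sup>+y. (q x * k x z) * (q y * k y z) \<partial>lborel \<partial>lborel \<partial>lborel)"
    unfolding k_def by (rule lborel_pair.Fubini') measurable
  also have "\<dots> = (\<integral>\<^sup>+x. \<integral>\<^sup>+y. \<integral>\<^sup>+z. (q x * k x z) * (q y * k y z) \<partial>lborel \<partial>lborel \<partial>lborel)"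
    unfolding k_def by (intro nn_integral_cong lborel_pair.Fubini') measurable
  also have "\<dots> = (\<integral>\<^sup>+x. \<integral>\<^sup>+y. q x * q y * (\<integral>\<^sup>+z. k x z * k y z \<partial>lborel) \<partial>lborel \<partial>lborel)"
    by (intro nn_integral_cong, subst nn_integral_cmult[symmetric]) (auto simp: k_def mult_ac)
  also have "\<dots> \<le> (\<integral>\<^sup>+x. \<integral>\<^sup>+y. q x * q y * ennreal (c / norm (x - y) ^ 3) \<partial>lborel \<partial>lborel)"
  proof (rule nn_integral_mono, rule nn_integral_mono_AE)
    fix x :: "real^5"
    have "AE y in lborel. y \<noteq> x" by (rule AE_lborel_singleton)
    then show "AE y in lborel. q x * q y * (\<integral>\<^sup>+z. k x z * k y z \<partial>lborel) \<le> q x * q y * ennreal (c / norm (x - y) ^ 3)"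
      by eventually_elim (use kernel_composition[of x] in \<open>auto simp: k_def c_def intro!: mult_left_mono\<close>)
  qed
  also have "\<dots> \<le> (\<integral>\<^sup>+x. \<integral>\<^sup>+y. ennreal (c / 2) * (S x y + S y x) \<partial>lborel \<partial>lborel)"
    by (intro nn_integral_mono ptw)
  also have "\<dots> = ennreal (c / 2) * ((\<integral>\<^sup>+x. \<integral>\<^sup>+y. S x y \<partial>lborel \<partial>lborel) + (\<integral>\<^sup>+x. \<integral>\<^sup>+y. S y x \<partial>lborel \<partial>lborel))"
    by (simp add: nn_integral_cmult nn_integral_add)
  also have "(\<integral>\<^sup>+x. \<integral>\<^sup>+y. S y x \<partial>lborel \<partial>lborel) = (\<integral>\<^sup>+x. \<integral>\<^sup>+y. S x y \<partial>lborel \<partial>lborel)"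
    by (rule lborel_pair.Fubini') measurable
  also have "ennreal (c / 2) * ((\<integral>\<^sup>+x. \<integral>\<^sup>+y. S x y \<partial>lborel \<partial>lborel) + (\<integral>\<^sup>+x. \<integral>\<^sup>+y. S x y \<partial>lborel \<partial>lborel))
     \<le> ennreal (c / 2) * (ennreal K * I + ennreal K * I)"
    by (intro mult_left_mono add_mono S_int) auto
  also have "\<dots> = (ennreal (c / 2) * 2) * (ennreal K * I)"
    by (metis (no_types) mult.assoc mult_2)
  also have "ennreal (c / 2) * 2 = ennreal (c / 2 * 2)" using c by (subst ennreal_mult) auto
  finally show ?thesis by (simp add: c_def I_def q_def[abs_def] mult.assoc)
qed

text \<open>The kernel is symmetric, so the potential can be moved from \<open>g\<close> to
  \<open>h f\<close>. Young's inequality then separates the two factors, and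
  \<open>riesz_energy\<close> evaluates the second. The parameter \<open>t\<close> stays free for
  the later absorption.\<close>

lemma pairing_le_riesz_energy:
  fixes h f w :: "real^5 \<Rightarrow> real" and g :: "real^5 \<Rightarrow> ennreal"
  assumes [measurable]: "h \<in> borel_measurable borel" "f \<in> borel_measurable borel" "g \<in> borel_measurable borel"
      "w \<in> borel_measurable borel"
    and nn: "\<And>x. h x \<ge> 0" "\<And>x. f x \<ge> 0"
    and K: "\<And>y. (\<integral>\<^sup>+x. ennreal (h x / norm (x - y) ^ 3) \<partial>lborel) \<le> ennreal K"
    and w: "AE y in lborel. ennreal (bubble_mass * \<bar>w y\<bar>) \<le> riesz g y"
    and t: "t > 0"
  shows "ennreal bubble_mass * (\<integral>\<^sup>+x. ennreal (h x * f x * \<bar>w x\<bar>) \<partial>lborel)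
    \<le> ennreal t * (\<integral>\<^sup>+x. (g x)\<^sup>2 \<partial>lborel)
      + ennreal (1 / t) * (ennreal (1536 * ball_vol) * ennreal K * (\<integral>\<^sup>+x. ennreal (h x * (f x)\<^sup>2) \<partial>lborel))"
proof -
  have amgm: "a * b \<le> ennreal t * a\<^sup>2 + ennreal (1 / t) * b\<^sup>2" for a b :: ennreal
  proof (cases "a = \<infinity> \<or> b = \<infinity>")
    case True
    then show ?thesis using t by (auto simp: power2_eq_square ennreal_mult_top ennreal_top_mult ennreal_eq_0_iff)
  next
    case False
    then obtain x y where [simp]: "a = ennreal x" "b = ennreal y" and xy: "x \<ge> 0" "y \<ge> 0"
      by (metis ennreal_cases infinity_ennreal_def)
    have "0 \<le> (t * x - y / 2)\<^sup>2 + 3 / 4 * y\<^sup>2" by simp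
    also have "\<dots> = t * (t * x\<^sup>2 + 1 / t * y\<^sup>2 - x * y)" using t by (simp add: power2_eq_square field_simps)
    finally have "x * y \<le> t * x\<^sup>2 + 1 / t * y\<^sup>2" using t by (simp add: zero_le_mult_iff)
    then have "ennreal (x * y) \<le> ennreal (t * x\<^sup>2 + 1 / t * y\<^sup>2)" by (rule ennreal_leI)
    moreover have "ennreal (t * x\<^sup>2 + 1 / t * y\<^sup>2) = ennreal (t * x\<^sup>2) + ennreal (1 / t * y\<^sup>2)"
      using t by (intro ennreal_plus) auto
    ultimately show ?thesis using xy t by (simp only: ennreal_mult ennreal_power \<open>a = ennreal x\<close> \<open>b = ennreal y\<close>
      zero_le_power divide_nonneg_pos zero_le_one less_imp_le)
  qed
  define q where "q x = ennreal (h x * f x)" for x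
  have [measurable]: "q \<in> borel_measurable borel" unfolding q_def by measurable
  have "ennreal bubble_mass * (\<integral>\<^sup>+x. ennreal (h x * f x * \<bar>w x\<bar>) \<partial>lborel)
      = (\<integral>\<^sup>+x. ennreal bubble_mass * ennreal (h x * f x * \<bar>w x\<bar>) \<partial>lborel)"
    by (rule nn_integral_cmult[symmetric]) simp
  also have "\<dots> \<le> (\<integral>\<^sup>+y. q y * riesz g y \<partial>lborel)"
  proof (rule nn_integral_mono_AE, use w in eventually_elim)
    case (elim y)
    have "ennreal bubble_mass * ennreal (h y * f y * \<bar>w y\<bar>) = q y * ennreal (bubble_mass * \<bar>w y\<bar>)"
      using nn bubble_mass_pos by (simp add: q_def mult_ac flip: ennreal_mult)
    also have "\<dots> \<le> q y * riesz g y" by (intro mult_left_mono elim) auto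
    finally show ?case .
  qed
  also have "\<dots> = (\<integral>\<^sup>+y. \<integral>\<^sup>+x. q y * (g x * ennreal (1 / norm (x - y) ^ 4)) \<partial>lborel \<partial>lborel)"
    unfolding riesz_def by (intro nn_integral_cong nn_integral_cmult[symmetric]) measurable
  also have "\<dots> = (\<integral>\<^sup>+x. \<integral>\<^sup>+y. q y * (g x * ennreal (1 / norm (x - y) ^ 4)) \<partial>lborel \<partial>lborel)"
    by (rule lborel_pair.Fubini') measurable
  also have "\<dots> = (\<integral>\<^sup>+x. g x * riesz q x \<partial>lborel)"
    unfolding riesz_def
    by (intro nn_integral_cong, subst nn_integral_cmult[symmetric]) (auto simp: mult_ac norm_minus_commute)
  also have "\<dots> \<le> (\<integral>\<^sup>+x. ennreal t * (g x)\<^sup>2 + ennreal (1 / t) * (riesz q x)\<^sup>2 \<partial>lborel)"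
    by (intro nn_integral_mono amgm)
  also have "\<dots> = ennreal t * (\<integral>\<^sup>+x. (g x)\<^sup>2 \<partial>lborel) + ennreal (1 / t) * (\<integral>\<^sup>+x. (riesz q x)\<^sup>2 \<partial>lborel)"
    by (simp add: nn_integral_add nn_integral_cmult)
  also have "\<dots> \<le> ennreal t * (\<integral>\<^sup>+x. (g x)\<^sup>2 \<partial>lborel)
      + ennreal (1 / t) * (ennreal (1536 * ball_vol) * ennreal K * (\<integral>\<^sup>+x. ennreal (h x * (f x)\<^sup>2) \<partial>lborel))"
    unfolding q_def by (intro add_left_mono mult_left_mono riesz_energy assms) auto
  finally show ?thesis .
qed

section \<open>Solutions with nonpositive head\<close>

lemma vec_nth_measurable [measurable (raw)]:
  fixes f :: "'a \<Rightarrow> 'b::euclidean_space^'n::finite"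
  assumes "f \<in> borel_measurable N"
  shows "(\<lambda>x. f x $ i) \<in> borel_measurable N"
  by (rule measurable_compose[OF assms]) (intro borel_measurable_continuous_onI continuous_intros)

lemma test_functions_UNIV_D:
  assumes "\<phi> \<in> test_functions UNIV"
  shows "smooth \<phi>" "compact (closure {x. \<phi> x \<noteq> 0})"
  using assms by (auto simp: test_functions_def smooth_def)

lemma test_functions_continuous: "\<phi> \<in> test_functions UNIV \<Longrightarrow> continuous_on UNIV \<phi>"
  using C_diff_imp_continuous by (auto simp: test_functions_def)

lemma smooth_continuous: "smooth f \<Longrightarrow> continuous_on UNIV f"
  using C_diff_imp_continuous by (auto simp: smooth_def)

lemma smooth_measurable: "smooth f \<Longrightarrow> f \<in> borel_measurable borel"
  by (intro borel_measurable_continuous_onI smooth_continuous)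

lemma smooth_partial_deriv: "smooth f \<Longrightarrow> smooth (partial_deriv i f)"
  unfolding smooth_def by (metis C_diff.simps(2))

lemma partial_deriv_test_functions:
  assumes "\<phi> \<in> test_functions UNIV"
  shows "partial_deriv i \<phi> \<in> test_functions UNIV"
proof -
  have "{x. partial_deriv i \<phi> x \<noteq> 0} \<subseteq> closure {x. \<phi> x \<noteq> 0}"
  proof (rule subsetI, rule ccontr)
    fix x assume x: "x \<in> {x. partial_deriv i \<phi> x \<noteq> 0}" "x \<notin> closure {x. \<phi> x \<noteq> 0}"
    have "((\<lambda>x. 0) has_derivative (\<lambda>h. 0)) (at x)" by simp
    then have "(\<phi> has_derivative (\<lambda>h. 0)) (at x)"
      by (rule has_derivative_transform_within_open[of _ _ _ _ "- closure {x. \<phi> x \<noteq> 0}"])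
        (use x(2) closure_subset[of "{x. \<phi> x \<noteq> 0}"] in auto)
    then show False using x(1) partial_deriv_eq by fastforce
  qed
  then have "closure {x. partial_deriv i \<phi> x \<noteq> 0} \<subseteq> closure {x. \<phi> x \<noteq> 0}"
    by (simp add: closure_minimal)
  then have "compact (closure {x. partial_deriv i \<phi> x \<noteq> 0})"
    using compact_Int_closed[OF test_functions_UNIV_D(2)[OF assms], of "closure {x. partial_deriv i \<phi> x \<noteq> 0}"]
    by (simp add: inf.absorb2)
  then show ?thesis using smooth_partial_deriv[OF test_functions_UNIV_D(1)[OF assms]]
    by (auto simp: test_functions_def smooth_def)
qed

definition locally_integrable :: "(real^5 \<Rightarrow> real) \<Rightarrow> bool" where
  "locally_integrable f \<longleftrightarrow> f \<in> borel_measurable borel \<and>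
     (\<forall>R. (\<integral>\<^sup>+x. ennreal \<bar>f x\<bar> * indicator (ball 0 R) x \<partial>lborel) < \<infinity>)"

lemma locally_integrable_bound:
  assumes "locally_integrable f" and [measurable]: "g \<in> borel_measurable borel"
    and "\<And>x. \<bar>g x\<bar> \<le> f x"
  shows "locally_integrable g"
  unfolding locally_integrable_def
proof (intro conjI allI)
  fix R
  have "(\<integral>\<^sup>+x. ennreal \<bar>g x\<bar> * indicator (ball 0 R) x \<partial>lborel) \<le> (\<integral>\<^sup>+x. ennreal \<bar>f x\<bar> * indicator (ball 0 R) x \<partial>lborel)"
    by (intro nn_integral_mono mult_right_mono ennreal_leI order_trans[OF assms(3) abs_ge_self]) auto
  also have "\<dots> < \<infinity>" using assms(1) by (auto simp: locally_integrable_def)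
  finally show "(\<integral>\<^sup>+x. ennreal \<bar>g x\<bar> * indicator (ball 0 R) x \<partial>lborel) < \<infinity>" .
qed simp

lemma locally_integrable_add:
  assumes "locally_integrable f" "locally_integrable g"
  shows "locally_integrable (\<lambda>x. \<bar>f x\<bar> + \<bar>g x\<bar>)"
  unfolding locally_integrable_def
proof (intro conjI allI)
  have [measurable]: "f \<in> borel_measurable borel" "g \<in> borel_measurable borel"
    using assms by (auto simp: locally_integrable_def)
  show "(\<lambda>x. \<bar>f x\<bar> + \<bar>g x\<bar>) \<in> borel_measurable borel" by measurable
  fix R
  have "(\<integral>\<^sup>+x. ennreal \<bar>\<bar>f x\<bar> + \<bar>g x\<bar>\<bar> * indicator (ball 0 R) x \<partial>lborel)
    = (\<integral>\<^sup>+x. ennreal \<bar>f x\<bar> * indicator (ball 0 R) x + ennreal \<bar>g x\<bar> * indicator (ball 0 R) x \<partial>lborel)"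
    by (intro nn_integral_cong) (auto simp: indicator_def)
  also have "\<dots> = (\<integral>\<^sup>+x. ennreal \<bar>f x\<bar> * indicator (ball 0 R) x \<partial>lborel) + (\<integral>\<^sup>+x. ennreal \<bar>g x\<bar> * indicator (ball 0 R) x \<partial>lborel)"
    by (rule nn_integral_add) measurable
  also have "\<dots> < \<infinity>" using assms by (auto simp: locally_integrable_def)
  finally show "(\<integral>\<^sup>+x. ennreal \<bar>\<bar>f x\<bar> + \<bar>g x\<bar>\<bar> * indicator (ball 0 R) x \<partial>lborel) < \<infinity>" .
qed

lemma integrable_mult_bounded_support:
  assumes f: "locally_integrable f" and [measurable]: "m \<in> borel_measurable borel"
    and b: "\<And>x. \<bar>m x\<bar> \<le> B" and s: "\<And>x. norm x \<ge> R \<Longrightarrow> m x = 0"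
  shows "integrable lborel (\<lambda>x. f x * m x)"
proof (rule integrableI_bounded)
  have [measurable]: "f \<in> borel_measurable borel" using f by (auto simp: locally_integrable_def)
  show "(\<lambda>x. f x * m x) \<in> borel_measurable lborel" by measurable
  have "(\<integral>\<^sup>+x. ennreal (norm (f x * m x)) \<partial>lborel) \<le> (\<integral>\<^sup>+x. ennreal B * (ennreal \<bar>f x\<bar> * indicator (ball 0 R) x) \<partial>lborel)"
  proof (rule nn_integral_mono)
    fix x
    have "\<bar>f x\<bar> * \<bar>m x\<bar> \<le> B * \<bar>f x\<bar>" using mult_left_mono[OF b[of x], of "\<bar>f x\<bar>"] by (simp add: mult.commute)
    moreover have "B \<ge> 0" using b[of x] by linarith
    ultimately show "ennreal (norm (f x * m x)) \<le> ennreal B * (ennreal \<bar>f x\<bar> * indicator (ball 0 R) x)"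
      using s[of x] by (auto simp: indicator_def abs_mult ennreal_leI simp flip: ennreal_mult)
  qed
  also have "\<dots> = ennreal B * (\<integral>\<^sup>+x. ennreal \<bar>f x\<bar> * indicator (ball 0 R) x \<partial>lborel)"
    by (rule nn_integral_cmult) measurable
  also have "\<dots> < \<infinity>" using f by (auto simp: locally_integrable_def ennreal_mult_less_top)
  finally show "(\<integral>\<^sup>+x. ennreal (norm (f x * m x)) \<partial>lborel) < \<infinity>" .
qed

lemma test_function_bounds:
  assumes "\<phi> \<in> test_functions (UNIV :: (real^'n::finite) set)"
  obtains B R where "\<And>x. \<bar>\<phi> x\<bar> \<le> B" "\<And>x. norm x \<ge> R \<Longrightarrow> \<phi> x = 0"
proof -
  let ?S = "closure {x. \<phi> x \<noteq> 0}"
  have S: "compact ?S" using assms test_functions_UNIV_D by auto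
  obtain R where R: "\<And>x. x \<in> ?S \<Longrightarrow> norm x \<le> R"
    using compact_imp_bounded[OF S] bounded_iff by metis
  have "bounded (\<phi> ` ?S)"
    using test_functions_continuous[OF assms] S
    by (intro compact_imp_bounded compact_continuous_image) (auto intro: continuous_on_subset)
  then obtain B where B: "\<And>x. x \<in> ?S \<Longrightarrow> \<bar>\<phi> x\<bar> \<le> B" by (auto simp: bounded_iff)
  have z: "x \<in> ?S \<or> \<phi> x = 0" for x using closure_subset[of "{x. \<phi> x \<noteq> 0}"] by auto
  show thesis
  proof (rule that[of "max B 0" "R + 1"])
    show "\<bar>\<phi> x\<bar> \<le> max B 0" for x using z[of x] B[of x] by auto
    show "\<phi> x = 0" if "norm x \<ge> R + 1" for x using z[of x] R[of x] that by auto
  qed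
qed

lemma integrable_mult_test_function:
  assumes "locally_integrable f" "\<phi> \<in> test_functions UNIV"
  shows "integrable lborel (\<lambda>x. f x * \<phi> x)"
proof -
  obtain B R where "\<And>x. \<bar>\<phi> x\<bar> \<le> B" "\<And>x. norm x \<ge> R \<Longrightarrow> \<phi> x = 0"
    by (rule test_function_bounds[OF assms(2)]) blast
  then show ?thesis
    by (intro integrable_mult_bounded_support[OF assms(1)] smooth_measurable test_functions_UNIV_D assms(2))
qed

text \<open>The analysis is carried out for Borel representatives and \<open>lborel\<close>, with
  the sign of the head imposed at every point. Unfolding the two signs of \<open>distr_deriv\<close>
  and changing the overall sign turns the distributional equation into \<open>momentum\<close>. One
  constant \<open>M\<close> bounds both scaled integrals.\<close>

locale nonpositive_head =
  fixes u :: "real^5 \<Rightarrow> real^5" and p :: "real^5 \<Rightarrow> real" and D :: "real^5 \<Rightarrow> real^5^5" and M :: real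
  assumes u_meas [measurable]: "u \<in> borel_measurable borel"
    and p_meas [measurable]: "p \<in> borel_measurable borel"
    and D_meas [measurable]: "D \<in> borel_measurable borel"
    and M: "M \<ge> 0"
    and u_bound: "\<And>R. R > 0 \<Longrightarrow> (\<integral>\<^sup>+x. ennreal (norm (u x) ^ 3) * indicator (ball 0 R) x \<partial>lborel) \<le> ennreal (M * R\<^sup>2)"
    and p_bound: "\<And>R. R > 0 \<Longrightarrow> (\<integral>\<^sup>+x. ennreal (\<bar>p x\<bar> powr (3/2)) * indicator (ball 0 R) x \<partial>lborel) \<le> ennreal (M * R\<^sup>2)"
    and D_local: "locally_integrable (\<lambda>x. (norm (D x))\<^sup>2)"
    and head: "\<And>x. (norm (u x))\<^sup>2 / 2 + p x \<le> 0"
    and momentum: "\<And>i \<phi>. \<phi> \<in> test_functions UNIV \<Longrightarrow>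
        (\<Sum>j\<in>UNIV. \<integral>x. u x $ i * partial_deriv j (partial_deriv j \<phi>) x \<partial>lborel)
      + (\<Sum>j\<in>UNIV. \<integral>x. u x $ i * u x $ j * partial_deriv j \<phi> x \<partial>lborel)
      + (\<integral>x. p x * partial_deriv i \<phi> x \<partial>lborel) = 0"
    and divergence: "\<And>\<phi>. \<phi> \<in> test_functions UNIV \<Longrightarrow> (\<Sum>j\<in>UNIV. \<integral>x. u x $ j * partial_deriv j \<phi> x \<partial>lborel) = 0"
    and gradient: "\<And>i j \<phi>. \<phi> \<in> test_functions UNIV \<Longrightarrow>
        (\<integral>x. u x $ i * partial_deriv j \<phi> x \<partial>lborel) = - (\<integral>x. D x $ i $ j * \<phi> x \<partial>lborel)"
    and energy: "\<And>\<phi>. \<phi> \<in> test_functions UNIV \<Longrightarrow> (\<And>x. \<phi> x \<ge> 0) \<Longrightarrow>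
        (\<integral>x. (norm (D x))\<^sup>2 * \<phi> x \<partial>lborel) \<le> (\<integral>x. (norm (u x))\<^sup>2 / 2 * laplacian \<phi> x \<partial>lborel)
          + (\<integral>x. ((norm (u x))\<^sup>2 / 2 + p x) * (u x \<bullet> grad \<phi> x) \<partial>lborel)"
begin

text \<open>This is h of the overview, hence the negative of the head H in the English
  theorem.\<close>

definition H :: "real^5 \<Rightarrow> real" where "H x = - ((norm (u x))\<^sup>2 / 2 + p x)"

lemma H_nonneg: "H x \<ge> 0" using head[of x] by (simp add: H_def)
lemma H_meas [measurable]: "H \<in> borel_measurable borel" unfolding H_def by measurable
lemma p_H: "p x = - H x - (norm (u x))\<^sup>2 / 2" by (simp add: H_def)
lemma abs_p: "\<bar>p x\<bar> = H x + (norm (u x))\<^sup>2 / 2" 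
  using H_nonneg[of x] abs_of_nonneg[of "H x + (norm (u x))\<^sup>2 / 2"] abs_minus_cancel[of "H x + (norm (u x))\<^sup>2 / 2"]
  by (simp add: p_H)

text \<open>Instead of Hoelder's inequality, b^2 <= R^{-2} + R b^3 is used pointwise, for b = |u|
  and for b the square root of |p|. The volume term R^{-2} R^5 and the terms R M R^2 all scale like
  R^3.\<close>

lemma square_p_bound:
  assumes R: "R > 0"
  shows "(\<integral>\<^sup>+x. ennreal ((norm (u x))\<^sup>2 + \<bar>p x\<bar>) * indicator (ball 0 R) x \<partial>lborel) \<le> ennreal (2 * (ball_vol + M) * R ^ 3)"
proof -
  have key: "b\<^sup>2 \<le> 1 / R\<^sup>2 + R * b ^ 3" if "b \<ge> 0" for b
  proof (cases "R * b \<le> 1")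
    case True
    have "(R * b)\<^sup>2 \<le> 1" using True R that by (intro power_le_one) auto
    then have "b\<^sup>2 \<le> 1 / R\<^sup>2" using R by (simp add: field_simps power_mult_distrib)
    then show ?thesis using R that by (simp add: add_increasing2)
  next
    case False
    then have "1 * b\<^sup>2 \<le> R * b * b\<^sup>2" by (intro mult_right_mono) auto
    then have "b\<^sup>2 \<le> R * b ^ 3" by (simp add: eval_nat_numeral mult.assoc)
    then show ?thesis using R by (simp add: add_increasing)
  qed
  have ptw: "(norm (u x))\<^sup>2 + \<bar>p x\<bar> \<le> 2 / R\<^sup>2 + R * (norm (u x) ^ 3) + R * (\<bar>p x\<bar> powr (3/2))" for x
  proof -
    have "(sqrt \<bar>p x\<bar>) ^ 3 = \<bar>p x\<bar> powr (3/2)"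
      by (simp add: powr_half_sqrt[symmetric] powr_powr powr_numeral[symmetric] del: powr_numeral)
    then show ?thesis using key[of "norm (u x)"] key[of "sqrt \<bar>p x\<bar>"] by simp
  qed
  have "(\<integral>\<^sup>+x. ennreal ((norm (u x))\<^sup>2 + \<bar>p x\<bar>) * indicator (ball 0 R) x \<partial>lborel)
    \<le> (\<integral>\<^sup>+x. ennreal (2 / R\<^sup>2) * indicator (ball 0 R) x + ennreal R * (ennreal (norm (u x) ^ 3) * indicator (ball 0 R) x)
        + ennreal R * (ennreal (\<bar>p x\<bar> powr (3/2)) * indicator (ball 0 R) x) \<partial>lborel)"
    using ennreal_leI[OF ptw] R by (intro nn_integral_mono) (auto simp: indicator_def ennreal_mult)
  also have "\<dots> = ennreal (2 / R\<^sup>2) * ennreal (ball_vol * R ^ 5)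
      + ennreal R * (\<integral>\<^sup>+x. ennreal (norm (u x) ^ 3) * indicator (ball 0 R) x \<partial>lborel)
      + ennreal R * (\<integral>\<^sup>+x. ennreal (\<bar>p x\<bar> powr (3/2)) * indicator (ball 0 R) x \<partial>lborel)"
    using R by (simp add: nn_integral_add nn_integral_cmult nn_integral_cmult_indicator emeasure_ball5)
  also have "\<dots> \<le> ennreal (2 / R\<^sup>2) * ennreal (ball_vol * R ^ 5) + ennreal R * ennreal (M * R\<^sup>2) + ennreal R * ennreal (M * R\<^sup>2)"
    by (intro add_mono mult_left_mono u_bound p_bound R) auto
  also have "\<dots> = ennreal (2 / R\<^sup>2 * (ball_vol * R ^ 5)) + ennreal (R * (M * R\<^sup>2)) + ennreal (R * (M * R\<^sup>2))"
    using R M by (simp add: ennreal_mult del: times_divide_eq_left times_divide_eq_right)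
  also have "\<dots> = ennreal (2 / R\<^sup>2 * (ball_vol * R ^ 5) + R * (M * R\<^sup>2) + R * (M * R\<^sup>2))"
  proof -
    have "ennreal x + ennreal y + ennreal y = ennreal (x + y + y)" if "x \<ge> 0" "y \<ge> 0" for x y
      using that by (simp only: ennreal_plus add_nonneg_nonneg)
    then show ?thesis using R M by simp
  qed
  also have "2 / R\<^sup>2 * (ball_vol * R ^ 5) + R * (M * R\<^sup>2) + R * (M * R\<^sup>2) = 2 * (ball_vol + M) * R ^ 3"
    using R by (simp add: field_simps eval_nat_numeral)
  finally show ?thesis .
qed

text \<open>Since |p| = H + |u|^2/2, \<open>H\<close> is at most |p|. Comparing |u| with the square
  root of |p| then bounds |p| |u| by |p|^{3/2} + |u|^3, the two integrands controlled by
  \<open>M\<close>.\<close>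

lemma head_flux_bound:
  assumes R: "R > 0"
  shows "(\<integral>\<^sup>+x. ennreal (H x * norm (u x)) * indicator (ball 0 R) x \<partial>lborel) \<le> ennreal (3 * M * R\<^sup>2)"
proof -
  have ptw: "H x * norm (u x) \<le> 2 * norm (u x) ^ 3 + \<bar>p x\<bar> powr (3/2)" for x
  proof -
    define b where "b = sqrt \<bar>p x\<bar>"
    have b: "b \<ge> 0" "b\<^sup>2 = \<bar>p x\<bar>" by (auto simp: b_def)
    have b3: "b ^ 3 = \<bar>p x\<bar> powr (3/2)"
      by (simp add: b_def powr_half_sqrt[symmetric] powr_powr powr_numeral[symmetric] del: powr_numeral)
    have "b\<^sup>2 * norm (u x) \<le> b ^ 3 + norm (u x) ^ 3"
    proof (cases "norm (u x) \<le> b")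
      case True
      then have "b\<^sup>2 * norm (u x) \<le> b\<^sup>2 * b" by (intro mult_left_mono) auto
      then show ?thesis by (simp add: eval_nat_numeral mult.assoc add_increasing2)
    next
      case False
      then have "b\<^sup>2 * norm (u x) \<le> (norm (u x))\<^sup>2 * norm (u x)" using b by (intro mult_right_mono power_mono) auto
      then show ?thesis using b(1) by (simp add: eval_nat_numeral mult.assoc add_increasing)
    qed
    moreover have "H x * norm (u x) \<le> (b\<^sup>2) * norm (u x)"
      unfolding b(2) abs_p by (intro mult_right_mono) auto
    ultimately have "H x * norm (u x) \<le> b ^ 3 + norm (u x) ^ 3" by linarith
    also have "\<dots> \<le> 2 * norm (u x) ^ 3 + \<bar>p x\<bar> powr (3/2)" by (simp add: b3)
    finally show ?thesis .
  qed
  have "(\<integral>\<^sup>+x. ennreal (H x * norm (u x)) * indicator (ball 0 R) x \<partial>lborel)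
    \<le> (\<integral>\<^sup>+x. 2 * (ennreal (norm (u x) ^ 3) * indicator (ball 0 R) x) + ennreal (\<bar>p x\<bar> powr (3/2)) * indicator (ball 0 R) x \<partial>lborel)"
    using ennreal_leI[OF ptw] by (intro nn_integral_mono) (auto simp: indicator_def ennreal_mult)
  also have "\<dots> = 2 * (\<integral>\<^sup>+x. ennreal (norm (u x) ^ 3) * indicator (ball 0 R) x \<partial>lborel)
      + (\<integral>\<^sup>+x. ennreal (\<bar>p x\<bar> powr (3/2)) * indicator (ball 0 R) x \<partial>lborel)"
    by (simp add: nn_integral_add nn_integral_cmult)
  also have "\<dots> \<le> 2 * ennreal (M * R\<^sup>2) + ennreal (M * R\<^sup>2)"
    by (intro add_mono mult_left_mono u_bound p_bound R) auto
  also have "\<dots> = ennreal (3 * (M * R\<^sup>2))"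
  proof -
    have "ennreal (2 * m) = 2 * ennreal m" if "m \<ge> 0" for m :: real using that by (simp add: ennreal_mult)
    moreover have "ennreal (2 * m + m) = ennreal (2 * m) + ennreal m" if "m \<ge> 0" for m :: real
      using that by (intro ennreal_plus) auto
    moreover have "2 * m + m = 3 * m" for m :: real by simp
    moreover have "M * R\<^sup>2 \<ge> 0" using M by simp
    ultimately show ?thesis by metis
  qed
  finally show ?thesis using M by (simp add: mult.assoc)
qed

lemma u_sq_p_local: "locally_integrable (\<lambda>x. (norm (u x))\<^sup>2 + \<bar>p x\<bar>)"
  unfolding locally_integrable_def
proof (intro conjI allI)
  fix R
  have "(\<integral>\<^sup>+x. ennreal \<bar>(norm (u x))\<^sup>2 + \<bar>p x\<bar>\<bar> * indicator (ball 0 R) x \<partial>lborel)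
      \<le> (\<integral>\<^sup>+x. ennreal ((norm (u x))\<^sup>2 + \<bar>p x\<bar>) * indicator (ball 0 (max R 1)) x \<partial>lborel)"
    by (intro nn_integral_mono) (auto simp: indicator_def)
  also have "\<dots> < \<infinity>" using order.strict_trans1[OF square_p_bound[of "max R 1"]] by auto
  finally show "(\<integral>\<^sup>+x. ennreal \<bar>(norm (u x))\<^sup>2 + \<bar>p x\<bar>\<bar> * indicator (ball 0 R) x \<partial>lborel) < \<infinity>" .
qed measurable

lemma locally_integrable_fields:
  shows "locally_integrable (\<lambda>x. u x $ i)" "locally_integrable (\<lambda>x. u x $ i * u x $ j)" "locally_integrable p"
    "locally_integrable (\<lambda>x. (norm (u x))\<^sup>2)" "locally_integrable H" "locally_integrable (\<lambda>x. D x $ i $ j)"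
    "locally_integrable (\<lambda>x. H x * norm (u x))" "locally_integrable (\<lambda>x. norm (u x))" "locally_integrable (\<lambda>x. norm (D x))"
proof -
  have one: "locally_integrable (\<lambda>x. 1)"
    using emeasure_lborel_ball_finite by (auto simp: locally_integrable_def)
  show sq: "locally_integrable (\<lambda>x. (norm (u x))\<^sup>2)"
    by (rule locally_integrable_bound[OF u_sq_p_local]) auto
  show "locally_integrable p" by (rule locally_integrable_bound[OF u_sq_p_local]) auto
  show "locally_integrable H" 
    by (rule locally_integrable_bound[OF u_sq_p_local]) (use H_nonneg in \<open>auto simp: abs_p\<close>)
  have le: "b \<le> \<bar>1\<bar> + \<bar>b\<^sup>2\<bar>" for b :: real
  proof -
    have "2 * b \<le> 1 + b\<^sup>2" using sum_squares_bound[of 1 b] by simp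
    moreover have "0 \<le> b\<^sup>2" by simp
    ultimately have "b \<le> 1 + b\<^sup>2" by linarith
    then show ?thesis by simp
  qed
  show nu: "locally_integrable (\<lambda>x. norm (u x))"
    by (rule locally_integrable_bound[OF locally_integrable_add[OF one sq]]) (use le in auto)
  show nD: "locally_integrable (\<lambda>x. norm (D x))"
    by (rule locally_integrable_bound[OF locally_integrable_add[OF one D_local]]) (use le in auto)
  show "locally_integrable (\<lambda>x. u x $ i)"
    by (rule locally_integrable_bound[OF nu]) (auto simp: component_le_norm_cart)
  have "\<bar>D x $ i $ j\<bar> \<le> norm (D x)" for x
    using component_le_norm_cart[of "D x $ i" j] Finite_Cartesian_Product.norm_nth_le[of "D x" i] by linarith
  then show "locally_integrable (\<lambda>x. D x $ i $ j)"
    by (intro locally_integrable_bound[OF nD]) auto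
  have "\<bar>u x $ i * u x $ j\<bar> \<le> (norm (u x))\<^sup>2" for x
    unfolding abs_mult power2_eq_square by (intro mult_mono component_le_norm_cart) auto
  then show "locally_integrable (\<lambda>x. u x $ i * u x $ j)"
    by (intro locally_integrable_bound[OF sq]) auto
  show "locally_integrable (\<lambda>x. H x * norm (u x))"
    unfolding locally_integrable_def
  proof (intro conjI allI)
    fix R
    have "(\<integral>\<^sup>+x. ennreal \<bar>H x * norm (u x)\<bar> * indicator (ball 0 R) x \<partial>lborel)
        \<le> (\<integral>\<^sup>+x. ennreal (H x * norm (u x)) * indicator (ball 0 (max R 1)) x \<partial>lborel)"
      using H_nonneg by (intro nn_integral_mono) (auto simp: indicator_def abs_mult)
    also have "\<dots> < \<infinity>" using order.strict_trans1[OF head_flux_bound[of "max R 1"]] by auto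
    finally show "(\<integral>\<^sup>+x. ennreal \<bar>H x * norm (u x)\<bar> * indicator (ball 0 R) x \<partial>lborel) < \<infinity>" .
  qed measurable
qed

text \<open>The momentum equation is tested with the gradient field \<open>G(|x-a|\<^sup>2) (x-a)\<close>; the viscous term drops out
  because the Laplacian of this field is again a gradient.\<close>

lemma pressure_identity:
  fixes a :: "real^5" and G G1 G2 :: "real \<Rightarrow> real"
  assumes sm: "smooth (\<lambda>x. G ((norm (x - a))\<^sup>2))" "smooth (\<lambda>x. G1 ((norm (x - a))\<^sup>2))"
    and dG: "\<And>s. s \<ge> 0 \<Longrightarrow> (G has_real_derivative G1 s) (at s)"
    and dG1: "\<And>s. s \<ge> 0 \<Longrightarrow> (G1 has_real_derivative G2 s) (at s)"
    and zero: "\<And>s. s \<ge> R\<^sup>2 \<Longrightarrow> G s = 0" "\<And>s. s \<ge> R\<^sup>2 \<Longrightarrow> G1 s = 0" and R: "R > 0"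
  defines "F \<equiv> \<lambda>x. 2 * G1 ((norm (x - a))\<^sup>2) * (u x \<bullet> (x - a))\<^sup>2 + G ((norm (x - a))\<^sup>2) * (norm (u x))\<^sup>2
    + p x * (2 * G1 ((norm (x - a))\<^sup>2) * (norm (x - a))\<^sup>2 + 5 * G ((norm (x - a))\<^sup>2))"
  shows "integrable lborel F" "(\<integral>x. F x \<partial>lborel) = 0"
proof -
  define s where "s x = (norm (x - a))\<^sup>2" for x
  define X where "X i x = x $ i - a $ i" for i x
  have s: "s x \<ge> 0" for x by (simp add: s_def)
  have far: "s x \<ge> R\<^sup>2" if "norm (x - a) > R" for x
    unfolding s_def using that R by (intro power_mono) auto
  have sX: "(\<Sum>i\<in>UNIV. X i x * X i x) = s x" for x
    by (simp add: X_def s_def power2_norm_eq_inner inner_vec_def)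
  have smX: "smooth (X i)" for i unfolding X_def[abs_def] by (intro smooth_diff smooth_nth smooth_const)
  have sms: "smooth s" unfolding s_def[abs_def] by (rule smooth_norm_sq)
  have hX: "(X i has_derivative (\<lambda>h. h $ i)) (at x)" for i x
    unfolding X_def[abs_def] by (auto intro!: derivative_eq_intros bounded_linear_imp_has_derivative bounded_linear_vec_nth)
  have hs: "(s has_derivative (\<lambda>h. 2 * ((x - a) \<bullet> h))) (at x)" for x
    unfolding s_def[abs_def] using has_derivative_radial[OF DERIV_ident, where x=x and a=a] by simp
  have hG: "((\<lambda>x. G (s x)) has_derivative (\<lambda>h. G1 (s x) * (2 * ((x - a) \<bullet> h)))) (at x)" for x
    unfolding s_def by (rule has_derivative_radial) (rule dG, simp)
  have hG1: "((\<lambda>x. G1 (s x)) has_derivative (\<lambda>h. G2 (s x) * (2 * ((x - a) \<bullet> h)))) (at x)" for x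
    unfolding s_def by (rule has_derivative_radial) (rule dG1, simp)
  have ax: "(x - a) \<bullet> axis j 1 = X j x" for j x by (simp add: X_def inner_axis)
  define d where "d i j = (if i = j then 1 else 0 :: real)" for i j :: 5
  have axd: "axis j (1::real) $ i = d i j" for i j by (simp add: d_def axis_def)
  define \<psi> where "\<psi> i x = G (s x) * X i x" for i x
  \<comment> \<open>\<open>L\<close> is the divergence of the field \<open>\<psi>\<close>. A field
    of this form is a gradient, so its Laplacian is the gradient of \<open>L\<close>, and the
    viscous terms add up to the divergence equation tested with \<open>L\<close>.\<close>
  define L where "L x = 2 * s x * G1 (s x) + 5 * G (s x)" for x
  have \<psi>_test: "\<psi> i \<in> test_functions UNIV" for i
    by (rule smooth_test_function[where a=a and R=R])
      (use smX sm[folded s_def] far zero in \<open>auto simp: \<psi>_def[abs_def]\<close>)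
  have "smooth L"
    unfolding L_def[abs_def] by (intro smooth_add smooth_mult smooth_const sms sm[folded s_def])
  then have L_test: "L \<in> test_functions UNIV"
    by (rule smooth_test_function[where a=a and R=R]) (use far zero in \<open>auto simp: L_def\<close>)
  have d1: "partial_deriv j (\<psi> i) = (\<lambda>x. 2 * (G1 (s x) * (X j x * X i x)) + d i j * G (s x))" for i j
  proof
    fix x
    show "partial_deriv j (\<psi> i) x = 2 * (G1 (s x) * (X j x * X i x)) + d i j * G (s x)"
      unfolding \<psi>_def[abs_def]
      by (subst partial_deriv_eq[OF has_derivative_mult[OF hG hX]]) (simp only: ax axd, simp add: algebra_simps)
  qed
  have d2: "partial_deriv j (partial_deriv j (\<psi> i)) x
      = 4 * G2 (s x) * (X j x * X j x) * X i x + 2 * G1 (s x) * X i x + d i j * (4 * G1 (s x) * X j x)" for i j x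
    unfolding d1
    by (subst partial_deriv_eq[OF has_derivative_add[OF has_derivative_mult_right[OF has_derivative_mult[OF hG1 has_derivative_mult[OF hX hX]]]
            has_derivative_mult_right[OF hG]]]) (simp only: ax axd, simp add: d_def algebra_simps)
  have dL: "partial_deriv i L x = X i x * (4 * s x * G2 (s x) + 14 * G1 (s x))" for i x
    unfolding L_def[abs_def]
    by (subst partial_deriv_eq[OF has_derivative_add[OF has_derivative_mult[OF has_derivative_mult_right[OF hs] hG1]
            has_derivative_mult_right[OF hG]]]) (simp only: ax, simp add: algebra_simps)
  have sum_d: "(\<Sum>j\<in>UNIV. d i j * f j) = f i" for i f
    by (simp add: d_def if_distrib[of "\<lambda>x. x * _"] cong: if_cong)
  have lap: "(\<Sum>j\<in>UNIV. partial_deriv j (partial_deriv j (\<psi> i)) x) = partial_deriv i L x" for i x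
  proof -
    have "(\<Sum>j\<in>UNIV. partial_deriv j (partial_deriv j (\<psi> i)) x)
       = (\<Sum>j\<in>UNIV. 4 * G2 (s x) * X i x * (X j x * X j x)) + (\<Sum>j\<in>(UNIV::5 set). 2 * G1 (s x) * X i x)
         + (\<Sum>j\<in>UNIV. d i j * (4 * G1 (s x) * X j x))"
      unfolding d2 by (simp add: sum.distrib mult_ac)
    also have "\<dots> = 4 * G2 (s x) * X i x * s x + 10 * G1 (s x) * X i x + 4 * G1 (s x) * X i x"
      unfolding sum_d sum_distrib_left[symmetric] sX by simp
    finally show ?thesis by (simp add: dL algebra_simps)
  qed
  have visc: "(\<Sum>i\<in>UNIV. \<Sum>j\<in>UNIV. \<integral>x. u x $ i * partial_deriv j (partial_deriv j (\<psi> i)) x \<partial>lborel) = 0"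
  proof -
    have "(\<Sum>j\<in>UNIV. \<integral>x. u x $ i * partial_deriv j (partial_deriv j (\<psi> i)) x \<partial>lborel)
       = (\<integral>x. u x $ i * partial_deriv i L x \<partial>lborel)" for i
      by (subst Bochner_Integration.integral_sum[symmetric])
        (auto intro!: integrable_mult_test_function locally_integrable_fields partial_deriv_test_functions \<psi>_test
          simp: lap simp flip: sum_distrib_left)
    then show ?thesis using divergence[OF L_test] by simp
  qed
  have conv_int: "integrable lborel (\<lambda>x. u x $ i * u x $ j * partial_deriv j (\<psi> i) x)" for i j
    by (intro integrable_mult_test_function locally_integrable_fields partial_deriv_test_functions \<psi>_test)
  have p_int: "integrable lborel (\<lambda>x. p x * partial_deriv i (\<psi> i) x)" for i
    by (intro integrable_mult_test_function locally_integrable_fields partial_deriv_test_functions \<psi>_test)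
  have F_eq: "F x = (\<Sum>i\<in>UNIV. \<Sum>j\<in>UNIV. u x $ i * u x $ j * partial_deriv j (\<psi> i) x) + (\<Sum>i\<in>UNIV. p x * partial_deriv i (\<psi> i) x)" for x
  proof -
    have "(\<Sum>i\<in>UNIV. \<Sum>j\<in>UNIV. u x $ i * u x $ j * partial_deriv j (\<psi> i) x)
      = (\<Sum>i\<in>UNIV. \<Sum>j\<in>UNIV. 2 * G1 (s x) * ((u x $ i * X i x) * (u x $ j * X j x))) + (\<Sum>i\<in>UNIV. \<Sum>j\<in>UNIV. d i j * (G (s x) * (u x $ i * u x $ j)))"
      unfolding d1 by (simp add: sum.distrib[symmetric] algebra_simps)
    also have "\<dots> = 2 * G1 (s x) * ((\<Sum>i\<in>UNIV. u x $ i * X i x) * (\<Sum>j\<in>UNIV. u x $ j * X j x)) + G (s x) * (\<Sum>i\<in>UNIV. u x $ i * u x $ i)"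
      unfolding sum_d sum_product by (simp only: sum_distrib_left)
    also have "\<dots> = 2 * G1 (s x) * (u x \<bullet> (x - a))\<^sup>2 + G (s x) * (norm (u x))\<^sup>2"
    proof -
      have "(norm (u x))\<^sup>2 = (\<Sum>i\<in>UNIV. u x $ i * u x $ i)"
        by (simp add: power2_norm_eq_inner inner_vec_def)
      moreover have "u x \<bullet> (x - a) = (\<Sum>i\<in>UNIV. u x $ i * X i x)" by (simp add: inner_vec_def X_def)
      ultimately show ?thesis by (simp only: power2_eq_square)
    qed
    finally have 1: "(\<Sum>i\<in>UNIV. \<Sum>j\<in>UNIV. u x $ i * u x $ j * partial_deriv j (\<psi> i) x) = 2 * G1 (s x) * (u x \<bullet> (x - a))\<^sup>2 + G (s x) * (norm (u x))\<^sup>2" .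
    have "(\<Sum>i\<in>UNIV. partial_deriv i (\<psi> i) x) = (\<Sum>i\<in>UNIV. 2 * G1 (s x) * (X i x * X i x)) + (\<Sum>i\<in>(UNIV::5 set). G (s x))"
      unfolding d1 by (simp add: sum.distrib d_def mult.assoc)
    also have "\<dots> = 2 * G1 (s x) * s x + 5 * G (s x)"
      unfolding sum_distrib_left[symmetric] sX by simp
    finally have 2: "(\<Sum>i\<in>UNIV. p x * partial_deriv i (\<psi> i) x) = p x * (2 * G1 (s x) * s x + 5 * G (s x))"
      by (simp flip: sum_distrib_left)
    show ?thesis unfolding 1 2 F_def s_def by simp
  qed
  show "integrable lborel F" unfolding F_eq[abs_def]
    by (intro Bochner_Integration.integrable_add Bochner_Integration.integrable_sum conv_int p_int)
  have "(\<integral>x. F x \<partial>lborel) = (\<Sum>i\<in>UNIV. \<Sum>j\<in>UNIV. \<integral>x. u x $ i * u x $ j * partial_deriv j (\<psi> i) x \<partial>lborel)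
     + (\<Sum>i\<in>UNIV. \<integral>x. p x * partial_deriv i (\<psi> i) x \<partial>lborel)"
    unfolding F_eq by (subst Bochner_Integration.integral_add)
      (auto intro!: Bochner_Integration.integrable_sum conv_int p_int sum.cong
        simp: Bochner_Integration.integral_sum conv_int p_int Bochner_Integration.integrable_sum)
  also have "\<dots> = (\<Sum>i\<in>UNIV. (\<Sum>j\<in>UNIV. \<integral>x. u x $ i * partial_deriv j (partial_deriv j (\<psi> i)) x \<partial>lborel)
        + (\<Sum>j\<in>UNIV. \<integral>x. u x $ i * u x $ j * partial_deriv j (\<psi> i) x \<partial>lborel)
        + (\<integral>x. p x * partial_deriv i (\<psi> i) x \<partial>lborel))"
    using visc by (simp add: sum.distrib)
  also have "\<dots> = 0" by (simp only: momentum[OF \<psi>_test] sum.neutral_const)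
  finally show "(\<integral>x. F x \<partial>lborel) = 0" .
qed

end

section \<open>The rescaled cutoff and the algebra of the pressure identity\<close>

definition cutoff_const :: real where
  "cutoff_const = (SOME C. C \<ge> 1 \<and> (\<forall>t. \<bar>cutoff1 t\<bar> \<le> C * \<bar>t\<bar>) \<and> (\<forall>t. \<bar>cutoff2 t\<bar> \<le> C))"

lemma cutoff_const: "cutoff_const \<ge> 1" "\<bar>cutoff1 t\<bar> \<le> cutoff_const * \<bar>t\<bar>" "\<bar>cutoff2 t\<bar> \<le> cutoff_const"
proof -
  have "\<exists>C. C \<ge> 1 \<and> (\<forall>t. \<bar>cutoff1 t\<bar> \<le> C * \<bar>t\<bar>) \<and> (\<forall>t. \<bar>cutoff2 t\<bar> \<le> C)"
    using cutoff_bounds by metis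
  from someI_ex[OF this] show "cutoff_const \<ge> 1" "\<bar>cutoff1 t\<bar> \<le> cutoff_const * \<bar>t\<bar>" "\<bar>cutoff2 t\<bar> \<le> cutoff_const"
    by (auto simp: cutoff_const_def)
qed

text \<open>One factor R^{-2} comes from the chain rule and another from the linear vanishing of
  \<open>cutoff1\<close> at 0. The extra s / R^2 is what makes the truncation errors summable
  against the weights.\<close>

lemma cutoff1_scaled_bound:
  assumes "s \<ge> 0" "R > 0"
  shows "\<bar>cutoff1 (s / R\<^sup>2) / R\<^sup>2\<bar> \<le> cutoff_const * s / R ^ 4 * indicator {..<R\<^sup>2} s"
proof (cases "s < R\<^sup>2")
  case True
  have "\<bar>cutoff1 (s / R\<^sup>2)\<bar> / R\<^sup>2 \<le> (cutoff_const * \<bar>s / R\<^sup>2\<bar>) / R\<^sup>2"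
    by (intro divide_right_mono cutoff_const) auto
  then show ?thesis using True assms by (simp add: abs_mult field_simps flip: power_add)
next
  case False
  then have "cutoff1 (s / R\<^sup>2) = 0" using assms by (intro cutoff_outside) (simp add: field_simps)
  then show ?thesis using False by simp
qed

lemma cutoff_scaled_zero: "s \<ge> R\<^sup>2 \<Longrightarrow> R > 0 \<Longrightarrow> cutoff (s / R\<^sup>2) = 0" "s \<ge> R\<^sup>2 \<Longrightarrow> R > 0 \<Longrightarrow> cutoff1 (s / R\<^sup>2) = 0"
  "s \<ge> R\<^sup>2 \<Longrightarrow> R > 0 \<Longrightarrow> cutoff2 (s / R\<^sup>2) = 0"
  using cutoff_outside[of "s / R\<^sup>2"] by (auto simp: field_simps)

lemma cutoff_measurable [measurable]: "cutoff \<in> borel_measurable borel" "cutoff1 \<in> borel_measurable borel"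
  by (meson DERIV_isCont borel_measurable_continuous_onI continuous_at_imp_continuous_on cutoff_deriv cutoff1_deriv)+

lemma cutoff_limit: "(\<lambda>k. cutoff (s / (real (Suc k))\<^sup>2)) \<longlonglongrightarrow> 1"
proof -
  have "(\<lambda>k. s * (inverse (real (Suc k)))\<^sup>2) \<longlonglongrightarrow> s * 0\<^sup>2"
    by (intro tendsto_intros LIMSEQ_inverse_real_of_nat)
  then have "(\<lambda>k. s / (real (Suc k))\<^sup>2) \<longlonglongrightarrow> 0" by (simp add: divide_inverse power_inverse)
  from isCont_tendsto_compose[OF DERIV_isCont[OF cutoff_deriv] this] show ?thesis by simp
qed

text \<open>This is the weight left in the truncation error. It is bounded uniformly in
  \<open>A\<close>, and by R when s <= R^2, which turns R^{-4} into the R^{-3} that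
  \<open>square_p_bound\<close> compensates.\<close>

lemma powr_shift_le:
  assumes "A > 0" "s \<ge> 0"
  shows "(A + s) powr (-3/2) * s\<^sup>2 \<le> sqrt s"
proof (cases "s = 0")
  case False
  have "(A + s) powr (-3/2) * s\<^sup>2 \<le> s powr (-3/2) * s powr 2"
    using assms False by (auto intro!: mult_right_mono powr_mono2')
  also have "\<dots> = s powr (-3/2 + 2)" by (rule powr_add[symmetric])
  also have "\<dots> = sqrt s" using assms by (simp add: powr_half_sqrt)
  finally show ?thesis .
qed simp

text \<open>If \<open>E\<close> has infinite integral there is nothing to show. Otherwise
  \<open>E + F\<close> is integrable and dominates \<open>Q\<close>, so the signed integrals may be
  compared.\<close>

lemma nn_integral_le_of_identity:
  fixes F Q E :: "'a \<Rightarrow> real"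
  assumes F: "integrable N F" "(\<integral>x. F x \<partial>N) \<le> 0"
    and [measurable]: "Q \<in> borel_measurable N" "E \<in> borel_measurable N"
    and nn: "\<And>x. Q x \<ge> 0" "\<And>x. E x \<ge> 0" and le: "\<And>x. Q x \<le> E x + F x"
  shows "(\<integral>\<^sup>+x. ennreal (Q x) \<partial>N) \<le> (\<integral>\<^sup>+x. ennreal (E x) \<partial>N)"
proof (cases "(\<integral>\<^sup>+x. ennreal (E x) \<partial>N) = \<infinity>")
  case False
  have E: "integrable N E"
    by (rule integrableI_nonneg) (use nn False in \<open>auto simp: less_top\<close>)
  have EF: "integrable N (\<lambda>x. E x + F x)" using E F by simp
  have Q: "integrable N Q"
    by (rule Bochner_Integration.integrable_bound[OF EF]) (use le nn in \<open>auto intro!: AE_I2 order_trans[OF le abs_ge_self]\<close>)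
  have "(\<integral>x. Q x \<partial>N) \<le> (\<integral>x. E x + F x \<partial>N)" by (rule integral_mono[OF Q EF le])
  also have "\<dots> \<le> (\<integral>x. E x \<partial>N)" using E F by simp
  finally show ?thesis
    using nn by (simp add: nn_integral_eq_integral Q E ennreal_leI)
qed simp

lemma mem_ball_square_iff:
  fixes x a :: "'a::real_normed_vector"
  assumes "R > 0"
  shows "x \<in> ball a R \<longleftrightarrow> (norm (x - a))\<^sup>2 < R\<^sup>2"
proof -
  have "R \<le> norm (x - a) \<longleftrightarrow> R\<^sup>2 \<le> (norm (x - a))\<^sup>2"
    using assms by (intro power_mono_iff[symmetric]) auto
  then show ?thesis by (simp add: dist_norm norm_minus_commute flip: not_le)
qed

text \<open>Here q stands for (A+s)^{-5/2}, W for (u . (x-a))^2, n for |u|^2, and the pressure has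
  been replaced by -h - n/2. The exponent 3/2 of the weight is the one at which the terms in s n
  cancel: only 3/2 A n survives, with the same sign as the terms in W and h. What carries
  \<open>c1\<close> is the truncation error.\<close>

lemma head_algebra:
  fixes A s q c c1 W n h :: real
  shows "2 * (-3/2 * q * c + (A + s) * q * c1) * W + (A + s) * q * c * n
      + (- h - n / 2) * (2 * (-3/2 * q * c + (A + s) * q * c1) * s + 5 * ((A + s) * q * c))
    = - (c * q * (3 * W + 3/2 * A * n + (2 * s + 5 * A) * h)) + (A + s) * q * c1 * (2 * W + 2 * s * (- h - n / 2))"
  by (simp add: algebra_simps add_divide_distrib)

lemma ennreal_mult_indicator:
  assumes "c \<ge> 0" "y \<ge> 0"
  shows "ennreal (c * (y * indicator S x)) = ennreal c * (ennreal y * indicator S x)"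
  using assms by (auto simp: indicator_def ennreal_mult)

section \<open>The pressure identity with a truncated Newton weight\<close>

context nonpositive_head
begin

text \<open>By \<open>head_algebra\<close> the identity has a definite sign up to the
  \<open>c1\<close> terms. The contribution 3 W and the surplus 3 A H are dropped; W <= s |u|^2
  bounds the error by 2 s (|u|^2 + |p|) times the derivative of the cutoff. Small \<open>A\<close>
  will give the Newton potential of \<open>H\<close>, while \<open>A = 1\<close> retains
  |u|^2.\<close>

lemma pressure_estimate:
  fixes a :: "real^5"
  assumes A: "A > 0" and R: "R > 0"
  defines "s \<equiv> \<lambda>x. (norm (x - a))\<^sup>2"
  shows "(\<integral>\<^sup>+x. ennreal (cutoff (s x / R\<^sup>2) * (A + s x) powr (-5/2) * (3/2 * A * (norm (u x))\<^sup>2 + 2 * (A + s x) * H x)) \<partial>lborel)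
    \<le> (\<integral>\<^sup>+x. ennreal (2 * cutoff_const * ((A + s x) powr (-3/2) * (s x)\<^sup>2) / R ^ 4 * ((norm (u x))\<^sup>2 + \<bar>p x\<bar>) * indicator (ball a R) x) \<partial>lborel)"
proof -
  define g g1 g2 where "g t = (A + t) powr (-3/2)" and "g1 t = -3/2 * (A + t) powr (-5/2)"
    and "g2 t = 15/4 * (A + t) powr (-7/2)" for t
  define G where "G t = g t * cutoff (t / R\<^sup>2)" for t
  define G1 where "G1 t = g1 t * cutoff (t / R\<^sup>2) + g t * (cutoff1 (t / R\<^sup>2) / R\<^sup>2)" for t
  define G2 where "G2 t = g2 t * cutoff (t / R\<^sup>2) + g1 t * (cutoff1 (t / R\<^sup>2) / R\<^sup>2) + (g1 t * (cutoff1 (t / R\<^sup>2) / R\<^sup>2) + g t * (cutoff2 (t / R\<^sup>2) / R\<^sup>2 / R\<^sup>2))" for t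
  have dg: "(g has_real_derivative g1 t) (at t)" "(g1 has_real_derivative g2 t) (at t)" if "t \<ge> 0" for t
    unfolding g_def[abs_def] g1_def[abs_def] g2_def using A that
    by (auto intro!: derivative_eq_intros)
  have dc: "((\<lambda>t. cutoff (t / R\<^sup>2)) has_real_derivative cutoff1 (t / R\<^sup>2) / R\<^sup>2) (at t)"
    "((\<lambda>t. cutoff1 (t / R\<^sup>2) / R\<^sup>2) has_real_derivative cutoff2 (t / R\<^sup>2) / R\<^sup>2 / R\<^sup>2) (at t)" for t
    using DERIV_chain2[OF cutoff_deriv DERIV_cdivide[OF DERIV_ident, of "R\<^sup>2"], of t UNIV]
      DERIV_cdivide[OF DERIV_chain2[OF cutoff1_deriv DERIV_cdivide[OF DERIV_ident, of "R\<^sup>2"], of t UNIV], of "R\<^sup>2"]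
    by simp_all
  have dG: "(G has_real_derivative G1 t) (at t)" "(G1 has_real_derivative G2 t) (at t)" if "t \<ge> 0" for t
    unfolding G_def[abs_def] G1_def[abs_def] G2_def
    using DERIV_mult[OF dg(1)[OF that] dc(1)] DERIV_add[OF DERIV_mult[OF dg(2)[OF that] dc(1)] DERIV_mult[OF dg(1)[OF that] dc(2)]]
    by (simp_all add: mult.commute add.commute)
  have s: "s x \<ge> 0" for x by (simp add: s_def)
  have sms: "smooth s" unfolding s_def by (rule smooth_norm_sq)
  have smR: "smooth (\<lambda>x. s x / R\<^sup>2)" using smooth_mult[OF sms smooth_const[of "1 / R\<^sup>2"]] by simp
  have smp: "smooth (\<lambda>x. (A + s x) powr q)" for q
    by (rule smooth_powr) (use smooth_add[OF smooth_const sms] s A in \<open>auto simp: add_pos_nonneg\<close>)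
  have smg: "smooth (\<lambda>x. g (s x))" "smooth (\<lambda>x. g1 (s x))"
    unfolding g_def g1_def by (intro smp smooth_mult smooth_const)+
  have smc: "smooth (\<lambda>x. cutoff1 (s x / R\<^sup>2) / R\<^sup>2)"
    using smooth_mult[OF smooth_cutoff(2)[OF smR] smooth_const[of "1 / R\<^sup>2"]] by simp
  have smG: "smooth (\<lambda>x. G (s x))" "smooth (\<lambda>x. G1 (s x))"
    unfolding G_def G1_def by (intro smooth_add smooth_mult smg smc smooth_cutoff smR)+
  define F where "F = (\<lambda>x. 2 * G1 (s x) * (u x \<bullet> (x - a))\<^sup>2 + G (s x) * (norm (u x))\<^sup>2
    + p x * (2 * G1 (s x) * s x + 5 * G (s x)))"
  have F: "integrable lborel F" "(\<integral>x. F x \<partial>lborel) = 0"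
    unfolding F_def s_def
    using pressure_identity[where a=a and G=G and ?G1.0=G1 and ?G2.0=G2 and R=R, OF smG[unfolded s_def] dG _ _ R]
    by (auto simp: G_def G1_def cutoff_scaled_zero R)
  define Q where "Q x = cutoff (s x / R\<^sup>2) * (A + s x) powr (-5/2) * (3/2 * A * (norm (u x))\<^sup>2 + 2 * (A + s x) * H x)" for x
  define E where "E x = 2 * cutoff_const * ((A + s x) powr (-3/2) * (s x)\<^sup>2) / R ^ 4 * ((norm (u x))\<^sup>2 + \<bar>p x\<bar>) * indicator (ball a R) x" for x
  have [measurable]: "s \<in> borel_measurable borel" by (rule smooth_measurable[OF sms])
  have "(\<integral>\<^sup>+x. ennreal (Q x) \<partial>lborel) \<le> (\<integral>\<^sup>+x. ennreal (E x) \<partial>lborel)"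
  proof (rule nn_integral_le_of_identity)
    show "Q \<in> borel_measurable lborel" unfolding Q_def by measurable
    show "E \<in> borel_measurable lborel" unfolding E_def by measurable
    show "Q x \<ge> 0" for x unfolding Q_def using cutoff_range[of "s x / R\<^sup>2"] A s[of x] H_nonneg[of x] by simp
    show "E x \<ge> 0" for x unfolding E_def using cutoff_const(1) R by (auto intro!: mult_nonneg_nonneg divide_nonneg_pos)
    show "Q x \<le> E x + - F x" for x
    proof -
      define n W c c1 q where "n = (norm (u x))\<^sup>2" and "W = (u x \<bullet> (x - a))\<^sup>2" and "c = cutoff (s x / R\<^sup>2)"
        and "c1 = cutoff1 (s x / R\<^sup>2) / R\<^sup>2" and "q = (A + s x) powr (-5/2)"
      \<comment> \<open>The power -3/2 is written with \<open>q\<close> so that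
        \<open>head_algebra\<close> applies as a polynomial identity.\<close>
      have q: "(A + s x) powr (-3/2) = (A + s x) * q"
        using A s[of x] powr_mult_base[of "A + s x" "-5/2"] by (simp add: q_def)
      have W: "0 \<le> W" "W \<le> s x * n"
      proof -
        have "(u x \<bullet> (x - a))\<^sup>2 \<le> (norm (u x) * norm (x - a))\<^sup>2"
          using Cauchy_Schwarz_ineq2[of "u x" "x - a"] by (intro abs_le_square_iff[THEN iffD1]) auto
        then show "W \<le> s x * n" by (simp add: W_def s_def n_def power_mult_distrib mult.commute)
      qed (simp add: W_def)
      have c: "0 \<le> c * q" using cutoff_range[of "s x / R\<^sup>2"] by (simp add: c_def q_def)
      have main: "F x = - (c * q * (3 * W + 3/2 * A * n + (2 * s x + 5 * A) * H x)) + (A + s x) * q * c1 * (2 * W + 2 * s x * p x)"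
      proof -
        have "G1 (s x) = -3/2 * q * c + (A + s x) * q * c1"
          by (simp only: G1_def g1_def g_def q c_def c1_def) (simp only: q_def)
        moreover have "G (s x) = (A + s x) * q * c" by (simp only: G_def g_def q c_def)
        moreover have "p x = - H x - n / 2" by (simp only: p_H n_def)
        moreover have "F x = 2 * G1 (s x) * W + G (s x) * n + p x * (2 * G1 (s x) * s x + 5 * G (s x))"
          by (simp only: F_def W_def n_def)
        ultimately show ?thesis by (simp only: head_algebra)
      qed
      have As: "0 \<le> (A + s x) * q" using A s[of x] by (simp add: q_def)
      have c1: "\<bar>c1\<bar> \<le> cutoff_const * s x / R ^ 4 * indicator (ball a R) x"
      proof -
        have "x \<in> ball a R \<longleftrightarrow> s x < R\<^sup>2"
          unfolding s_def by (rule mem_ball_square_iff[OF R])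
        then show ?thesis using cutoff1_scaled_bound[OF s R, of x] by (simp add: c1_def indicator_def)
      qed
      have "\<bar>2 * W + 2 * s x * p x\<bar> \<le> 2 * s x * (n + \<bar>p x\<bar>)"
      proof -
        have "\<bar>2 * W + 2 * s x * p x\<bar> \<le> 2 * W + 2 * s x * \<bar>p x\<bar>"
          using abs_triangle_ineq[of "2 * W" "2 * s x * p x"] W s[of x] by (simp add: abs_mult)
        then show ?thesis using W by (simp add: algebra_simps)
      qed
      then have "\<bar>c1\<bar> * \<bar>2 * W + 2 * s x * p x\<bar> \<le> (cutoff_const * s x / R ^ 4 * indicator (ball a R) x) * (2 * s x * (n + \<bar>p x\<bar>))"
        by (intro mult_mono c1) (use cutoff_const(1) s R in auto)
      then have "(A + s x) * q * \<bar>c1 * (2 * W + 2 * s x * p x)\<bar>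
          \<le> (A + s x) * q * ((cutoff_const * s x / R ^ 4 * indicator (ball a R) x) * (2 * s x * (n + \<bar>p x\<bar>)))"
        unfolding abs_mult by (intro mult_left_mono As)
      also have "\<dots> = E x" unfolding E_def q n_def by (simp add: power2_eq_square)
      finally have err0: "(A + s x) * q * \<bar>c1 * (2 * W + 2 * s x * p x)\<bar> \<le> E x" .
      have err: "(A + s x) * q * c1 * (2 * W + 2 * s x * p x) \<le> E x"
      proof -
        have "\<bar>(A + s x) * q * (c1 * (2 * W + 2 * s x * p x))\<bar> = (A + s x) * q * \<bar>c1 * (2 * W + 2 * s x * p x)\<bar>"
          unfolding abs_mult[of "(A + s x) * q"] abs_of_nonneg[OF As] ..
        then show ?thesis using err0 unfolding mult.assoc[of "(A + s x) * q"] by linarith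
      qed
      have "3/2 * A * n + 2 * (A + s x) * H x \<le> 3 * W + 3/2 * A * n + (2 * s x + 5 * A) * H x"
        using W(1) A H_nonneg[of x] by (simp add: algebra_simps)
      then have "Q x \<le> c * q * (3 * W + 3/2 * A * n + (2 * s x + 5 * A) * H x)"
        unfolding Q_def c_def[symmetric] q_def[symmetric] n_def[symmetric] by (intro mult_left_mono c)
      moreover have "Q x \<le> X \<Longrightarrow> Y \<le> E x \<Longrightarrow> Q x \<le> E x + - (- X + Y)" for X Y :: real by linarith
      ultimately show ?thesis using err unfolding main by blast
    qed
  qed (use F in auto)
  then show ?thesis by (simp add: Q_def E_def)
qed

definition potential_bound :: real where "potential_bound = 32 * cutoff_const * (ball_vol + M)"

text \<open>Once R >= |a|, the ball around \<open>a\<close> lies in the ball of radius 2 R around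
  the origin. This is how bounds on centred balls give a constant free of the centre: 2 C R^{-3}
  times 2 (\<open>ball_vol\<close> + M) (2 R)^3 is \<open>potential_bound\<close>, with C =
  \<open>cutoff_const\<close>.\<close>

lemma pressure_error_bound:
  assumes A: "A > 0" and R: "R > 0" "R \<ge> norm a"
  shows "(\<integral>\<^sup>+x. ennreal (2 * cutoff_const * ((A + (norm (x - a))\<^sup>2) powr (-3/2) * ((norm (x - a))\<^sup>2)\<^sup>2) / R ^ 4
      * ((norm (u x))\<^sup>2 + \<bar>p x\<bar>) * indicator (ball a R) x) \<partial>lborel) \<le> ennreal potential_bound"
proof -
  have "2 * cutoff_const * ((A + (norm (x - a))\<^sup>2) powr (-3/2) * ((norm (x - a))\<^sup>2)\<^sup>2) / R ^ 4
      * ((norm (u x))\<^sup>2 + \<bar>p x\<bar>) * indicator (ball a R) x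
     \<le> (2 * cutoff_const / R ^ 3) * (((norm (u x))\<^sup>2 + \<bar>p x\<bar>) * indicator (ball 0 (2 * R)) x)" for x
  proof (cases "x \<in> ball a R")
    case True
    then have xa: "norm (x - a) \<le> R" by (simp add: dist_norm norm_minus_commute)
    have x: "x \<in> ball 0 (2 * R)"
      using norm_triangle_ineq[of "x - a" a] True R by (simp add: dist_norm norm_minus_commute)
    have "2 * cutoff_const * ((A + (norm (x - a))\<^sup>2) powr (-3/2) * ((norm (x - a))\<^sup>2)\<^sup>2) / R ^ 4 \<le> 2 * cutoff_const * R / R ^ 4"
      using powr_shift_le[OF A, of "(norm (x - a))\<^sup>2"] xa cutoff_const(1) R by (intro divide_right_mono mult_left_mono) auto
    also have "\<dots> = 2 * cutoff_const / R ^ 3" using R by (simp add: field_simps eval_nat_numeral)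
    finally have le: "2 * cutoff_const * ((A + (norm (x - a))\<^sup>2) powr (-3/2) * ((norm (x - a))\<^sup>2)\<^sup>2) / R ^ 4 \<le> 2 * cutoff_const / R ^ 3" .
    show ?thesis using mult_right_mono[OF le, of "(norm (u x))\<^sup>2 + \<bar>p x\<bar>"] True x by simp
  next
    case False
    then show ?thesis using cutoff_const(1) R by simp
  qed
  then have "(\<integral>\<^sup>+x. ennreal (2 * cutoff_const * ((A + (norm (x - a))\<^sup>2) powr (-3/2) * ((norm (x - a))\<^sup>2)\<^sup>2) / R ^ 4
      * ((norm (u x))\<^sup>2 + \<bar>p x\<bar>) * indicator (ball a R) x) \<partial>lborel)
     \<le> (\<integral>\<^sup>+x. ennreal (2 * cutoff_const / R ^ 3) * (ennreal ((norm (u x))\<^sup>2 + \<bar>p x\<bar>) * indicator (ball 0 (2 * R)) x) \<partial>lborel)"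
    using cutoff_const(1) R
    by (intro nn_integral_mono, subst ennreal_mult_indicator[symmetric]) (auto intro!: ennreal_leI)
  also have "\<dots> = ennreal (2 * cutoff_const / R ^ 3) * (\<integral>\<^sup>+x. ennreal ((norm (u x))\<^sup>2 + \<bar>p x\<bar>) * indicator (ball 0 (2 * R)) x \<partial>lborel)"
    by (rule nn_integral_cmult) measurable
  also have "\<dots> \<le> ennreal (2 * cutoff_const / R ^ 3) * ennreal (2 * (ball_vol + M) * (2 * R) ^ 3)"
    using R by (intro mult_left_mono square_p_bound) auto
  also have "\<dots> = ennreal (2 * cutoff_const / R ^ 3 * (2 * (ball_vol + M) * (2 * R) ^ 3))"
    using cutoff_const(1) R M by (intro ennreal_mult[symmetric]) auto
  also have "2 * cutoff_const / R ^ 3 * (2 * (ball_vol + M) * (2 * R) ^ 3) = potential_bound"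
    using R by (simp add: potential_bound_def power_mult_distrib field_simps)
  finally show ?thesis .
qed

text \<open>Fatou's lemma with an upper bound that may move with \<open>k\<close>, as needed when
  that bound is a truncation error tending to 0.\<close>

lemma Liminf_bound:
  fixes f :: "nat \<Rightarrow> real^5 \<Rightarrow> ennreal"
  assumes [measurable]: "\<And>k. f k \<in> borel_measurable borel"
    and lim: "AE x in lborel. (\<lambda>k. f k x) \<longlonglongrightarrow> g x"
    and bound: "\<forall>\<^sub>F k in sequentially. (\<integral>\<^sup>+x. f k x \<partial>lborel) \<le> c k" and c: "c \<longlonglongrightarrow> K"
  shows "(\<integral>\<^sup>+x. g x \<partial>lborel) \<le> K"
proof -
  have "(\<integral>\<^sup>+x. g x \<partial>lborel) = (\<integral>\<^sup>+x. liminf (\<lambda>k. f k x) \<partial>lborel)"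
    by (rule nn_integral_cong_AE) (use lim in eventually_elim, simp add: lim_imp_Liminf)
  also have "\<dots> \<le> liminf (\<lambda>k. \<integral>\<^sup>+x. f k x \<partial>lborel)" by (rule nn_integral_liminf) simp
  also have "\<dots> \<le> liminf c" by (rule Liminf_mono[OF bound])
  also have "\<dots> = K" using c by (simp add: lim_imp_Liminf)
  finally show ?thesis .
qed

text \<open>Fatou along A = 1/(k+1) and radius k+1 simultaneously in
  \<open>pressure_estimate\<close>; the error bound is uniform in both as soon as the radius exceeds
  |a|. The limit is twice the integrand, and the factor 2 is given away.\<close>

lemma head_potential: "(\<integral>\<^sup>+x. ennreal (H x / norm (x - a) ^ 3) \<partial>lborel) \<le> ennreal potential_bound"
proof -
  define s where "s x = (norm (x - a))\<^sup>2" for x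
  define r where "r k = real (Suc k)" for k
  define e where "e k = inverse (real (Suc k))" for k
  have er: "e k > 0" "r k > 0" for k by (auto simp: e_def r_def)
  have e0: "e \<longlonglongrightarrow> 0" unfolding e_def[abs_def] by (rule LIMSEQ_inverse_real_of_nat)
  define f where "f k x = cutoff (s x / (r k)\<^sup>2) * (e k + s x) powr (-5/2) * (3/2 * e k * (norm (u x))\<^sup>2 + 2 * (e k + s x) * H x)" for k x
  have [measurable]: "s \<in> borel_measurable borel" unfolding s_def[abs_def] by measurable
  have "(\<integral>\<^sup>+x. ennreal (2 * (H x / norm (x - a) ^ 3)) \<partial>lborel) \<le> ennreal potential_bound"
  proof (rule Liminf_bound[where f="\<lambda>k x. ennreal (f k x)"])
    show "(\<lambda>x. ennreal (f k x)) \<in> borel_measurable borel" for k unfolding f_def by measurable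
    have "AE x in lborel. x \<noteq> a" by (rule AE_lborel_singleton)
    then show "AE x in lborel. (\<lambda>k. ennreal (f k x)) \<longlonglongrightarrow> ennreal (2 * (H x / norm (x - a) ^ 3))"
    proof eventually_elim
      case (elim x)
      then have s: "s x > 0" by (simp add: s_def)
      have "(\<lambda>k. f k x) \<longlonglongrightarrow> 1 * (0 + s x) powr (-5/2) * (3/2 * 0 * (norm (u x))\<^sup>2 + 2 * (0 + s x) * H x)"
        unfolding f_def r_def using s by (intro tendsto_intros cutoff_limit e0) auto
      also have "1 * (0 + s x) powr (-5/2) * (3/2 * 0 * (norm (u x))\<^sup>2 + 2 * (0 + s x) * H x) = 2 * (H x / norm (x - a) ^ 3)"
      proof -
        have "(s x) powr (-5/2) * s x = (norm (x - a)) powr (-5) * norm (x - a) powr 2"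
          using elim by (simp add: s_def powr_powr flip: powr_numeral)
        also have "\<dots> = norm (x - a) powr (-5 + 2)" by (rule powr_add[symmetric])
        also have "\<dots> = 1 / norm (x - a) ^ 3" using elim by (simp add: powr_minus_divide)
        finally have eq: "(s x) powr (-5/2) * s x = 1 / norm (x - a) ^ 3" .
        have "1 * (0 + s x) powr (-5/2) * (3/2 * 0 * (norm (u x))\<^sup>2 + 2 * (0 + s x) * H x) = 2 * H x * ((s x) powr (-5/2) * s x)"
          by simp
        then show ?thesis unfolding eq by simp
      qed
      finally show ?case by (rule tendsto_ennrealI)
    qed
    obtain n :: nat where n: "norm a \<le> real n" using real_arch_simple by blast
    show "\<forall>\<^sub>F k in sequentially. (\<integral>\<^sup>+x. ennreal (f k x) \<partial>lborel) \<le> ennreal potential_bound"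
      using eventually_ge_at_top[of n]
    proof eventually_elim
      case (elim k)
      then have "norm a \<le> r k" using n by (simp add: r_def)
      then show ?case
        unfolding f_def s_def
        by (intro order_trans[OF pressure_estimate pressure_error_bound] er) auto
    qed
  qed simp
  moreover have "(\<integral>\<^sup>+x. ennreal (H x / norm (x - a) ^ 3) \<partial>lborel) \<le> (\<integral>\<^sup>+x. ennreal (2 * (H x / norm (x - a) ^ 3)) \<partial>lborel)"
  proof (intro nn_integral_mono ennreal_leI)
    fix x
    have "0 \<le> H x / norm (x - a) ^ 3" using H_nonneg[of x] by simp
    then show "H x / norm (x - a) ^ 3 \<le> 2 * (H x / norm (x - a) ^ 3)" by linarith
  qed
  ultimately show ?thesis by (rule order_trans[rotated])
qed

lemma head_weighted: "(\<integral>\<^sup>+x. ennreal (H x * (1 + (norm x)\<^sup>2) powr (-3/2)) \<partial>lborel) \<le> ennreal potential_bound"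
proof -
  have "AE x in lborel. x \<noteq> (0 :: real^5)" by (rule AE_lborel_singleton)
  then have "AE x in lborel. ennreal (H x * (1 + (norm x)\<^sup>2) powr (-3/2)) \<le> ennreal (H x / norm (x - 0) ^ 3)"
  proof eventually_elim
    case (elim x)
    have "(1 + (norm x)\<^sup>2) powr (-3/2) \<le> ((norm x)\<^sup>2) powr (-3/2)" using elim by (intro powr_mono2') auto
    also have "\<dots> = norm x powr (-3)" using elim by (simp add: powr_powr flip: powr_numeral)
    also have "\<dots> = 1 / norm x ^ 3" using elim by (simp add: powr_minus_divide)
    finally show ?case using mult_left_mono[OF _ H_nonneg[of x]] by (fastforce intro!: ennreal_leI)
  qed
  then have "(\<integral>\<^sup>+x. ennreal (H x * (1 + (norm x)\<^sup>2) powr (-3/2)) \<partial>lborel) \<le> (\<integral>\<^sup>+x. ennreal (H x / norm (x - 0) ^ 3) \<partial>lborel)"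
    by (rule nn_integral_mono_AE)
  also note head_potential
  finally show ?thesis .
qed

text \<open>The assumption and \<open>head_weighted\<close> make (1+s)^{-3/2} (|u|^2 + |p|)
  integrable. The truncation error is this density times a constant times s^2 / R^4 on the ball: the
  last factor is at most 1 and tends to 0 at each point, so dominated convergence removes the
  error.\<close>

lemma vanishing_if_weighted_finite:
  assumes fin: "(\<integral>\<^sup>+x. ennreal ((norm (u x))\<^sup>2 * (1 + (norm x)\<^sup>2) powr (-3/2)) \<partial>lborel) < \<infinity>"
  shows "AE x in lborel. u x = 0 \<and> p x = 0"
proof -
  define s where "s x = (norm (x - 0))\<^sup>2" for x :: "real^5"
  define r where "r k = real (Suc k)" for k
  have r: "r k > 0" for k by (auto simp: r_def)
  have [measurable]: "s \<in> borel_measurable borel" unfolding s_def[abs_def] by measurable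
  define f where "f k x = cutoff (s x / (r k)\<^sup>2) * (1 + s x) powr (-5/2) * (3/2 * 1 * (norm (u x))\<^sup>2 + 2 * (1 + s x) * H x)" for k x
  define E where "E k x = 2 * cutoff_const * ((1 + s x) powr (-3/2) * (s x)\<^sup>2) / (r k) ^ 4 * ((norm (u x))\<^sup>2 + \<bar>p x\<bar>) * indicator (ball 0 (r k)) x" for k x
  define W where "W x = (1 + s x) powr (-3/2) * ((norm (u x))\<^sup>2 + \<bar>p x\<bar>)" for x
  have W0: "W x \<ge> 0" for x by (simp add: W_def)
  have W_fin: "(\<integral>\<^sup>+x. ennreal (W x) \<partial>lborel) < \<infinity>"
  proof -
    have "(\<integral>\<^sup>+x. ennreal (W x) \<partial>lborel) \<le> (\<integral>\<^sup>+x. 2 * ennreal ((norm (u x))\<^sup>2 * (1 + (norm x)\<^sup>2) powr (-3/2)) + ennreal (H x * (1 + (norm x)\<^sup>2) powr (-3/2)) \<partial>lborel)"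
    proof (rule nn_integral_mono)
      fix x :: "real^5"
      define q where "q = (1 + (norm x)\<^sup>2) powr (-3/2)"
      have q: "q \<ge> 0" by (simp add: q_def)
      have "W x = 3/2 * ((norm (u x))\<^sup>2 * q) + H x * q" by (simp add: W_def s_def abs_p q_def algebra_simps)
      also have "\<dots> \<le> 2 * ((norm (u x))\<^sup>2 * q) + H x * q" using q by simp
      finally have "ennreal (W x) \<le> ennreal (2 * ((norm (u x))\<^sup>2 * q) + H x * q)" by (rule ennreal_leI)
      also have "\<dots> = ennreal (2 * ((norm (u x))\<^sup>2 * q)) + ennreal (H x * q)" using q H_nonneg[of x] by (intro ennreal_plus) auto
      also have "ennreal (2 * ((norm (u x))\<^sup>2 * q)) = 2 * ennreal ((norm (u x))\<^sup>2 * q)"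
        using q by (subst ennreal_mult) auto
      finally show "ennreal (W x) \<le> 2 * ennreal ((norm (u x))\<^sup>2 * (1 + (norm x)\<^sup>2) powr (-3/2)) + ennreal (H x * (1 + (norm x)\<^sup>2) powr (-3/2))"
        by (simp add: q_def)
    qed
    also have "\<dots> = 2 * (\<integral>\<^sup>+x. ennreal ((norm (u x))\<^sup>2 * (1 + (norm x)\<^sup>2) powr (-3/2)) \<partial>lborel) + (\<integral>\<^sup>+x. ennreal (H x * (1 + (norm x)\<^sup>2) powr (-3/2)) \<partial>lborel)"
      by (simp add: nn_integral_add nn_integral_cmult)
    also have "\<dots> < \<infinity>"
      using fin order.strict_trans1[OF head_weighted] by (simp add: ennreal_mult_less_top)
    finally show ?thesis .
  qed
  have E_lim: "(\<lambda>k. \<integral>\<^sup>+x. ennreal (E k x) \<partial>lborel) \<longlonglongrightarrow> (\<integral>\<^sup>+x. 0 \<partial>(lborel :: (real^5) measure))"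
  proof (rule nn_integral_dominated_convergence[where w="\<lambda>x. ennreal (2 * cutoff_const) * ennreal (W x)"])
    show "(\<lambda>x. ennreal (E k x)) \<in> borel_measurable lborel" for k unfolding E_def by measurable
    show "(\<lambda>x. ennreal (2 * cutoff_const) * ennreal (W x)) \<in> borel_measurable lborel" unfolding W_def by measurable
    have E_eq: "E k x = 2 * cutoff_const * W x * ((s x)\<^sup>2 / (r k) ^ 4 * indicator (ball 0 (r k)) x)" for k x
      by (simp add: E_def W_def)
    show "AE x in lborel. ennreal (E k x) \<le> ennreal (2 * cutoff_const) * ennreal (W x)" for k
    proof (rule AE_I2)
      fix x :: "real^5"
      have "(s x)\<^sup>2 / (r k) ^ 4 * indicator (ball 0 (r k)) x \<le> 1"
      proof (cases "x \<in> ball 0 (r k)")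
        case True
        then have "norm x ^ 4 \<le> r k ^ 4" by (intro power_mono) auto
        then show ?thesis using True r[of k] by (simp add: s_def field_simps flip: power_mult)
      qed simp
      then have "E k x \<le> 2 * cutoff_const * W x * 1"
        unfolding E_eq using cutoff_const(1) W0[of x] by (intro mult_left_mono) auto
      then show "ennreal (E k x) \<le> ennreal (2 * cutoff_const) * ennreal (W x)"
        using cutoff_const(1) W0[of x] by (simp add: ennreal_leI flip: ennreal_mult)
    qed
    show "(\<integral>\<^sup>+x. ennreal (2 * cutoff_const) * ennreal (W x) \<partial>lborel) < \<infinity>"
      using W_fin by (subst nn_integral_cmult) (auto simp: W_def ennreal_mult_less_top)
    show "AE x in lborel. (\<lambda>k. ennreal (E k x)) \<longlonglongrightarrow> 0"
    proof (rule AE_I2)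
      fix x :: "real^5"
      have "(\<lambda>k. 2 * cutoff_const * W x * (s x)\<^sup>2 * (inverse (real (Suc k))) ^ 4) \<longlonglongrightarrow> 2 * cutoff_const * W x * (s x)\<^sup>2 * 0 ^ 4"
        by (intro tendsto_intros LIMSEQ_inverse_real_of_nat)
      then have l: "(\<lambda>k. 2 * cutoff_const * W x * (s x)\<^sup>2 * (inverse (r k)) ^ 4) \<longlonglongrightarrow> 0" by (simp add: r_def)
      have "(\<lambda>k. E k x) \<longlonglongrightarrow> 0"
      proof (rule tendsto_sandwich[OF _ _ tendsto_const l])
        show "\<forall>\<^sub>F k in sequentially. 0 \<le> E k x"
          unfolding E_eq using cutoff_const(1) W0[of x] r by (intro always_eventually allI mult_nonneg_nonneg) (auto simp: less_imp_le)
        show "\<forall>\<^sub>F k in sequentially. E k x \<le> 2 * cutoff_const * W x * (s x)\<^sup>2 * inverse (r k) ^ 4"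
          unfolding E_eq using cutoff_const(1) W0[of x] r
          by (intro always_eventually allI) (auto simp: indicator_def divide_inverse power_inverse mult.assoc intro!: mult_nonneg_nonneg less_imp_le)
      qed
      then show "(\<lambda>k. ennreal (E k x)) \<longlonglongrightarrow> 0" using tendsto_ennrealI by fastforce
    qed
  qed auto
  have "(\<integral>\<^sup>+x. ennreal ((1 + s x) powr (-5/2) * (3/2 * (norm (u x))\<^sup>2 + 2 * (1 + s x) * H x)) \<partial>lborel) \<le> 0"
  proof (rule Liminf_bound[where f="\<lambda>k x. ennreal (f k x)"])
    show "(\<lambda>x. ennreal (f k x)) \<in> borel_measurable borel" for k unfolding f_def by measurable
    show "AE x in lborel. (\<lambda>k. ennreal (f k x)) \<longlonglongrightarrow> ennreal ((1 + s x) powr (-5/2) * (3/2 * (norm (u x))\<^sup>2 + 2 * (1 + s x) * H x))"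
    proof (rule AE_I2)
      fix x :: "real^5"
      have "(\<lambda>k. f k x) \<longlonglongrightarrow> 1 * (1 + s x) powr (-5/2) * (3/2 * 1 * (norm (u x))\<^sup>2 + 2 * (1 + s x) * H x)"
        unfolding f_def r_def by (intro tendsto_mult cutoff_limit tendsto_const)
      then show "(\<lambda>k. ennreal (f k x)) \<longlonglongrightarrow> ennreal ((1 + s x) powr (-5/2) * (3/2 * (norm (u x))\<^sup>2 + 2 * (1 + s x) * H x))"
        by (intro tendsto_ennrealI) simp
    qed
    show "\<forall>\<^sub>F k in sequentially. (\<integral>\<^sup>+x. ennreal (f k x) \<partial>lborel) \<le> (\<integral>\<^sup>+x. ennreal (E k x) \<partial>lborel)"
      unfolding f_def E_def s_def by (intro always_eventually allI pressure_estimate r) simp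
    show "(\<lambda>k. \<integral>\<^sup>+x. ennreal (E k x) \<partial>lborel) \<longlonglongrightarrow> 0" using E_lim by simp
  qed
  then have "AE x in lborel. ennreal ((1 + s x) powr (-5/2) * (3/2 * (norm (u x))\<^sup>2 + 2 * (1 + s x) * H x)) = 0"
    by (subst (asm) le_zero_eq, subst (asm) nn_integral_0_iff_AE) auto
  then show ?thesis
  proof eventually_elim
    case (elim x)
    have "(1 + s x) powr (-5/2) > 0" by (smt (verit) powr_gt_zero s_def zero_le_power2)
    then have "3/2 * (norm (u x))\<^sup>2 + 2 * (1 + s x) * H x \<le> 0"
      using elim by (simp add: ennreal_eq_0_iff mult_le_0_iff)
    moreover have "0 \<le> (norm (u x))\<^sup>2" "0 \<le> s x * H x" using H_nonneg[of x] by (auto simp: s_def)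
    moreover have "2 * (1 + s x) * H x = 2 * H x + 2 * (s x * H x)" by (simp add: algebra_simps)
    ultimately have "(norm (u x))\<^sup>2 = 0" "H x = 0" using H_nonneg[of x] by linarith+
    then show ?case by (simp add: p_H)
  qed
qed

end

section \<open>The weighted local energy inequality\<close>

lemma partial_deriv_radial_second:
  fixes a :: "real^'n"
  assumes "\<And>t. t \<ge> 0 \<Longrightarrow> (F has_real_derivative F1 t) (at t)" "\<And>t. t \<ge> 0 \<Longrightarrow> (F1 has_real_derivative F2 t) (at t)"
  shows "partial_deriv i (\<lambda>x. F ((norm (x - a))\<^sup>2)) = (\<lambda>x. 2 * F1 ((norm (x - a))\<^sup>2) * (x$i - a$i))"
    and "partial_deriv i (partial_deriv i (\<lambda>x. F ((norm (x - a))\<^sup>2))) x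
      = 4 * F2 ((norm (x - a))\<^sup>2) * (x$i - a$i)\<^sup>2 + 2 * F1 ((norm (x - a))\<^sup>2)"
proof -
  show 1: "partial_deriv i (\<lambda>x. F ((norm (x - a))\<^sup>2)) = (\<lambda>x. 2 * F1 ((norm (x - a))\<^sup>2) * (x$i - a$i))"
    using assms(1) by (intro ext partial_deriv_radial) auto
  have h: "((\<lambda>x. F1 ((norm (x - a))\<^sup>2)) has_derivative (\<lambda>h. F2 ((norm (x - a))\<^sup>2) * (2 * ((x - a) \<bullet> h)))) (at x)"
    by (rule has_derivative_radial) (rule assms(2), simp)
  have hX: "((\<lambda>x. x $ i - a $ i) has_derivative (\<lambda>h. h $ i)) (at x)"
    by (auto intro!: derivative_eq_intros bounded_linear_imp_has_derivative bounded_linear_vec_nth)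
  have ax: "(x - a) \<bullet> axis i 1 = x $ i - a $ i" by (simp add: inner_axis)
  show "partial_deriv i (partial_deriv i (\<lambda>x. F ((norm (x - a))\<^sup>2))) x
      = 4 * F2 ((norm (x - a))\<^sup>2) * (x$i - a$i)\<^sup>2 + 2 * F1 ((norm (x - a))\<^sup>2)"
    unfolding 1
    by (subst partial_deriv_eq[OF has_derivative_mult[OF has_derivative_mult_right[OF h] hX]])
      (simp only: ax, simp add: power2_eq_square)
qed

lemma laplacian_radial:
  fixes a :: "real^5"
  assumes "\<And>t. t \<ge> 0 \<Longrightarrow> (F has_real_derivative F1 t) (at t)" "\<And>t. t \<ge> 0 \<Longrightarrow> (F1 has_real_derivative F2 t) (at t)"
  shows "laplacian (\<lambda>x. F ((norm (x - a))\<^sup>2)) x = 4 * (norm (x - a))\<^sup>2 * F2 ((norm (x - a))\<^sup>2) + 10 * F1 ((norm (x - a))\<^sup>2)"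
proof -
  have "(norm (x - a))\<^sup>2 = (\<Sum>i\<in>UNIV. (x$i - a$i)\<^sup>2)"
    unfolding power2_norm_eq_inner inner_vec_def by (simp add: power2_eq_square)
  moreover have "laplacian (\<lambda>x. F ((norm (x - a))\<^sup>2)) x
      = (\<Sum>i\<in>UNIV. 4 * F2 ((norm (x - a))\<^sup>2) * (x$i - a$i)\<^sup>2 + 2 * F1 ((norm (x - a))\<^sup>2))"
    unfolding laplacian_def by (intro sum.cong refl partial_deriv_radial_second(2) assms)
  moreover have "\<dots> = 4 * F2 ((norm (x - a))\<^sup>2) * (\<Sum>i\<in>UNIV. (x$i - a$i)\<^sup>2) + 10 * F1 ((norm (x - a))\<^sup>2)"
    by (simp add: sum.distrib sum_distrib_left)
  ultimately show ?thesis by (simp add: mult_ac)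
qed

lemma grad_radial:
  fixes a :: "real^'n"
  assumes "\<And>t. t \<ge> 0 \<Longrightarrow> (F has_real_derivative F1 t) (at t)"
  shows "grad (\<lambda>x. F ((norm (x - a))\<^sup>2)) x = (2 * F1 ((norm (x - a))\<^sup>2)) *\<^sub>R (x - a)"
  unfolding grad_def vec_eq_iff using assms by (auto simp: partial_deriv_radial)

text \<open>The energy is tested with \<open>wt s = (1 + s) powr (-1/2) * (c s)\<^sup>2\<close>, \<open>s = |x|\<^sup>2\<close>: without the cutoff its Laplacian is
  at most \<open>-2 (1 + s) powr (-3/2)\<close>, which is the sign that puts \<open>|u|\<^sup>2\<close> on the good side. \<open>rt\<close> is the
  square root of this weight.\<close>

locale radius =
  fixes R :: real
  assumes R: "R > 0"
begin

definition c :: "real \<Rightarrow> real" where "c t = cutoff (t / R\<^sup>2)"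
definition c1 :: "real \<Rightarrow> real" where "c1 t = cutoff1 (t / R\<^sup>2) / R\<^sup>2"
definition c2 :: "real \<Rightarrow> real" where "c2 t = cutoff2 (t / R\<^sup>2) / R\<^sup>2 / R\<^sup>2"

definition wt :: "real \<Rightarrow> real" where "wt t = (1 + t) powr (-1/2) * (c t * c t)"
definition wt1 :: "real \<Rightarrow> real" where
  "wt1 t = -1/2 * (1 + t) powr (-3/2) * (c t * c t) + (1 + t) powr (-1/2) * (2 * c t * c1 t)"
definition wt2 :: "real \<Rightarrow> real" where
  "wt2 t = 3/4 * (1 + t) powr (-5/2) * (c t * c t) - (1 + t) powr (-3/2) * (2 * c t * c1 t)
     + (1 + t) powr (-1/2) * (2 * c1 t * c1 t + 2 * c t * c2 t)"

definition rt :: "real \<Rightarrow> real" where "rt t = (1 + t) powr (-1/4) * c t"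
definition rt1 :: "real \<Rightarrow> real" where "rt1 t = -1/4 * (1 + t) powr (-5/4) * c t + (1 + t) powr (-1/4) * c1 t"

lemma c_deriv: "(c has_real_derivative c1 t) (at t)" "(c1 has_real_derivative c2 t) (at t)"
  unfolding c_def[abs_def] c1_def[abs_def] c2_def
  using DERIV_chain2[OF cutoff_deriv DERIV_cdivide[OF DERIV_ident, of "R\<^sup>2"], of t UNIV]
    DERIV_cdivide[OF DERIV_chain2[OF cutoff1_deriv DERIV_cdivide[OF DERIV_ident, of "R\<^sup>2"], of t UNIV], of "R\<^sup>2"]
  by simp_all

lemma wt_deriv:
  assumes "t \<ge> 0"
  shows "(wt has_real_derivative wt1 t) (at t)" "(wt1 has_real_derivative wt2 t) (at t)"
    "(rt has_real_derivative rt1 t) (at t)"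
  unfolding wt_def[abs_def] wt1_def[abs_def] wt2_def rt_def[abs_def] rt1_def using assms
  by (auto intro!: derivative_eq_intros c_deriv) (auto simp: algebra_simps add_divide_distrib diff_divide_distrib)

lemma c_range: "0 \<le> c t" "c t \<le> 1" by (auto simp: c_def cutoff_range)

lemma c_outside: "t \<ge> R\<^sup>2 \<Longrightarrow> c t = 0" "t \<ge> R\<^sup>2 \<Longrightarrow> c1 t = 0" "t \<ge> R\<^sup>2 \<Longrightarrow> c2 t = 0"
  using R by (auto simp: c_def c1_def c2_def cutoff_scaled_zero)

lemma c1_bound: "t \<ge> 0 \<Longrightarrow> \<bar>c1 t\<bar> \<le> cutoff_const * t / R ^ 4"
proof -
  assume t: "t \<ge> 0"
  have "\<bar>c1 t\<bar> \<le> cutoff_const * t / R ^ 4 * indicator {..<R\<^sup>2} t"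
    unfolding c1_def by (rule cutoff1_scaled_bound[OF t R])
  also have "\<dots> \<le> cutoff_const * t / R ^ 4 * 1"
    using t R cutoff_const(1) by (intro mult_left_mono) (auto simp: indicator_def)
  finally show ?thesis by simp
qed

lemma c2_bound: "\<bar>c2 t\<bar> \<le> cutoff_const / R ^ 4"
proof -
  have "\<bar>c2 t\<bar> = \<bar>cutoff2 (t / R\<^sup>2)\<bar> / R ^ 4" by (simp add: c2_def abs_mult flip: power_add)
  then show ?thesis using cutoff_const(3)[of "t / R\<^sup>2"] R by (simp add: divide_right_mono)
qed

lemma half_shift_le: "t \<ge> 0 \<Longrightarrow> (1 + t) powr (-1/2) * t \<le> sqrt t"
proof (cases "t = 0")
  case False
  assume t: "t \<ge> 0"
  have "(1 + t) powr (-1/2) * t \<le> t powr (-1/2) * t powr 1"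
    using t False by (auto intro!: mult_right_mono powr_mono2')
  also have "\<dots> = t powr (-1/2 + 1)" by (rule powr_add[symmetric])
  also have "\<dots> = sqrt t" using t by (simp add: powr_half_sqrt)
  finally show ?thesis .
qed simp

text \<open>Without the cutoff, w = (1+t)^{-1/2} satisfies 4 t w'' + 10 w' = -(5 + 2 t)
  (1+t)^{-5/2}, which is at most -2 (1+t)^{-3/2}. Every cutoff term is of order R^{-4} times
  (1+t)^{-1/2} t or (1+t)^{-3/2} t^2, both at most sqrt t <= R. The coefficients 8, 16 and 20 add up
  to 44 once C <= C^2.\<close>

lemma laplacian_weight_bound:
  assumes t: "t \<ge> 0"
  shows "4 * t * wt2 t + 10 * wt1 t \<le> - 2 * (1 + t) powr (-3/2) * (c t * c t) + 44 * cutoff_const\<^sup>2 / R ^ 3 * indicator {..<R\<^sup>2} t"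
proof (cases "t < R\<^sup>2")
  case True
  define C where "C = cutoff_const"
  have C: "C \<ge> 1" "C \<le> C\<^sup>2" using cutoff_const(1) by (auto simp: C_def power2_eq_square)
  define f g q where "f = (1 + t) powr (-1/2)" and "g = (1 + t) powr (-3/2)" and "q = (1 + t) powr (-5/2)"
  have g: "g = (1 + t) * q"
    using t powr_mult_base[of "1 + t" "-5/2"] by (simp add: q_def g_def)
  have pos: "f \<ge> 0" "g \<ge> 0" "q \<ge> 0" by (auto simp: f_def g_def q_def)
  define r where "r = sqrt t"
  have r: "0 \<le> r" "r \<le> R" using t True R real_le_lsqrt[of R t] by (auto simp: r_def)
  have ft: "f * t \<le> r" using half_shift_le[OF t] by (simp add: f_def r_def)
  have gt: "g * t\<^sup>2 \<le> r" using powr_shift_le[of 1 t] t by (simp add: g_def r_def)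
  have rR: "K * r / R ^ 4 \<le> K / R ^ 3" if "K \<ge> 0" for K
  proof -
    have "K * r / R ^ 4 \<le> K * R / R ^ 4" using that r R by (intro divide_right_mono mult_left_mono) auto
    also have "\<dots> = K / R ^ 3" using R by (simp add: eval_nat_numeral)
    finally show ?thesis .
  qed
  have b1: "\<bar>c t * c1 t\<bar> \<le> C * t / R ^ 4"
    using mult_mono[OF c_range(2) c1_bound[OF t], of t] c_range[of t] by (simp add: abs_mult C_def)
  have b2: "\<bar>2 * c1 t * c1 t + 2 * c t * c2 t\<bar> \<le> 4 * C\<^sup>2 / R ^ 4"
  proof -
    have "\<bar>c1 t\<bar> * \<bar>c1 t\<bar> \<le> (C * t / R ^ 4) * (C * t / R ^ 4)"
      unfolding C_def using c1_bound[OF t] by (intro mult_mono) (auto intro: order_trans[OF abs_ge_zero])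
    also have "\<dots> = C\<^sup>2 / R ^ 4 * (t / R\<^sup>2)\<^sup>2" by (simp add: power2_eq_square field_simps eval_nat_numeral)
    also have "\<dots> \<le> C\<^sup>2 / R ^ 4 * 1"
      using t True R by (intro mult_left_mono power_le_one) auto
    finally have 1: "\<bar>c1 t * c1 t\<bar> \<le> C\<^sup>2 / R ^ 4" by (simp add: abs_mult)
    have "\<bar>c t\<bar> * \<bar>c2 t\<bar> \<le> 1 * (C / R ^ 4)"
      unfolding C_def using c2_bound[of t] c_range[of t] by (intro mult_mono) auto
    also have "\<dots> \<le> C\<^sup>2 / R ^ 4" using C R by (simp add: divide_right_mono)
    finally have 2: "\<bar>c t * c2 t\<bar> \<le> C\<^sup>2 / R ^ 4" by (simp add: abs_mult)
    have "\<bar>2 * c1 t * c1 t + 2 * c t * c2 t\<bar> \<le> 2 * \<bar>c1 t * c1 t\<bar> + 2 * \<bar>c t * c2 t\<bar>"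
      by (rule order_trans[OF abs_triangle_ineq]) (simp add: abs_mult)
    then show ?thesis using 1 2 by linarith
  qed
  have main: "4 * t * wt2 t + 10 * wt1 t = - (5 + 2 * t) * q * (c t * c t)
      + (- 8 * (g * t) * (c t * c1 t) + 4 * (f * t) * (2 * c1 t * c1 t + 2 * c t * c2 t) + 20 * f * (c t * c1 t))"
    unfolding wt1_def wt2_def f_def[symmetric] g_def[symmetric] q_def[symmetric] unfolding g by (simp add: algebra_simps)
  have cc: "0 \<le> c t * c t" using c_range[of t] by simp
  have "- 8 * (g * t) * (c t * c1 t) \<le> 8 * (g * t) * (C * t / R ^ 4)"
    using mult_left_mono[OF b1, of "8 * (g * t)"] pos t abs_ge_minus_self[of "c t * c1 t"]
    by (smt (verit, ccfv_SIG) mult_left_mono mult_minus_left mult_minus_right mult_nonneg_nonneg)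
  also have "\<dots> = 8 * C * (g * t\<^sup>2) / R ^ 4" by (simp add: power2_eq_square)
  also have "\<dots> \<le> 8 * C * r / R ^ 4" using gt C R by (intro divide_right_mono mult_left_mono) auto
  also have "\<dots> \<le> 8 * C / R ^ 3" using C by (intro rR) auto
  finally have e1: "- 8 * (g * t) * (c t * c1 t) \<le> 8 * C / R ^ 3" .
  have "4 * (f * t) * (2 * c1 t * c1 t + 2 * c t * c2 t) \<le> 4 * (f * t) * (4 * C\<^sup>2 / R ^ 4)"
    using b2 pos t by (intro mult_left_mono) auto
  also have "\<dots> = 16 * C\<^sup>2 * (f * t) / R ^ 4" by simp
  also have "\<dots> \<le> 16 * C\<^sup>2 * r / R ^ 4" using ft R by (intro divide_right_mono mult_left_mono) auto
  also have "\<dots> \<le> 16 * C\<^sup>2 / R ^ 3" by (intro rR) auto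
  finally have e2: "4 * (f * t) * (2 * c1 t * c1 t + 2 * c t * c2 t) \<le> 16 * C\<^sup>2 / R ^ 3" .
  have "20 * f * (c t * c1 t) \<le> 20 * f * (C * t / R ^ 4)"
    using b1 pos by (intro mult_left_mono) auto
  also have "\<dots> = 20 * C * (f * t) / R ^ 4" by simp
  also have "\<dots> \<le> 20 * C * r / R ^ 4" using ft C R by (intro divide_right_mono mult_left_mono) auto
  also have "\<dots> \<le> 20 * C / R ^ 3" using C by (intro rR) auto
  finally have e3: "20 * f * (c t * c1 t) \<le> 20 * C / R ^ 3" .
  have "8 * C / R ^ 3 + 16 * C\<^sup>2 / R ^ 3 + 20 * C / R ^ 3 = (28 * C + 16 * C\<^sup>2) / R ^ 3" by (simp add: add_divide_distrib)
  also have "\<dots> \<le> 44 * C\<^sup>2 / R ^ 3" using C R by (intro divide_right_mono) auto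
  finally have e4: "8 * C / R ^ 3 + 16 * C\<^sup>2 / R ^ 3 + 20 * C / R ^ 3 \<le> 44 * C\<^sup>2 / R ^ 3" .
  have e5: "- (5 + 2 * t) * q * (c t * c t) \<le> - 2 * ((1 + t) * q) * (c t * c t)"
  proof -
    have "- 2 * ((1 + t) * q) * (c t * c t) - - (5 + 2 * t) * q * (c t * c t) = 3 * (q * (c t * c t))"
      by (simp add: algebra_simps)
    moreover have "0 \<le> q * (c t * c t)" using pos cc by simp
    ultimately show ?thesis by linarith
  qed
  show ?thesis using e1 e2 e3 e4 e5 True unfolding main g_def[symmetric] C_def[symmetric] by (simp add: g)
next
  case False
  then show ?thesis by (simp add: wt1_def wt2_def c_outside)
qed

text \<open>The left side is the length of the gradient of \<open>wt\<close> at |x|^2 = t. The first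
  term on the right is kept as the flux to be absorbed; the second, of order R^{-2} on the ball, is
  matched to the growth R^2 in \<open>head_flux_bound\<close>.\<close>

lemma gradient_weight_bound:
  assumes t: "t \<ge> 0"
  shows "2 * sqrt t * \<bar>wt1 t\<bar> \<le> (1 + t) powr (-1) * (c t * c t) + 4 * cutoff_const / R\<^sup>2 * indicator {..<R\<^sup>2} t"
proof (cases "t < R\<^sup>2")
  case True
  define C where "C = cutoff_const"
  have C: "C \<ge> 1" using cutoff_const(1) by (auto simp: C_def)
  define f g where "f = (1 + t) powr (-1/2)" and "g = (1 + t) powr (-3/2)"
  have pos: "f \<ge> 0" "g \<ge> 0" by (auto simp: f_def g_def)
  define r where "r = sqrt t"
  have r: "0 \<le> r" "r \<le> R" using t True R real_le_lsqrt[of R t] by (auto simp: r_def)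
  have ft: "f * t \<le> r" using half_shift_le[OF t] by (simp add: f_def r_def)
  have cc: "0 \<le> c t * c t" using c_range[of t] by simp
  have b1: "\<bar>c t * c1 t\<bar> \<le> C * t / R ^ 4"
    using mult_mono[OF c_range(2) c1_bound[OF t], of t] c_range[of t] by (simp add: abs_mult C_def)
  have rg: "r * g \<le> (1 + t) powr (-1)"
  proof -
    have "r * g \<le> (1 + t) powr (1/2) * g"
      using t pos by (intro mult_right_mono) (auto simp: r_def powr_half_sqrt)
    also have "\<dots> = (1 + t) powr (1/2 + -3/2)" unfolding g_def by (rule powr_add[symmetric])
    finally show ?thesis by simp
  qed
  have "\<bar>wt1 t\<bar> \<le> 1/2 * g * (c t * c t) + 2 * f * \<bar>c t * c1 t\<bar>"
    unfolding wt1_def f_def[symmetric] g_def[symmetric]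
    by (rule order_trans[OF abs_triangle_ineq]) (use pos cc in \<open>simp add: abs_mult\<close>)
  also have "\<dots> \<le> 1/2 * g * (c t * c t) + 2 * f * (C * t / R ^ 4)"
    using b1 pos by (intro add_left_mono mult_left_mono) auto
  finally have "2 * r * \<bar>wt1 t\<bar> \<le> 2 * r * (1/2 * g * (c t * c t) + 2 * f * (C * t / R ^ 4))"
    using r by (intro mult_left_mono) auto
  also have "\<dots> = (r * g) * (c t * c t) + 4 * C * (r * (f * t)) / R ^ 4" by (simp add: field_simps)
  also have "\<dots> \<le> (1 + t) powr (-1) * (c t * c t) + 4 * C * (R * R) / R ^ 4"
  proof (intro add_mono mult_right_mono rg cc divide_right_mono mult_left_mono)
    show "r * (f * t) \<le> R * R" using ft r pos t by (intro mult_mono) auto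
  qed (use C R in auto)
  also have "4 * C * (R * R) / R ^ 4 = 4 * C / R\<^sup>2" using R by (simp add: eval_nat_numeral)
  finally show ?thesis using True by (simp add: r_def C_def)
next
  case False
  then show ?thesis by (simp add: wt1_def c_outside)
qed

text \<open>The left side is the squared gradient of \<open>rt\<close> at |x|^2 = t. Its principal
  part is the weight of |u|^2 in the energy density, so localising u by \<open>rt\<close> costs no
  more than energy already at hand. The product rule terms are separated by (b - a)^2 <= 2 a^2 + 2
  b^2.\<close>

lemma root_weight_bound:
  assumes t: "t \<ge> 0"
  shows "4 * t * (rt1 t)\<^sup>2 \<le> (1 + t) powr (-3/2) * (c t * c t) + 8 * cutoff_const\<^sup>2 / R ^ 3 * indicator {..<R\<^sup>2} t"
proof (cases "t < R\<^sup>2")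
  case True
  define C where "C = cutoff_const"
  define f g q where "f = (1 + t) powr (-1/2)" and "g = (1 + t) powr (-3/2)" and "q = (1 + t) powr (-5/2)"
  have g: "g = (1 + t) * q"
    using t powr_mult_base[of "1 + t" "-5/2"] by (simp add: q_def g_def)
  have pos: "f \<ge> 0" "g \<ge> 0" "q \<ge> 0" by (auto simp: f_def g_def q_def)
  define r where "r = sqrt t"
  have r: "0 \<le> r" "r \<le> R" using t True R real_le_lsqrt[of R t] by (auto simp: r_def)
  have ft: "f * t \<le> r" using half_shift_le[OF t] by (simp add: f_def r_def)
  have cc: "0 \<le> c t * c t" using c_range[of t] by simp
  define a b where "a = 1/4 * (1 + t) powr (-5/4) * c t" and "b = (1 + t) powr (-1/4) * c1 t"
  have a2: "a\<^sup>2 = 1/16 * q * (c t * c t)"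
    by (simp add: a_def q_def power_mult_distrib power2_eq_square flip: powr_add)
  have b2: "b\<^sup>2 = f * (c1 t)\<^sup>2"
    by (simp add: b_def f_def power_mult_distrib power2_eq_square flip: powr_add)
  have "(rt1 t)\<^sup>2 \<le> 2 * a\<^sup>2 + 2 * b\<^sup>2"
  proof -
    have eq: "rt1 t = b - a" by (simp add: rt1_def a_def b_def)
    have "(b - a)\<^sup>2 + (a + b)\<^sup>2 = 2 * a\<^sup>2 + 2 * b\<^sup>2" by (simp add: power2_eq_square algebra_simps)
    moreover have "0 \<le> (a + b)\<^sup>2" by simp
    ultimately show ?thesis unfolding eq by linarith
  qed
  then have "4 * t * (rt1 t)\<^sup>2 \<le> 4 * t * (2 * a\<^sup>2 + 2 * b\<^sup>2)" using t by (intro mult_left_mono) auto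
  also have "\<dots> = 1/2 * (t * q) * (c t * c t) + 8 * (f * t) * (c1 t)\<^sup>2" by (simp add: a2 b2 algebra_simps)
  also have "\<dots> \<le> g * (c t * c t) + 8 * C\<^sup>2 / R ^ 3"
  proof (rule add_mono)
    show "1/2 * (t * q) * (c t * c t) \<le> g * (c t * c t)"
      using t pos by (intro mult_right_mono cc) (auto simp: g algebra_simps)
    have "(c1 t)\<^sup>2 \<le> (C * t / R ^ 4)\<^sup>2"
      using c1_bound[OF t] unfolding C_def by (rule power2_le_iff_abs_le[THEN iffD2, rotated]) (use t cutoff_const(1) in auto)
    also have "\<dots> = C\<^sup>2 / R ^ 4 * (t / R\<^sup>2)\<^sup>2" by (simp add: power2_eq_square field_simps eval_nat_numeral)
    also have "\<dots> \<le> C\<^sup>2 / R ^ 4 * 1"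
      using t True R by (intro mult_left_mono power_le_one) auto
    finally have "8 * (f * t) * (c1 t)\<^sup>2 \<le> 8 * R * (C\<^sup>2 / R ^ 4)"
      using ft r pos t by (intro mult_mono) auto
    also have "\<dots> = 8 * C\<^sup>2 / R ^ 3" using R by (simp add: eval_nat_numeral)
    finally show "8 * (f * t) * (c1 t)\<^sup>2 \<le> 8 * C\<^sup>2 / R ^ 3" .
  qed
  finally show ?thesis using True by (simp add: g_def C_def)
next
  case False
  then show ?thesis by (simp add: rt1_def c_outside)
qed

lemma rt_square: "rt t * rt t = wt t"
  by (simp add: rt_def wt_def mult_ac flip: powr_add mult.assoc)

lemma smooth_weights:
  "smooth (\<lambda>x::real^'n. wt ((norm (x - a))\<^sup>2))" "smooth (\<lambda>x::real^'n. rt ((norm (x - a))\<^sup>2))"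
proof -
  have sms: "smooth (\<lambda>x::real^'n. (norm (x - a))\<^sup>2)" by (rule smooth_norm_sq)
  have smc: "smooth (\<lambda>x::real^'n. c ((norm (x - a))\<^sup>2))"
    unfolding c_def using smooth_cutoff(1)[OF smooth_mult[OF sms smooth_const[of "1 / R\<^sup>2"]]] by simp
  have smp: "smooth (\<lambda>x::real^'n. (1 + (norm (x - a))\<^sup>2) powr q)" for q
    by (rule smooth_powr[OF smooth_add[OF smooth_const sms]]) (simp add: add_pos_nonneg)
  show "smooth (\<lambda>x::real^'n. wt ((norm (x - a))\<^sup>2))" "smooth (\<lambda>x::real^'n. rt ((norm (x - a))\<^sup>2))"
    unfolding wt_def rt_def by (intro smooth_mult smp smc)+
qed

lemma weight_test_functions:
  "(\<lambda>x::real^'n. wt ((norm (x - a))\<^sup>2)) \<in> test_functions UNIV" "(\<lambda>x::real^'n. rt ((norm (x - a))\<^sup>2)) \<in> test_functions UNIV"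
proof -
  have "c ((norm (x - a))\<^sup>2) = 0" if "norm (x - a) > R" for x :: "real^'n"
    using that R by (intro c_outside power_mono) auto
  then show "(\<lambda>x::real^'n. wt ((norm (x - a))\<^sup>2)) \<in> test_functions UNIV" "(\<lambda>x::real^'n. rt ((norm (x - a))\<^sup>2)) \<in> test_functions UNIV"
    by (intro smooth_test_function[OF smooth_weights(1), where a=a and R=R] smooth_test_function[OF smooth_weights(2), where a=a and R=R];
      simp add: wt_def rt_def)+
qed

lemma weights_measurable [measurable]:
  "c \<in> borel_measurable borel" "c1 \<in> borel_measurable borel" "rt1 \<in> borel_measurable borel" "rt \<in> borel_measurable borel" "wt \<in> borel_measurable borel"
proof -
  show "c \<in> borel_measurable borel" "c1 \<in> borel_measurable borel"
    unfolding c_def[abs_def] c1_def[abs_def] by measurable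
  then show "rt1 \<in> borel_measurable borel" "rt \<in> borel_measurable borel" "wt \<in> borel_measurable borel"
    unfolding rt1_def[abs_def] rt_def[abs_def] wt_def[abs_def] by measurable
qed

end

section \<open>Absorbing the flux at a fixed cutoff radius\<close>

locale cutoff_solution = nonpositive_head + radius
begin

definition sq :: "real^5 \<Rightarrow> real" where "sq x = (norm x)\<^sup>2"

lemma sq_nonneg: "sq x \<ge> 0" by (simp add: sq_def)

lemma sq_measurable [measurable]: "sq \<in> borel_measurable borel"
  unfolding sq_def[abs_def] by measurable

lemma ball_sq: "x \<in> ball 0 R \<longleftrightarrow> sq x < R\<^sup>2"
  using mem_ball_square_iff[OF R, of x 0] by (simp add: sq_def)

lemma ind_sq: "indicator {..<R\<^sup>2} (sq x) = (indicator (ball 0 R) x :: real)"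
  using ball_sq[of x] by (simp add: indicator_def)

lemma wt_test: "(\<lambda>x. wt (sq x)) \<in> test_functions UNIV" and rt_test: "(\<lambda>x. rt (sq x)) \<in> test_functions UNIV"
  using weight_test_functions[where a="0::real^5"] by (simp_all add: sq_def)

lemma wt_nonneg: "wt t \<ge> 0" and rt_nonneg: "rt t \<ge> 0"
  using c_range[of t] by (auto simp: wt_def rt_def)

definition flux :: ennreal where
  "flux = (\<integral>\<^sup>+x. ennreal (H x * norm (u x) * ((1 + sq x) powr (-1) * (c (sq x) * c (sq x)))) \<partial>lborel)"

definition energy_density :: "real^5 \<Rightarrow> real" where
  "energy_density x = (norm (D x))\<^sup>2 * wt (sq x) + (norm (u x))\<^sup>2 * ((1 + sq x) powr (-3/2) * (c (sq x) * c (sq x)))"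

lemma energy_density_measurable [measurable]: "energy_density \<in> borel_measurable borel"
  unfolding energy_density_def by measurable

lemma energy_density_nonneg: "energy_density x \<ge> 0"
  using c_range[of "sq x"] wt_nonneg[of "sq x"] by (simp add: energy_density_def)

definition energy_error :: real where "energy_error = 44 * cutoff_const\<^sup>2 * (ball_vol + M) + 12 * cutoff_const * M"

text \<open>The factor 1/2 in the energy inequality turns the -2 of
  \<open>laplacian_weight_bound\<close> into coefficient 1 for |u|^2 on the left. The cutoff errors
  pair R^{-3} with \<open>square_p_bound\<close> and R^{-2} with \<open>head_flux_bound\<close>, so
  that \<open>energy_error\<close> does not depend on R.\<close>

lemma energy_estimate: "(\<integral>\<^sup>+x. ennreal (energy_density x) \<partial>lborel) \<le> flux + ennreal energy_error"
proof -
  define C where "C = cutoff_const"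
  have C: "C \<ge> 1" using cutoff_const(1) by (simp add: C_def)
  define \<phi> where "\<phi> x = wt (sq x)" for x
  have test: "\<phi> \<in> test_functions UNIV" unfolding \<phi>_def[abs_def] by (rule wt_test)
  have lap: "laplacian \<phi> x = 4 * sq x * wt2 (sq x) + 10 * wt1 (sq x)" for x
    using laplacian_radial[OF wt_deriv(1,2), of 0 x] by (simp add: \<phi>_def[abs_def] sq_def)
  have gr: "grad \<phi> x = (2 * wt1 (sq x)) *\<^sub>R x" for x
    using grad_radial[OF wt_deriv(1), of "0::real^5" x] by (simp add: \<phi>_def[abs_def] sq_def)
  have int_D: "integrable lborel (\<lambda>x. (norm (D x))\<^sup>2 * \<phi> x)"
    by (rule integrable_mult_test_function[OF D_local test])
  have int_lap: "integrable lborel (\<lambda>x. (norm (u x))\<^sup>2 / 2 * laplacian \<phi> x)"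
  proof -
    have "integrable lborel (\<lambda>x. \<Sum>i\<in>UNIV. (norm (u x))\<^sup>2 * partial_deriv i (partial_deriv i \<phi>) x)"
      by (intro Bochner_Integration.integrable_sum integrable_mult_test_function locally_integrable_fields
          partial_deriv_test_functions test)
    then have "integrable lborel (\<lambda>x. 1/2 * (\<Sum>i\<in>UNIV. (norm (u x))\<^sup>2 * partial_deriv i (partial_deriv i \<phi>) x))"
      by (rule integrable_mult_right)
    then show ?thesis by (simp add: laplacian_def sum_distrib_left)
  qed
  have int_gr: "integrable lborel (\<lambda>x. H x * (u x \<bullet> grad \<phi> x))"
  proof -
    have "locally_integrable (\<lambda>x. H x * u x $ i)" for i
    proof (rule locally_integrable_bound[OF locally_integrable_fields(7)])
      show "\<bar>H x * u x $ i\<bar> \<le> H x * norm (u x)" for x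
        unfolding abs_mult using H_nonneg[of x] component_le_norm_cart[of "u x" i] by (intro mult_mono) auto
    qed measurable
    then have "integrable lborel (\<lambda>x. \<Sum>i\<in>UNIV. (H x * u x $ i) * partial_deriv i \<phi> x)"
      by (intro Bochner_Integration.integrable_sum integrable_mult_test_function partial_deriv_test_functions test)
    then show ?thesis by (simp add: grad_def inner_vec_def sum_distrib_left mult.assoc)
  qed
  define F where "F x = (norm (D x))\<^sup>2 * \<phi> x - (norm (u x))\<^sup>2 / 2 * laplacian \<phi> x + H x * (u x \<bullet> grad \<phi> x)" for x
  have F: "integrable lborel F" unfolding F_def using int_D int_lap int_gr by simp
  have "(\<integral>x. (norm (D x))\<^sup>2 * \<phi> x \<partial>lborel) \<le> (\<integral>x. (norm (u x))\<^sup>2 / 2 * laplacian \<phi> x \<partial>lborel)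
          + (\<integral>x. ((norm (u x))\<^sup>2 / 2 + p x) * (u x \<bullet> grad \<phi> x) \<partial>lborel)"
    by (rule energy[OF test]) (simp add: \<phi>_def wt_nonneg)
  also have "(\<integral>x. ((norm (u x))\<^sup>2 / 2 + p x) * (u x \<bullet> grad \<phi> x) \<partial>lborel) = - (\<integral>x. H x * (u x \<bullet> grad \<phi> x) \<partial>lborel)"
    by (simp add: p_H)
  finally have F0: "(\<integral>x. F x \<partial>lborel) \<le> 0"
    unfolding F_def using int_D int_lap int_gr by simp
  define E where "E x = H x * norm (u x) * ((1 + sq x) powr (-1) * (c (sq x) * c (sq x)))
     + (22 * C\<^sup>2 / R ^ 3 * ((norm (u x))\<^sup>2 * indicator (ball 0 R) x) + 4 * C / R\<^sup>2 * (H x * norm (u x) * indicator (ball 0 R) x))" for x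
  have "(\<integral>\<^sup>+x. ennreal (energy_density x) \<partial>lborel) \<le> (\<integral>\<^sup>+x. ennreal (E x) \<partial>lborel)"
  proof (rule nn_integral_le_of_identity[OF F F0])
    show "energy_density \<in> borel_measurable lborel" "E \<in> borel_measurable lborel" unfolding E_def by measurable
    show "energy_density x \<ge> 0" for x by (rule energy_density_nonneg)
    show "E x \<ge> 0" for x unfolding E_def
      using H_nonneg[of x] C R c_range[of "sq x"] by (intro add_nonneg_nonneg mult_nonneg_nonneg divide_nonneg_nonneg) auto
    show "energy_density x \<le> E x + F x" for x
    proof -
      define n where "n = (norm (u x))\<^sup>2"
      define I :: real where "I = indicator (ball 0 R) x"
      have "n / 2 * laplacian \<phi> x \<le> n / 2 * (- 2 * (1 + sq x) powr (-3/2) * (c (sq x) * c (sq x)) + 44 * C\<^sup>2 / R ^ 3 * I)"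
        using laplacian_weight_bound[OF sq_nonneg[of x]] unfolding lap ind_sq C_def I_def by (intro mult_left_mono) (auto simp: n_def)
      also have "\<dots> = - (n * ((1 + sq x) powr (-3/2) * (c (sq x) * c (sq x)))) + 22 * C\<^sup>2 / R ^ 3 * (n * I)"
        by (simp add: algebra_simps)
      finally have l: "n / 2 * laplacian \<phi> x \<le> \<dots>" .
      have "- (u x \<bullet> grad \<phi> x) \<le> norm (u x) * norm (grad \<phi> x)"
        using Cauchy_Schwarz_ineq2[of "u x" "grad \<phi> x"] by linarith
      also have "norm (grad \<phi> x) = 2 * sqrt (sq x) * \<bar>wt1 (sq x)\<bar>"
        unfolding gr by (simp add: sq_def abs_mult)
      also have "norm (u x) * \<dots> \<le> norm (u x) * ((1 + sq x) powr (-1) * (c (sq x) * c (sq x)) + 4 * C / R\<^sup>2 * I)"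
        using gradient_weight_bound[OF sq_nonneg[of x]] unfolding ind_sq C_def I_def by (intro mult_left_mono) auto
      finally have "H x * - (u x \<bullet> grad \<phi> x) \<le> H x * (norm (u x) * ((1 + sq x) powr (-1) * (c (sq x) * c (sq x)) + 4 * C / R\<^sup>2 * I))"
        by (intro mult_left_mono H_nonneg)
      also have "\<dots> = H x * norm (u x) * ((1 + sq x) powr (-1) * (c (sq x) * c (sq x))) + 4 * C / R\<^sup>2 * (H x * norm (u x) * I)"
        by (simp add: algebra_simps)
      finally have majorant: "- (H x * (u x \<bullet> grad \<phi> x)) \<le> \<dots>" by simp
      show ?thesis
        unfolding energy_density_def E_def F_def n_def[symmetric] I_def[symmetric] \<phi>_def[symmetric] using l majorant by linarith
    qed
  qed
  also have "\<dots> = (\<integral>\<^sup>+x. ennreal (H x * norm (u x) * ((1 + sq x) powr (-1) * (c (sq x) * c (sq x))))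
     + (ennreal (22 * C\<^sup>2 / R ^ 3) * (ennreal ((norm (u x))\<^sup>2) * indicator (ball 0 R) x)
      + ennreal (4 * C / R\<^sup>2) * (ennreal (H x * norm (u x)) * indicator (ball 0 R) x)) \<partial>lborel)"
  proof (intro nn_integral_cong)
    fix x
    have nn: "0 \<le> 22 * C\<^sup>2 / R ^ 3" "0 \<le> 4 * C / R\<^sup>2" "0 \<le> H x * norm (u x)"
      "0 \<le> H x * norm (u x) * ((1 + sq x) powr (-1) * (c (sq x) * c (sq x)))"
      using C R H_nonneg[of x] c_range[of "sq x"] by auto
    have three: "ennreal (x + (y + z)) = ennreal x + (ennreal y + ennreal z)" if "x \<ge> 0" "y \<ge> 0" "z \<ge> 0" for x y z
      using that by simp
    show "ennreal (E x) = ennreal (H x * norm (u x) * ((1 + sq x) powr (-1) * (c (sq x) * c (sq x))))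
     + (ennreal (22 * C\<^sup>2 / R ^ 3) * (ennreal ((norm (u x))\<^sup>2) * indicator (ball 0 R) x)
      + ennreal (4 * C / R\<^sup>2) * (ennreal (H x * norm (u x)) * indicator (ball 0 R) x))"
      unfolding E_def ennreal_mult_indicator[OF nn(1) zero_le_power2, symmetric] ennreal_mult_indicator[OF nn(2,3), symmetric]
      by (rule three; intro mult_nonneg_nonneg nn indicator_pos_le zero_le_power2)
  qed
  also have "\<dots> = flux + (ennreal (22 * C\<^sup>2 / R ^ 3) * (\<integral>\<^sup>+x. ennreal ((norm (u x))\<^sup>2) * indicator (ball 0 R) x \<partial>lborel)
      + ennreal (4 * C / R\<^sup>2) * (\<integral>\<^sup>+x. ennreal (H x * norm (u x)) * indicator (ball 0 R) x \<partial>lborel))"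
    unfolding flux_def by (simp add: nn_integral_add nn_integral_cmult)
  also have "\<dots> \<le> flux + (ennreal (22 * C\<^sup>2 / R ^ 3) * ennreal (2 * (ball_vol + M) * R ^ 3) + ennreal (4 * C / R\<^sup>2) * ennreal (3 * M * R\<^sup>2))"
  proof (intro add_mono mult_left_mono head_flux_bound R order_refl)
    show "(\<integral>\<^sup>+x. ennreal ((norm (u x))\<^sup>2) * indicator (ball 0 R) x \<partial>lborel) \<le> ennreal (2 * (ball_vol + M) * R ^ 3)"
      by (rule order_trans[OF nn_integral_mono square_p_bound[OF R]]) (auto intro!: mult_right_mono ennreal_leI)
  qed auto
  also have "\<dots> = flux + (ennreal (22 * C\<^sup>2 / R ^ 3 * (2 * (ball_vol + M) * R ^ 3)) + ennreal (4 * C / R\<^sup>2 * (3 * M * R\<^sup>2)))"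
    using C R M by (simp add: ennreal_mult del: times_divide_eq_left times_divide_eq_right)
  also have "22 * C\<^sup>2 / R ^ 3 * (2 * (ball_vol + M) * R ^ 3) = 44 * C\<^sup>2 * (ball_vol + M)" using R by simp
  also have "4 * C / R\<^sup>2 * (3 * M * R\<^sup>2) = 12 * C * M" using R by simp
  also have "ennreal (44 * C\<^sup>2 * (ball_vol + M)) + ennreal (12 * C * M) = ennreal energy_error"
    unfolding energy_error_def C_def[symmetric] using C M by (intro ennreal_plus[symmetric]) auto
  finally show ?thesis .
qed

text \<open>A qualitative bound that may depend on R. It is what allows a fraction of the energy to
  be subtracted in \<open>uniform_energy_bound\<close>.\<close>

lemma energy_density_finite: "(\<integral>\<^sup>+x. ennreal (energy_density x) \<partial>lborel) < \<infinity>"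
proof -
  have "integrable lborel (\<lambda>x. (norm (u x))\<^sup>2 * ((1 + sq x) powr (-3/2) * (c (sq x) * c (sq x))))"
  proof (rule integrable_mult_bounded_support[OF locally_integrable_fields(4), where B=1 and R=R])
    show "\<bar>(1 + sq x) powr (-3/2) * (c (sq x) * c (sq x))\<bar> \<le> 1" for x
    proof -
      have "(1 + sq x) powr (-3/2) \<le> (1 + sq x) powr 0" using sq_nonneg[of x] by (intro powr_mono) auto
      then have "(1 + sq x) powr (-3/2) \<le> 1" using sq_nonneg[of x] by simp
      moreover have "c (sq x) * c (sq x) \<le> 1 * 1" using c_range[of "sq x"] by (intro mult_mono) auto
      ultimately have "(1 + sq x) powr (-3/2) * (c (sq x) * c (sq x)) \<le> 1 * 1"
        using c_range[of "sq x"] by (intro mult_mono) auto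
      then show ?thesis using c_range[of "sq x"] by (simp add: abs_mult)
    qed
    show "(1 + sq x) powr (-3/2) * (c (sq x) * c (sq x)) = 0" if "norm x \<ge> R" for x
    proof -
      have "R\<^sup>2 \<le> sq x" unfolding sq_def using that R by (intro power_mono) auto
      then show ?thesis by (simp add: c_outside)
    qed
  qed measurable
  then have "integrable lborel energy_density"
    unfolding energy_density_def[abs_def] by (intro Bochner_Integration.integrable_add integrable_mult_test_function[OF D_local wt_test])
  then show ?thesis using nn_integral_eq_integral[of lborel energy_density] energy_density_nonneg by simp
qed

text \<open>The product rule bound for the gradient of the field rt(|x|^2) u, where the gradient of
  rt(|x|^2) has length 2 |x| |rt1|.\<close>

definition majorant :: "real^5 \<Rightarrow> real" where
  "majorant x = rt (sq x) * norm (D x) + norm (u x) * (2 * norm x * \<bar>rt1 (sq x)\<bar>)"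

lemma majorant_nonneg: "majorant x \<ge> 0" using rt_nonneg by (simp add: majorant_def)
lemma majorant_measurable [measurable]: "majorant \<in> borel_measurable borel" unfolding majorant_def by measurable

lemma majorant_sq: "(majorant x)\<^sup>2 \<le> 2 * energy_density x + 16 * cutoff_const\<^sup>2 / R ^ 3 * ((norm (u x))\<^sup>2 * indicator (ball 0 R) x)"
proof -
  define n where "n = (norm (u x))\<^sup>2"
  define a b where "a = rt (sq x) * norm (D x)" and "b = norm (u x) * (2 * norm x * \<bar>rt1 (sq x)\<bar>)"
  have "(a + b)\<^sup>2 + (a - b)\<^sup>2 = 2 * a\<^sup>2 + 2 * b\<^sup>2" by (simp add: power2_eq_square algebra_simps)
  moreover have "0 \<le> (a - b)\<^sup>2" by simp
  ultimately have "(a + b)\<^sup>2 \<le> 2 * a\<^sup>2 + 2 * b\<^sup>2" by linarith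
  moreover have "a\<^sup>2 = (norm (D x))\<^sup>2 * wt (sq x)"
    unfolding rt_square[symmetric] by (simp add: a_def power2_eq_square)
  moreover have "b\<^sup>2 = n * (4 * sq x * (rt1 (sq x))\<^sup>2)"
    by (simp add: b_def n_def sq_def power_mult_distrib)
  moreover have "n * (4 * sq x * (rt1 (sq x))\<^sup>2)
      \<le> n * ((1 + sq x) powr (-3/2) * (c (sq x) * c (sq x)) + 8 * cutoff_const\<^sup>2 / R ^ 3 * indicator (ball 0 R) x)"
    using root_weight_bound[OF sq_nonneg[of x]] unfolding ind_sq by (intro mult_left_mono) (auto simp: n_def)
  ultimately have "(a + b)\<^sup>2 \<le> 2 * ((norm (D x))\<^sup>2 * wt (sq x)) + 2 * (n * ((1 + sq x) powr (-3/2) * (c (sq x) * c (sq x)) + 8 * cutoff_const\<^sup>2 / R ^ 3 * indicator (ball 0 R) x))"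
    by linarith
  then show ?thesis unfolding majorant_def energy_density_def a_def[symmetric] b_def[symmetric] n_def[symmetric] by (simp add: algebra_simps)
qed

lemma majorant_energy: "(\<integral>\<^sup>+x. (ennreal (majorant x))\<^sup>2 \<partial>lborel) \<le> 2 * (\<integral>\<^sup>+x. ennreal (energy_density x) \<partial>lborel) + ennreal (32 * cutoff_const\<^sup>2 * (ball_vol + M))"
proof -
  have k: "0 \<le> 16 * cutoff_const\<^sup>2 / R ^ 3" using R by simp
  have "(\<integral>\<^sup>+x. (ennreal (majorant x))\<^sup>2 \<partial>lborel) \<le> (\<integral>\<^sup>+x. 2 * ennreal (energy_density x) + ennreal (16 * cutoff_const\<^sup>2 / R ^ 3) * (ennreal ((norm (u x))\<^sup>2) * indicator (ball 0 R) x) \<partial>lborel)"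
  proof (rule nn_integral_mono)
    fix x
    have "(ennreal (majorant x))\<^sup>2 = ennreal ((majorant x)\<^sup>2)" using majorant_nonneg by (simp add: ennreal_power)
    also have "\<dots> \<le> ennreal (2 * energy_density x + 16 * cutoff_const\<^sup>2 / R ^ 3 * ((norm (u x))\<^sup>2 * indicator (ball 0 R) x))"
      by (intro ennreal_leI majorant_sq)
    also have "\<dots> = ennreal (2 * energy_density x) + ennreal (16 * cutoff_const\<^sup>2 / R ^ 3 * ((norm (u x))\<^sup>2 * indicator (ball 0 R) x))"
      using k energy_density_nonneg[of x] by (intro ennreal_plus mult_nonneg_nonneg) auto
    also have "ennreal (2 * energy_density x) = 2 * ennreal (energy_density x)" using energy_density_nonneg[of x] by (subst ennreal_mult) auto
    also note ennreal_mult_indicator[OF k zero_le_power2]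
    finally show "(ennreal (majorant x))\<^sup>2 \<le> 2 * ennreal (energy_density x) + ennreal (16 * cutoff_const\<^sup>2 / R ^ 3) * (ennreal ((norm (u x))\<^sup>2) * indicator (ball 0 R) x)" .
  qed
  also have "\<dots> = 2 * (\<integral>\<^sup>+x. ennreal (energy_density x) \<partial>lborel) + ennreal (16 * cutoff_const\<^sup>2 / R ^ 3) * (\<integral>\<^sup>+x. ennreal ((norm (u x))\<^sup>2) * indicator (ball 0 R) x \<partial>lborel)"
    by (simp add: nn_integral_add nn_integral_cmult)
  also have "\<dots> \<le> 2 * (\<integral>\<^sup>+x. ennreal (energy_density x) \<partial>lborel) + ennreal (16 * cutoff_const\<^sup>2 / R ^ 3) * ennreal (2 * (ball_vol + M) * R ^ 3)"
  proof (intro add_mono mult_left_mono order_refl)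
    show "(\<integral>\<^sup>+x. ennreal ((norm (u x))\<^sup>2) * indicator (ball 0 R) x \<partial>lborel) \<le> ennreal (2 * (ball_vol + M) * R ^ 3)"
      by (rule order_trans[OF nn_integral_mono square_p_bound[OF R]]) (auto intro!: mult_right_mono ennreal_leI)
  qed auto
  also have "ennreal (16 * cutoff_const\<^sup>2 / R ^ 3) * ennreal (2 * (ball_vol + M) * R ^ 3) = ennreal (16 * cutoff_const\<^sup>2 / R ^ 3 * (2 * (ball_vol + M) * R ^ 3))"
    using k R M by (intro ennreal_mult[symmetric]) auto
  also have "16 * cutoff_const\<^sup>2 / R ^ 3 * (2 * (ball_vol + M) * R ^ 3) = 32 * cutoff_const\<^sup>2 * (ball_vol + M)" using R by simp
  finally show ?thesis .
qed

text \<open>Square integrability together with support in a ball gives integrability, by m <= 1 +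
  m^2 on the ball. This is the finite mass that \<open>abs_le_riesz\<close> asks of the density of
  the potential.\<close>

lemma majorant_finite: "(\<integral>\<^sup>+x. ennreal (majorant x) \<partial>lborel) < \<infinity>"
proof -
  have out: "sq x \<ge> R\<^sup>2" if "norm x \<ge> R" for x unfolding sq_def using that R by (intro power_mono) auto
  have "\<bar>majorant x\<bar> \<le> indicator (ball 0 R) x + (majorant x)\<^sup>2" for x
  proof (cases "x \<in> ball 0 R")
    case True
    have "0 \<le> (majorant x - 1)\<^sup>2 + majorant x" using majorant_nonneg[of x] by simp
    then have "majorant x \<le> 1 + (majorant x)\<^sup>2" using majorant_nonneg[of x] by (simp add: power2_eq_square algebra_simps)
    then show ?thesis using True majorant_nonneg[of x] by simp
  next
    case False
    then have "majorant x = 0" using out[of x] by (simp add: majorant_def rt_def rt1_def c_outside)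
    then show ?thesis by simp
  qed
  then have le: "majorant x \<le> indicator (ball 0 R) x + (majorant x)\<^sup>2" for x using abs_ge_self order_trans by blast
  have "ennreal (majorant x) \<le> indicator (ball 0 R) x + (ennreal (majorant x))\<^sup>2" for x
  proof -
    have "ennreal (majorant x) \<le> ennreal (indicator (ball 0 R) x + (majorant x)\<^sup>2)" by (rule ennreal_leI[OF le])
    also have "\<dots> = ennreal (indicator (ball 0 R) x) + ennreal ((majorant x)\<^sup>2)" by (rule ennreal_plus) auto
    finally show ?thesis using majorant_nonneg[of x] by (simp add: ennreal_indicator ennreal_power)
  qed
  then have "(\<integral>\<^sup>+x. ennreal (majorant x) \<partial>lborel) \<le> (\<integral>\<^sup>+x. indicator (ball 0 R) x + (ennreal (majorant x))\<^sup>2 \<partial>lborel)"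
    by (intro nn_integral_mono) auto
  also have "\<dots> = emeasure lborel (ball (0::real^5) R) + (\<integral>\<^sup>+x. (ennreal (majorant x))\<^sup>2 \<partial>lborel)"
    by (subst nn_integral_add) auto
  also have "\<dots> < \<infinity>"
    using order.strict_trans1[OF majorant_energy] energy_density_finite emeasure_lborel_ball_finite[of "0::real^5" R] by (simp add: ennreal_mult_less_top)
  finally show ?thesis .
qed

text \<open>Test the weak gradient with \<open>rt\<close> times \<open>(x-y) / (e\<^sup>2 + |x-y|\<^sup>2)\<^bsup>5/2\<^esup>\<close>, whose divergence is five times
  the regularised kernel.\<close>

lemma regularised_representation:
  assumes e: "e > 0"
  shows "ennreal \<bar>\<integral>x. (u x $ j * rt (sq x)) * regular_kernel e (x - y) \<partial>lborel\<bar> \<le> riesz (\<lambda>x. ennreal (majorant x)) y"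
proof -
  define \<kappa> \<kappa>1 where "\<kappa> t = (e\<^sup>2 + t) powr (-5/2)" and "\<kappa>1 t = -5/2 * (e\<^sup>2 + t) powr (-7/2)" for t
  define \<sigma> where "\<sigma> x = (norm (x - y))\<^sup>2" for x
  have e2: "e\<^sup>2 > 0" using e by simp
  have \<sigma>: "\<sigma> x \<ge> 0" for x by (simp add: \<sigma>_def)
  have d\<kappa>: "(\<kappa> has_real_derivative \<kappa>1 t) (at t)" if "t \<ge> 0" for t
    unfolding \<kappa>_def[abs_def] \<kappa>1_def using add_pos_nonneg[OF e2 that] by (auto intro!: derivative_eq_intros)
  have sm\<sigma>: "smooth (\<lambda>x. e\<^sup>2 + \<sigma> x)" unfolding \<sigma>_def by (intro smooth_add smooth_const smooth_norm_sq)
  have smp: "smooth (\<lambda>x. (e\<^sup>2 + \<sigma> x) powr q)" for q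
    by (rule smooth_powr[OF sm\<sigma>]) (use e2 \<sigma> in \<open>auto simp: add_pos_nonneg\<close>)
  have smrt: "smooth (\<lambda>x. rt (sq x))" by (rule test_functions_UNIV_D[OF rt_test])
  have out: "rt (sq x) = 0" if "norm (x - 0) > R" for x
  proof -
    have "R\<^sup>2 \<le> sq x" unfolding sq_def using that R by (intro power_mono) auto
    then show ?thesis by (simp add: rt_def c_outside)
  qed
  define \<psi> where "\<psi> i x = rt (sq x) * (\<kappa> (\<sigma> x) * (x $ i - y $ i))" for i x
  have \<psi>_test: "\<psi> i \<in> test_functions UNIV" for i
    unfolding \<psi>_def[abs_def] \<kappa>_def
    by (rule smooth_test_function[where a=0 and R=R], intro smooth_mult smooth_diff smooth_nth smooth_const smrt smp)
      (simp add: out)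
  have hrt: "((\<lambda>x. rt (sq x)) has_derivative (\<lambda>h. rt1 (sq x) * (2 * (x \<bullet> h)))) (at x)" for x
    using has_derivative_radial[OF wt_deriv(3), where a=0 and x=x] by (simp add: sq_def)
  have h\<kappa>: "((\<lambda>x. \<kappa> (\<sigma> x)) has_derivative (\<lambda>h. \<kappa>1 (\<sigma> x) * (2 * ((x - y) \<bullet> h)))) (at x)" for x
    unfolding \<sigma>_def by (rule has_derivative_radial) (rule d\<kappa>, simp)
  have hX: "((\<lambda>x. x $ i - y $ i) has_derivative (\<lambda>h. h $ i)) (at x)" for i :: 5 and x
    by (auto intro!: derivative_eq_intros bounded_linear_imp_has_derivative bounded_linear_vec_nth)
  have ax: "x \<bullet> axis i 1 = x $ i" "(x - y) \<bullet> axis i 1 = x $ i - y $ i" for i x by (simp_all add: inner_axis)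
  have d\<psi>: "partial_deriv i (\<psi> i) x = 2 * rt1 (sq x) * \<kappa> (\<sigma> x) * (x $ i * (x $ i - y $ i))
      + rt (sq x) * (2 * \<kappa>1 (\<sigma> x) * ((x $ i - y $ i) * (x $ i - y $ i)) + \<kappa> (\<sigma> x))" for i x
    unfolding \<psi>_def[abs_def]
    by (subst partial_deriv_eq[OF has_derivative_mult[OF hrt has_derivative_mult[OF h\<kappa> hX]]])
      (simp only: ax, simp add: algebra_simps)
  have div_kernel: "2 * \<kappa>1 (\<sigma> x) * \<sigma> x + 5 * \<kappa> (\<sigma> x) = 5 * regular_kernel e (x - y)" for x
  proof -
    have "(e\<^sup>2 + \<sigma> x) powr (-5/2) = (e\<^sup>2 + \<sigma> x) * (e\<^sup>2 + \<sigma> x) powr (-7/2)"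
      using \<sigma>[of x] e2 powr_mult_base[of "e\<^sup>2 + \<sigma> x" "-7/2"] by simp
    then show ?thesis unfolding \<kappa>_def \<kappa>1_def regular_kernel_def \<sigma>_def[symmetric] by (simp add: algebra_simps)
  qed
  define A where "A x = u x $ j * (2 * rt1 (sq x) * \<kappa> (\<sigma> x) * (x \<bullet> (x - y)))" for x
  define B where "B x = (u x $ j * rt (sq x)) * regular_kernel e (x - y)" for x
  define T where "T x = rt (sq x) * \<kappa> (\<sigma> x) * (D x $ j \<bullet> (x - y))" for x
  have sum_\<psi>: "(\<Sum>i\<in>UNIV. u x $ j * partial_deriv i (\<psi> i) x) = A x + 5 * B x" for x
  proof -
    have "(\<Sum>i\<in>UNIV. partial_deriv i (\<psi> i) x) = 2 * rt1 (sq x) * \<kappa> (\<sigma> x) * (\<Sum>i\<in>UNIV. x $ i * (x $ i - y $ i))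
       + rt (sq x) * (2 * \<kappa>1 (\<sigma> x) * (\<Sum>i\<in>UNIV. (x $ i - y $ i) * (x $ i - y $ i)) + 5 * \<kappa> (\<sigma> x))"
      unfolding d\<psi> by (simp add: sum.distrib sum_distrib_left distrib_left mult.assoc)
    also have "(\<Sum>i\<in>UNIV. x $ i * (x $ i - y $ i)) = x \<bullet> (x - y)" by (simp add: inner_vec_def)
    also have "(\<Sum>i\<in>UNIV. (x $ i - y $ i) * (x $ i - y $ i)) = \<sigma> x"
      unfolding \<sigma>_def power2_norm_eq_inner by (simp add: inner_vec_def)
    also note div_kernel
    finally have S: "(\<Sum>i\<in>UNIV. partial_deriv i (\<psi> i) x)
      = 2 * rt1 (sq x) * \<kappa> (\<sigma> x) * (x \<bullet> (x - y)) + rt (sq x) * (5 * regular_kernel e (x - y))" .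
    show ?thesis unfolding sum_distrib_left[symmetric] S A_def B_def by (simp add: distrib_left mult_ac)
  qed
  have sum_D: "(\<Sum>i\<in>UNIV. D x $ j $ i * \<psi> i x) = T x" for x
    by (simp add: \<psi>_def T_def inner_vec_def sum_distrib_left mult_ac)
  have int_u: "integrable lborel (\<lambda>x. u x $ j * partial_deriv i (\<psi> i) x)" for i
    by (intro integrable_mult_test_function locally_integrable_fields partial_deriv_test_functions \<psi>_test)
  have int_D: "integrable lborel (\<lambda>x. D x $ j $ i * \<psi> i x)" for i
    by (intro integrable_mult_test_function locally_integrable_fields \<psi>_test)
  have int_T: "integrable lborel T"
    unfolding sum_D[symmetric] by (intro Bochner_Integration.integrable_sum int_D)
  have int_AB: "integrable lborel (\<lambda>x. A x + 5 * B x)"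
    unfolding sum_\<psi>[symmetric] by (intro Bochner_Integration.integrable_sum int_u)
  have int_B: "integrable lborel B"
  proof -
    have "(\<lambda>x. rt (sq x) * regular_kernel e (x - y)) \<in> test_functions UNIV"
      unfolding regular_kernel_def \<sigma>_def[symmetric]
      by (rule smooth_test_function[where a=0 and R=R], intro smooth_mult smooth_const smrt smp) (simp add: out)
    from integrable_mult_test_function[OF locally_integrable_fields(1)[of j] this] show ?thesis
      by (simp add: B_def[abs_def] mult.assoc)
  qed
  have int_A: "integrable lborel A"
    using Bochner_Integration.integrable_diff[OF int_AB integrable_mult_right[OF int_B, of 5]] by simp
  have "(\<integral>x. A x + 5 * B x \<partial>lborel) = (\<Sum>i\<in>UNIV. \<integral>x. u x $ j * partial_deriv i (\<psi> i) x \<partial>lborel)"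
    unfolding sum_\<psi>[symmetric] by (rule Bochner_Integration.integral_sum) (rule int_u)
  also have "\<dots> = (\<Sum>i\<in>UNIV. - (\<integral>x. D x $ j $ i * \<psi> i x \<partial>lborel))"
    by (intro sum.cong refl gradient \<psi>_test)
  also have "\<dots> = - (\<integral>x. T x \<partial>lborel)"
    unfolding sum_D[symmetric] by (subst Bochner_Integration.integral_sum) (auto simp: int_D sum_negf)
  finally have "5 * (\<integral>x. B x \<partial>lborel) = - (\<integral>x. T x + A x \<partial>lborel)"
    using int_A int_B int_T by simp
  \<comment> \<open>The factor 1/5 that the divergence would gain is given away.\<close>
  then have "\<bar>\<integral>x. B x \<partial>lborel\<bar> \<le> norm (\<integral>x. T x + A x \<partial>lborel)" by simp
  then have "ennreal \<bar>\<integral>x. B x \<partial>lborel\<bar> \<le> ennreal (norm (\<integral>x. T x + A x \<partial>lborel))" by (rule ennreal_leI)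
  also have "\<dots> \<le> (\<integral>\<^sup>+x. ennreal (norm (T x + A x)) \<partial>lborel)"
    by (rule integral_norm_bound_ennreal) (use int_T int_A in auto)
  also have "\<dots> \<le> (\<integral>\<^sup>+x. ennreal (majorant x) * ennreal (1 / norm (x - y) ^ 4) \<partial>lborel)"
  proof (rule nn_integral_mono)
    fix x
    have \<kappa>0: "\<kappa> (\<sigma> x) \<ge> 0" by (simp add: \<kappa>_def)
    \<comment> \<open>Dropping e^2 from the kernel makes the bound independent of \<open>e\<close>.
      At \<open>x = y\<close> both sides are 0, since 1/0 = 0.\<close>
    have k: "\<kappa> (\<sigma> x) * norm (x - y) \<le> 1 / norm (x - y) ^ 4"
    proof (cases "x = y")
      case False
      then have "\<kappa> (\<sigma> x) \<le> (\<sigma> x) powr (-5/2)"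
        unfolding \<kappa>_def using e2 by (intro powr_mono2') (auto simp: \<sigma>_def)
      also have "\<dots> = norm (x - y) powr (-5)" using False by (simp add: \<sigma>_def powr_powr flip: powr_numeral)
      also have "\<dots> = 1 / norm (x - y) ^ 5" using False by (simp add: powr_minus_divide)
      finally have "\<kappa> (\<sigma> x) * norm (x - y) \<le> 1 / norm (x - y) ^ 5 * norm (x - y)" by (rule mult_right_mono) simp
      also have "\<dots> = 1 / norm (x - y) ^ 4" using False by (simp add: eval_nat_numeral)
      finally show ?thesis .
    qed simp
    have "\<bar>T x\<bar> \<le> rt (sq x) * \<kappa> (\<sigma> x) * (norm (D x) * norm (x - y))"
    proof -
      have "\<bar>D x $ j \<bullet> (x - y)\<bar> \<le> norm (D x $ j) * norm (x - y)" by (rule Cauchy_Schwarz_ineq2)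
      also have "\<dots> \<le> norm (D x) * norm (x - y)"
        by (intro mult_right_mono Finite_Cartesian_Product.norm_nth_le) auto
      finally show ?thesis unfolding T_def using rt_nonneg[of "sq x"] \<kappa>0 by (simp add: abs_mult mult_left_mono)
    qed
    moreover have "\<bar>A x\<bar> \<le> norm (u x) * (2 * \<bar>rt1 (sq x)\<bar> * \<kappa> (\<sigma> x) * (norm x * norm (x - y)))"
      unfolding A_def abs_mult using \<kappa>0 component_le_norm_cart[of "u x" j] Cauchy_Schwarz_ineq2[of x "x - y"]
      by (intro mult_mono) (auto simp: abs_mult)
    ultimately have "norm (T x + A x) \<le> majorant x * (\<kappa> (\<sigma> x) * norm (x - y))"
      by (simp add: majorant_def algebra_simps)
    also have "\<dots> \<le> majorant x * (1 / norm (x - y) ^ 4)" by (intro mult_left_mono k majorant_nonneg)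
    finally have "ennreal (norm (T x + A x)) \<le> ennreal (majorant x * (1 / norm (x - y) ^ 4))" by (rule ennreal_leI)
    then show "ennreal (norm (T x + A x)) \<le> ennreal (majorant x) * ennreal (1 / norm (x - y) ^ 4)"
      using majorant_nonneg[of x] by (simp add: ennreal_mult del: times_divide_eq_right)
  qed
  finally show ?thesis by (simp add: riesz_def B_def)
qed

text \<open>The representation holds for each component. As |u| is at most the sum of five absolute
  components, one of them is at least |u|/5, which accounts for the division by 5.\<close>

lemma velocity_le_riesz: "AE y in lborel. ennreal (bubble_mass * \<bar>norm (u y) * rt (sq y) / 5\<bar>) \<le> riesz (\<lambda>x. ennreal (majorant x)) y"
proof -
  have "AE y in lborel. ennreal (bubble_mass * \<bar>u y $ j * rt (sq y)\<bar>) \<le> riesz (\<lambda>x. ennreal (majorant x)) y" for j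
    by (rule abs_le_riesz[OF integrable_mult_test_function[OF locally_integrable_fields(1) rt_test] _ majorant_finite regularised_representation])
      measurable
  then have "AE y in lborel. \<forall>j. ennreal (bubble_mass * \<bar>u y $ j * rt (sq y)\<bar>) \<le> riesz (\<lambda>x. ennreal (majorant x)) y"
    by (simp add: AE_all_countable)
  then show ?thesis
  proof eventually_elim
    case (elim y)
    have "norm (u y) \<le> (\<Sum>j\<in>UNIV. \<bar>u y $ j\<bar>)" by (rule norm_le_l1_cart)
    also have "\<dots> \<le> (\<Sum>j\<in>(UNIV::5 set). Max (range (\<lambda>j. \<bar>u y $ j\<bar>)))" by (intro sum_mono Max_ge) auto
    also have "\<dots> = 5 * Max (range (\<lambda>j. \<bar>u y $ j\<bar>))" by simp
    finally have n: "norm (u y) / 5 \<le> Max (range (\<lambda>j. \<bar>u y $ j\<bar>))" by simp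
    have "Max (range (\<lambda>j. \<bar>u y $ j\<bar>)) \<in> range (\<lambda>j. \<bar>u y $ j\<bar>)" by (intro Max_in) auto
    then obtain j where j: "Max (range (\<lambda>j. \<bar>u y $ j\<bar>)) = \<bar>u y $ j\<bar>" by blast
    have "norm (u y) / 5 \<le> \<bar>u y $ j\<bar>" using n unfolding j .
    then have "(norm (u y) / 5) * rt (sq y) \<le> \<bar>u y $ j\<bar> * rt (sq y)" by (intro mult_right_mono rt_nonneg)
    then have "\<bar>norm (u y) * rt (sq y) / 5\<bar> \<le> \<bar>u y $ j * rt (sq y)\<bar>"
      using rt_nonneg[of "sq y"] by (simp add: abs_mult)
    then have "ennreal (bubble_mass * \<bar>norm (u y) * rt (sq y) / 5\<bar>) \<le> ennreal (bubble_mass * \<bar>u y $ j * rt (sq y)\<bar>)"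
      using bubble_mass_pos by (intro ennreal_leI mult_left_mono) auto
    then show ?case using elim order_trans by blast
  qed
qed

text \<open>The weight (1+s)^{-1} is split as (1+s)^{-3/4} (1+s)^{-1/4}. The first factor
  \<open>f\<close> goes with \<open>H\<close>, because H f^2 is what \<open>head_weighted\<close>
  integrates; the second, with one copy of the cutoff, is \<open>rt\<close>, and the other copy is
  estimated by 1.\<close>

lemma flux_bound:
  assumes t: "t > 0"
  shows "ennreal (bubble_mass / 5) * flux
    \<le> ennreal t * (2 * (\<integral>\<^sup>+x. ennreal (energy_density x) \<partial>lborel) + ennreal (32 * cutoff_const\<^sup>2 * (ball_vol + M)))
      + ennreal (1 / t) * (ennreal (1536 * ball_vol) * ennreal potential_bound * ennreal potential_bound)"
proof -
  define f where "f x = (1 + sq x) powr (-3/4)" for x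
  have f2: "(f x)\<^sup>2 = (1 + sq x) powr (-3/2)" for x
    by (simp add: f_def power2_eq_square flip: powr_add)
  have [measurable]: "f \<in> borel_measurable borel" unfolding f_def by measurable
  have "flux \<le> (\<integral>\<^sup>+x. ennreal 5 * ennreal (H x * f x * \<bar>norm (u x) * rt (sq x) / 5\<bar>) \<partial>lborel)"
    unfolding flux_def
  proof (rule nn_integral_mono)
    fix x
    have "f x * rt (sq x) = (1 + sq x) powr (-1) * c (sq x)"
      by (simp add: f_def rt_def flip: powr_add mult.assoc)
    moreover have "c (sq x) * c (sq x) \<le> c (sq x)" using c_range[of "sq x"] by (intro mult_left_le) auto
    then have "(1 + sq x) powr (-1) * (c (sq x) * c (sq x)) \<le> (1 + sq x) powr (-1) * c (sq x)" by (intro mult_left_mono) auto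
    ultimately have "(1 + sq x) powr (-1) * (c (sq x) * c (sq x)) \<le> f x * rt (sq x)" by simp
    then have "H x * norm (u x) * ((1 + sq x) powr (-1) * (c (sq x) * c (sq x))) \<le> H x * norm (u x) * (f x * rt (sq x))"
      using H_nonneg[of x] by (intro mult_left_mono) auto
    also have "\<dots> = 5 * (H x * f x * \<bar>norm (u x) * rt (sq x) / 5\<bar>)" using rt_nonneg[of "sq x"] by simp
    finally have "ennreal (H x * norm (u x) * ((1 + sq x) powr (-1) * (c (sq x) * c (sq x)))) \<le> ennreal \<dots>" by (rule ennreal_leI)
    then show "ennreal (H x * norm (u x) * ((1 + sq x) powr (-1) * (c (sq x) * c (sq x)))) \<le> ennreal 5 * ennreal (H x * f x * \<bar>norm (u x) * rt (sq x) / 5\<bar>)"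
      using H_nonneg[of x] by (subst ennreal_mult[symmetric]) (auto simp: f_def)
  qed
  also have "\<dots> = ennreal 5 * (\<integral>\<^sup>+x. ennreal (H x * f x * \<bar>norm (u x) * rt (sq x) / 5\<bar>) \<partial>lborel)"
    by (rule nn_integral_cmult) measurable
  finally have "ennreal (bubble_mass / 5) * flux \<le> ennreal (bubble_mass / 5) * (ennreal 5 * (\<integral>\<^sup>+x. ennreal (H x * f x * \<bar>norm (u x) * rt (sq x) / 5\<bar>) \<partial>lborel))"
    by (intro mult_left_mono) auto
  also have "\<dots> = ennreal bubble_mass * (\<integral>\<^sup>+x. ennreal (H x * f x * \<bar>norm (u x) * rt (sq x) / 5\<bar>) \<partial>lborel)"
  proof -
    have "ennreal (bubble_mass / 5) * ennreal 5 = ennreal (bubble_mass / 5 * 5)"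
      using bubble_mass_pos by (intro ennreal_mult[symmetric]) auto
    then show ?thesis by (simp only: mult.assoc[symmetric]) simp
  qed
  also have "\<dots> \<le> ennreal t * (\<integral>\<^sup>+x. (ennreal (majorant x))\<^sup>2 \<partial>lborel)
      + ennreal (1 / t) * (ennreal (1536 * ball_vol) * ennreal potential_bound * (\<integral>\<^sup>+x. ennreal (H x * (f x)\<^sup>2) \<partial>lborel))"
    by (rule pairing_le_riesz_energy[OF _ _ _ _ H_nonneg _ head_potential velocity_le_riesz t]) (auto simp: f_def)
  also have "\<dots> \<le> ennreal t * (2 * (\<integral>\<^sup>+x. ennreal (energy_density x) \<partial>lborel) + ennreal (32 * cutoff_const\<^sup>2 * (ball_vol + M)))
      + ennreal (1 / t) * (ennreal (1536 * ball_vol) * ennreal potential_bound * ennreal potential_bound)"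
    unfolding f2 using head_weighted by (intro add_mono mult_left_mono majorant_energy) (auto simp: sq_def)
  finally show ?thesis .
qed

definition energy_bound :: real where
  "energy_bound = 2 * energy_error + 16 * cutoff_const\<^sup>2 * (ball_vol + M) + 200 * (1536 * ball_vol * potential_bound * potential_bound) / bubble_mass\<^sup>2"

text \<open>With b = \<open>bubble_mass\<close> and t = b/20, the flux estimate returns b/10 times
  the energy against b/5 on the left, so half of it is absorbed. Multiplying the remainder by 10/b
  produces the coefficients 2, 1/2 and 200 / b^2 in \<open>energy_bound\<close>.\<close>

lemma uniform_energy_bound: "(\<integral>\<^sup>+x. ennreal (energy_density x) \<partial>lborel) \<le> ennreal energy_bound"
proof -
  define b where "b = bubble_mass"
  have b: "b > 0" using bubble_mass_pos by (simp add: b_def)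
  define m where "m = 32 * cutoff_const\<^sup>2 * (ball_vol + M)"
  have m: "m \<ge> 0" using M by (simp add: m_def)
  define k where "k = 1536 * ball_vol * potential_bound * potential_bound"
  have pb: "potential_bound \<ge> 0" using M cutoff_const(1) by (simp add: potential_bound_def)
  have k: "k \<ge> 0" using pb by (simp add: k_def)
  have energy_error: "energy_error \<ge> 0" using M cutoff_const(1) by (simp add: energy_error_def)
  obtain q where q: "q \<ge> 0" "(\<integral>\<^sup>+x. ennreal (energy_density x) \<partial>lborel) = ennreal q"
    using energy_density_finite by (metis ennreal_cases infinity_ennreal_def less_irrefl)
  have bound: "ennreal (b / 5) * flux \<le> ennreal (b / 20 * (2 * q + m) + 20 / b * k)"
  proof -
    have "ennreal (b / 5) * flux \<le> ennreal (b / 20) * (2 * ennreal q + ennreal m)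
        + ennreal (1 / (b / 20)) * (ennreal (1536 * ball_vol) * ennreal potential_bound * ennreal potential_bound)"
      using flux_bound[of "b / 20"] b unfolding q b_def m_def by simp
    also have "ennreal (1536 * ball_vol) * ennreal potential_bound * ennreal potential_bound = ennreal k"
      using pb by (simp add: k_def ennreal_mult)
    also have "2 * ennreal q + ennreal m = ennreal (2 * q + m)"
      using q m by (simp add: ennreal_mult)
    also have "ennreal (b / 20) * ennreal (2 * q + m) = ennreal (b / 20 * (2 * q + m))"
      using q m b by (intro ennreal_mult[symmetric]) auto
    also have "ennreal (1 / (b / 20)) * ennreal k = ennreal (20 / b * k)"
      using k b by (subst ennreal_mult[symmetric]) auto
    also have "ennreal (b / 20 * (2 * q + m)) + ennreal (20 / b * k) = ennreal (b / 20 * (2 * q + m) + 20 / b * k)"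
      using q m k b by (intro ennreal_plus[symmetric]) auto
    finally show ?thesis .
  qed
  have "ennreal (b / 5 * q) = ennreal (b / 5) * ennreal q" using b q by (intro ennreal_mult) auto
  also have "\<dots> \<le> ennreal (b / 5) * (flux + ennreal energy_error)"
    using energy_estimate unfolding q by (intro mult_left_mono) auto
  also have "\<dots> = ennreal (b / 5) * flux + ennreal (b / 5 * energy_error)"
    using b energy_error by (simp add: distrib_left ennreal_mult del: times_divide_eq_left)
  also have "\<dots> \<le> ennreal (b / 20 * (2 * q + m) + 20 / b * k) + ennreal (b / 5 * energy_error)"
    by (intro add_right_mono bound)
  also have "\<dots> = ennreal (b / 20 * (2 * q + m) + 20 / b * k + b / 5 * energy_error)"
    using q m k b energy_error by (intro ennreal_plus[symmetric]) auto
  finally have "b / 5 * q \<le> b / 20 * (2 * q + m) + 20 / b * k + b / 5 * energy_error"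
    using q m k b energy_error by (subst (asm) ennreal_le_iff) auto
  then have "10 / b * (b / 5 * q) \<le> 10 / b * (b / 20 * (2 * q + m) + 20 / b * k + b / 5 * energy_error)"
    using b by (intro mult_left_mono) auto
  also have "10 / b * (b / 20 * (2 * q + m) + 20 / b * k + b / 5 * energy_error) = q + m / 2 + 200 * k / b\<^sup>2 + 2 * energy_error"
    using b by (simp add: field_simps power2_eq_square)
  finally have "q \<le> 2 * energy_error + m / 2 + 200 * k / b\<^sup>2" using b by simp
  also have "\<dots> = energy_bound" by (simp add: energy_bound_def m_def k_def b_def)
  finally show ?thesis unfolding q by (rule ennreal_leI)
qed

end

section \<open>Removing the cutoff\<close>

context nonpositive_head
begin

text \<open>The constant \<open>energy_bound\<close> depends on \<open>M\<close> but not on the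
  radius, so Fatou along the radii k+1 gives the finiteness that
  \<open>vanishing_if_weighted_finite\<close> requires.\<close>

lemma solution_vanishes: "AE x in lborel. u x = 0 \<and> p x = 0"
proof (rule vanishing_if_weighted_finite)
  have cs: "cutoff_solution u p D M (real (Suc k))" for k
    by unfold_locales simp
  define f where "f k x = (norm (u x))\<^sup>2 * ((1 + (norm x)\<^sup>2) powr (-3/2) * (cutoff ((norm x)\<^sup>2 / (real (Suc k))\<^sup>2) * cutoff ((norm x)\<^sup>2 / (real (Suc k))\<^sup>2)))" for k x
  have "(\<integral>\<^sup>+x. ennreal ((norm (u x))\<^sup>2 * (1 + (norm x)\<^sup>2) powr (-3/2)) \<partial>lborel) \<le> ennreal (cutoff_solution.energy_bound M)"
  proof (rule Liminf_bound[where f="\<lambda>k x. ennreal (f k x)"])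
    show "(\<lambda>x. ennreal (f k x)) \<in> borel_measurable borel" for k unfolding f_def by measurable
    show "AE x in lborel. (\<lambda>k. ennreal (f k x)) \<longlonglongrightarrow> ennreal ((norm (u x))\<^sup>2 * (1 + (norm x)\<^sup>2) powr (-3/2))"
    proof (intro AE_I2 tendsto_ennrealI)
      fix x
      have "(\<lambda>k. f k x) \<longlonglongrightarrow> (norm (u x))\<^sup>2 * ((1 + (norm x)\<^sup>2) powr (-3/2) * (1 * 1))"
        unfolding f_def by (intro tendsto_mult tendsto_const cutoff_limit)
      then show "(\<lambda>k. f k x) \<longlonglongrightarrow> (norm (u x))\<^sup>2 * (1 + (norm x)\<^sup>2) powr (-3/2)" by simp
    qed
    show "\<forall>\<^sub>F k in sequentially. (\<integral>\<^sup>+x. ennreal (f k x) \<partial>lborel) \<le> ennreal (cutoff_solution.energy_bound M)"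
    proof (intro always_eventually allI)
      fix k
      interpret cutoff_solution u p D M "real (Suc k)" by (rule cs)
      have "f k x \<le> energy_density x" for x
      proof -
        have "0 \<le> (norm (D x))\<^sup>2 * wt (sq x)" using wt_nonneg by (intro mult_nonneg_nonneg) auto
        moreover have "f k x = (norm (u x))\<^sup>2 * ((1 + sq x) powr (-3/2) * (c (sq x) * c (sq x)))"
          unfolding f_def c_def sq_def ..
        ultimately show ?thesis unfolding energy_density_def by linarith
      qed
      then have "(\<integral>\<^sup>+x. ennreal (f k x) \<partial>lborel) \<le> (\<integral>\<^sup>+x. ennreal (energy_density x) \<partial>lborel)"
        by (intro nn_integral_mono ennreal_leI)
      then show "(\<integral>\<^sup>+x. ennreal (f k x) \<partial>lborel) \<le> ennreal energy_bound"
        using uniform_energy_bound by (rule order_trans)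
    qed
  qed simp
  then show "(\<integral>\<^sup>+x. ennreal ((norm (u x))\<^sup>2 * (1 + (norm x)\<^sup>2) powr (-3/2)) \<partial>lborel) < \<infinity>"
    by (rule order.strict_trans1) simp
qed

end

section \<open>From Lebesgue measurable solutions to Borel representatives\<close>

lemma completion_ex_borel_measurable_euclidean:
  fixes f :: "'a \<Rightarrow> 'b::euclidean_space"
  assumes f: "f \<in> borel_measurable (completion N)"
  shows "\<exists>f'\<in>borel_measurable N. (AE x in N. f x = f' x)"
proof -
  have "\<exists>h. h \<in> borel_measurable N \<and> (AE x in N. f x \<bullet> b = h x)" for b
    using completion_ex_borel_measurable_real[of "\<lambda>x. f x \<bullet> b" N] f by auto
  then obtain h where h: "\<And>b. h b \<in> borel_measurable N" "\<And>b. AE x in N. f x \<bullet> b = h b x"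
    by metis
  have "AE x in N. \<forall>b\<in>Basis. f x \<bullet> b = h b x"
    using h(2) by (intro AE_finite_allI) auto
  then have "AE x in N. f x = (\<Sum>b\<in>Basis. h b x *\<^sub>R b)"
  proof eventually_elim
    case (elim x)
    have "f x = (\<Sum>b\<in>Basis. (f x \<bullet> b) *\<^sub>R b)" by (simp add: euclidean_representation)
    also have "\<dots> = (\<Sum>b\<in>Basis. h b x *\<^sub>R b)" using elim by (intro sum.cong) auto
    finally show ?case .
  qed
  moreover have "(\<lambda>x. \<Sum>b\<in>Basis. h b x *\<^sub>R b) \<in> borel_measurable N"
    by (intro borel_measurable_sum borel_measurable_scaleR borel_measurable_const h(1))
  ultimately show ?thesis by (rule bexI)
qed

lemma set_integral_lebesgue_eq:
  fixes f g :: "real^5 \<Rightarrow> real"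
  assumes g: "g \<in> borel_measurable lebesgue" and f: "f \<in> borel_measurable borel" and eq: "AE x in lborel. g x = f x"
  shows "(LINT x:UNIV|lebesgue. g x) = (\<integral>x. f x \<partial>lborel)"
proof -
  have f': "f \<in> borel_measurable lborel" using f by simp
  have "(LINT x:UNIV|lebesgue. g x) = (\<integral>x. g x \<partial>lebesgue)" by (simp add: set_lebesgue_integral_def)
  also have "\<dots> = (\<integral>x. f x \<partial>lebesgue)"
    using eq by (intro integral_cong_AE g measurable_completion f') (simp add: AE_completion_iff)
  also have "\<dots> = (\<integral>x. f x \<partial>lborel)" by (rule integral_completion[OF f'])
  finally show ?thesis .
qed

lemma set_integral_lebesgue_mult_smooth:
  fixes f g \<psi> :: "real^5 \<Rightarrow> real"
  assumes "g \<in> borel_measurable lebesgue" "f \<in> borel_measurable borel" "AE x in lborel. g x = f x" "smooth \<psi>"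
  shows "(LINT x:UNIV|lebesgue. g x * \<psi> x) = (\<integral>x. f x * \<psi> x \<partial>lborel)"
proof (rule set_integral_lebesgue_eq)
  have "\<psi> \<in> borel_measurable borel" by (rule smooth_measurable[OF assms(4)])
  moreover from this have "\<psi> \<in> borel_measurable lebesgue" by (intro measurable_completion) simp
  ultimately show "(\<lambda>x. g x * \<psi> x) \<in> borel_measurable lebesgue" "(\<lambda>x. f x * \<psi> x) \<in> borel_measurable borel"
    using assms(1,2) by (auto intro: borel_measurable_times)
  show "AE x in lborel. g x * \<psi> x = f x * \<psi> x" using assms(3) by eventually_elim simp
qed

lemma scaled_integral_bound:
  fixes f :: "real^5 \<Rightarrow> ennreal"
  assumes S: "(SUP R\<in>{0<..}. ennreal (1 / R\<^sup>2) * (\<integral>\<^sup>+x\<in>ball 0 R. f x \<partial>lebesgue)) \<le> ennreal M"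
    and M: "M \<ge> 0" and eq: "AE x in lborel. f x = h x" and R: "(R::real) > 0"
  shows "(\<integral>\<^sup>+x. h x * indicator (ball 0 R) x \<partial>lborel) \<le> ennreal (M * R\<^sup>2)"
proof -
  define I where "I = (\<integral>\<^sup>+x\<in>ball 0 R. f x \<partial>lebesgue)"
  have "ennreal (1 / R\<^sup>2) * I \<le> ennreal M"
    unfolding I_def by (rule order_trans[OF SUP_upper S]) (use R in auto)
  then have "ennreal (R\<^sup>2) * (ennreal (1 / R\<^sup>2) * I) \<le> ennreal (R\<^sup>2) * ennreal M" by (rule mult_left_mono) simp
  also have "\<dots> = ennreal (M * R\<^sup>2)" using M by (simp add: ennreal_mult mult.commute)
  also have "ennreal (R\<^sup>2) * (ennreal (1 / R\<^sup>2) * I) = ennreal (R\<^sup>2 * (1 / R\<^sup>2)) * I"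
    by (simp add: ennreal_mult mult.assoc del: times_divide_eq_right)
  also have "R\<^sup>2 * (1 / R\<^sup>2) = 1" using R by simp
  finally have "I \<le> ennreal (M * R\<^sup>2)" by simp
  moreover have "I = (\<integral>\<^sup>+x. h x * indicator (ball 0 R) x \<partial>lborel)"
    unfolding I_def nn_integral_completion
    by (rule nn_integral_cong_AE) (use eq in eventually_elim, simp)
  ultimately show ?thesis by simp
qed

theorem proposition1p10:
  fixes U :: "real^5 \<Rightarrow> real^5" and P :: "real^5 \<Rightarrow> real"
  assumes "suitable_weak_solution UNIV U P"
    and "scaled_bound U P < \<infinity>"
    and "AE x in lebesgue. (norm (U x))\<^sup>2 / 2 + P x \<le> 0"
  shows "AE x in lebesgue. U x = 0 \<and> P x = 0"
proof -
  from assms(1) obtain D where sol: "H1_loc UNIV U" "L_loc (3/2) UNIV P" "stationary_NS UNIV U P"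
    and D: "has_weak_gradient UNIV U D" "L_loc 2 UNIV D"
    and energy: "\<And>\<phi>. \<phi> \<in> test_functions UNIV \<Longrightarrow> (\<And>x. 0 \<le> \<phi> x) \<Longrightarrow>
          (LINT x:UNIV|lebesgue. (norm (D x))\<^sup>2 * \<phi> x)
          \<le> (LINT x:UNIV|lebesgue. (norm (U x))\<^sup>2 / 2 * laplacian \<phi> x)
            + (LINT x:UNIV|lebesgue. ((norm (U x))\<^sup>2 / 2 + P x) * (U x \<bullet> grad \<phi> x))"
    unfolding suitable_weak_solution_def by blast
  have U: "U \<in> borel_measurable lebesgue" and P: "P \<in> borel_measurable lebesgue" and D_leb: "D \<in> borel_measurable lebesgue"
    using sol(1,2) D(2) by (auto simp: H1_loc_def L_loc_def set_borel_measurable_def)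
  obtain u where u [measurable]: "u \<in> borel_measurable borel" and Uu: "AE x in lborel. U x = u x"
    using completion_ex_borel_measurable_euclidean[OF U] by auto
  obtain p0 where p0 [measurable]: "p0 \<in> borel_measurable borel" and Pp0: "AE x in lborel. P x = p0 x"
    using completion_ex_borel_measurable_euclidean[OF P] by auto
  obtain d where d [measurable]: "d \<in> borel_measurable borel" and Dd: "AE x in lborel. D x = d x"
    using completion_ex_borel_measurable_euclidean[OF D_leb] by auto
  \<comment> \<open>Taking the minimum forces the head to be nonpositive at every point. By the
    hypothesis on the head it alters \<open>p0\<close> on a null set only.\<close>
  define p where "p x = min (p0 x) (- (norm (u x))\<^sup>2 / 2)" for x
  have p [measurable]: "p \<in> borel_measurable borel" unfolding p_def by measurable
  have "AE x in lborel. (norm (U x))\<^sup>2 / 2 + P x \<le> 0" using assms(3) by (simp add: AE_completion_iff)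
  with Uu Pp0 have Pp: "AE x in lborel. P x = p x"
    by eventually_elim (auto simp: p_def)
  have Ui: "(\<lambda>x. U x $ i) \<in> borel_measurable lebesgue" and Dij: "(\<lambda>x. D x $ i $ j) \<in> borel_measurable lebesgue"
    and ui: "(\<lambda>x. u x $ i) \<in> borel_measurable borel" and dij: "(\<lambda>x. d x $ i $ j) \<in> borel_measurable borel" for i j
    by (intro vec_nth_measurable U D_leb u d)+
  have norms: "(\<lambda>x. (norm (U x))\<^sup>2) \<in> borel_measurable lebesgue" "(\<lambda>x. (norm (D x))\<^sup>2) \<in> borel_measurable lebesgue"
    "(\<lambda>x. (norm (u x))\<^sup>2) \<in> borel_measurable borel" "(\<lambda>x. (norm (d x))\<^sup>2) \<in> borel_measurable borel"
    using U D_leb u d by (auto intro!: borel_measurable_power)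
  have AE_Ui: "AE x in lborel. U x $ i = u x $ i" for i
    using Uu by eventually_elim simp
  have smooth_leb: "f \<in> borel_measurable lebesgue" if "smooth f" for f :: "real^5 \<Rightarrow> real"
    using smooth_measurable[OF that] by (intro measurable_completion) simp
  \<comment> \<open>The sum of the two suprema bounds each of them, so a single real number serves
    both \<open>u_int\<close> and \<open>p_int\<close>.\<close>
  define M where "M = enn2real (scaled_bound U P)"
  have M: "M \<ge> 0" "scaled_bound U P = ennreal M" using assms(2) by (auto simp: M_def)
  have u_int: "(\<integral>\<^sup>+x. ennreal (norm (u x) ^ 3) * indicator (ball 0 R) x \<partial>lborel) \<le> ennreal (M * R\<^sup>2)" if "R > 0" for R
  proof (rule scaled_integral_bound[OF _ M(1) _ that])
    show "(SUP R\<in>{0<..}. ennreal (1 / R\<^sup>2) * (\<integral>\<^sup>+x\<in>ball 0 R. ennreal (norm (U x) ^ 3) \<partial>lebesgue)) \<le> ennreal M"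
      unfolding M(2)[symmetric] scaled_bound_def by simp
    show "AE x in lborel. ennreal (norm (U x) ^ 3) = ennreal (norm (u x) ^ 3)"
      using Uu by eventually_elim simp
  qed
  have p_int: "(\<integral>\<^sup>+x. ennreal (\<bar>p x\<bar> powr (3/2)) * indicator (ball 0 R) x \<partial>lborel) \<le> ennreal (M * R\<^sup>2)" if "R > 0" for R
  proof (rule scaled_integral_bound[OF _ M(1) _ that])
    show "(SUP R\<in>{0<..}. ennreal (1 / R\<^sup>2) * (\<integral>\<^sup>+x\<in>ball 0 R. ennreal (\<bar>P x\<bar> powr (3/2)) \<partial>lebesgue)) \<le> ennreal M"
      unfolding M(2)[symmetric] scaled_bound_def by simp
    show "AE x in lborel. ennreal (\<bar>P x\<bar> powr (3/2)) = ennreal (\<bar>p x\<bar> powr (3/2))"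
      using Pp by eventually_elim simp
  qed
  have d_local: "locally_integrable (\<lambda>x. (norm (d x))\<^sup>2)"
    unfolding locally_integrable_def
  proof (intro conjI allI)
    fix R
    \<comment> \<open>\<open>L_loc\<close> speaks of compact sets, hence the closed ball, which
      contains the open one.\<close>
    have "set_integrable lebesgue (cball 0 R) (\<lambda>x. norm (D x) powr 2)"
      using D(2) by (simp add: L_loc_def)
    then have "(\<integral>\<^sup>+x. ennreal (norm (indicator (cball 0 R) x *\<^sub>R norm (D x) powr 2)) \<partial>lebesgue) < \<infinity>"
      unfolding set_integrable_def integrable_iff_bounded by (rule conjunct2)
    then have fin: "(\<integral>\<^sup>+x. ennreal (norm (indicator (cball 0 R) x *\<^sub>R norm (D x) powr 2)) \<partial>lborel) < \<infinity>"
      unfolding nn_integral_completion .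
    have "(\<integral>\<^sup>+x. ennreal \<bar>(norm (d x))\<^sup>2\<bar> * indicator (ball 0 R) x \<partial>lborel)
        \<le> (\<integral>\<^sup>+x. ennreal (norm (indicator (cball 0 R) x *\<^sub>R norm (D x) powr 2)) \<partial>lborel)"
      by (rule nn_integral_mono_AE) (use Dd in eventually_elim, auto simp: indicator_def)
    then show "(\<integral>\<^sup>+x. ennreal \<bar>(norm (d x))\<^sup>2\<bar> * indicator (ball 0 R) x \<partial>lborel) < \<infinity>"
      using fin by (rule order.strict_trans1)
  qed measurable
  interpret nonpositive_head u p d M
  proof
    show "(norm (u x))\<^sup>2 / 2 + p x \<le> 0" for x by (simp add: p_def min_def)
  next
    fix i :: 5 and \<phi> :: "real^5 \<Rightarrow> real"
    assume \<phi>: "\<phi> \<in> test_functions UNIV"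
    note sm = test_functions_UNIV_D(1)[OF \<phi>]
    have 1: "distr_deriv j (distr_deriv j (distr_of UNIV (\<lambda>x. U x $ i))) \<phi> = (\<integral>x. u x $ i * partial_deriv j (partial_deriv j \<phi>) x \<partial>lborel)" for j
      unfolding distr_deriv_def distr_of_def minus_minus
      by (intro set_integral_lebesgue_mult_smooth Ui ui AE_Ui smooth_partial_deriv sm)
    have 2: "distr_deriv j (distr_of UNIV (\<lambda>x. U x $ i * U x $ j)) \<phi> = - (\<integral>x. u x $ i * u x $ j * partial_deriv j \<phi> x \<partial>lborel)" for j
      unfolding distr_deriv_def distr_of_def neg_equal_iff_equal
      by (intro set_integral_lebesgue_mult_smooth borel_measurable_times Ui ui smooth_partial_deriv sm)
        (use Uu in eventually_elim, simp)
    have 3: "distr_deriv i (distr_of UNIV P) \<phi> = - (\<integral>x. p x * partial_deriv i \<phi> x \<partial>lborel)"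
      unfolding distr_deriv_def distr_of_def neg_equal_iff_equal
      by (intro set_integral_lebesgue_mult_smooth P p Pp smooth_partial_deriv sm)
    have "- (\<Sum>j\<in>UNIV. distr_deriv j (distr_deriv j (distr_of UNIV (\<lambda>x. U x $ i))) \<phi>)
        + (\<Sum>j\<in>UNIV. distr_deriv j (distr_of UNIV (\<lambda>x. U x $ i * U x $ j)) \<phi>)
        + distr_deriv i (distr_of UNIV P) \<phi> = 0"
      using sol(3) \<phi> by (simp add: stationary_NS_def)
    then show "(\<Sum>j\<in>UNIV. \<integral>x. u x $ i * partial_deriv j (partial_deriv j \<phi>) x \<partial>lborel)
      + (\<Sum>j\<in>UNIV. \<integral>x. u x $ i * u x $ j * partial_deriv j \<phi> x \<partial>lborel)
      + (\<integral>x. p x * partial_deriv i \<phi> x \<partial>lborel) = 0"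
      unfolding 1 2 3 by (simp add: sum_negf)
  next
    fix \<phi> :: "real^5 \<Rightarrow> real"
    assume \<phi>: "\<phi> \<in> test_functions UNIV"
    note sm = test_functions_UNIV_D(1)[OF \<phi>]
    have 1: "distr_deriv j (distr_of UNIV (\<lambda>x. U x $ j)) \<phi> = - (\<integral>x. u x $ j * partial_deriv j \<phi> x \<partial>lborel)" for j
      unfolding distr_deriv_def distr_of_def neg_equal_iff_equal
      by (intro set_integral_lebesgue_mult_smooth Ui ui AE_Ui smooth_partial_deriv sm)
    have "(\<Sum>j\<in>UNIV. distr_deriv j (distr_of UNIV (\<lambda>x. U x $ j)) \<phi>) = 0"
      using sol(3) \<phi> by (simp add: stationary_NS_def)
    then show "(\<Sum>j\<in>UNIV. \<integral>x. u x $ j * partial_deriv j \<phi> x \<partial>lborel) = 0"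
      unfolding 1 by (simp add: sum_negf)
  next
    fix i j :: 5 and \<phi> :: "real^5 \<Rightarrow> real"
    assume \<phi>: "\<phi> \<in> test_functions UNIV"
    note sm = test_functions_UNIV_D(1)[OF \<phi>]
    have "(LINT x:UNIV|lebesgue. U x $ i * partial_deriv j \<phi> x) = (\<integral>x. u x $ i * partial_deriv j \<phi> x \<partial>lborel)"
      by (intro set_integral_lebesgue_mult_smooth Ui ui AE_Ui smooth_partial_deriv sm)
    moreover have "(LINT x:UNIV|lebesgue. D x $ i $ j * \<phi> x) = (\<integral>x. d x $ i $ j * \<phi> x \<partial>lborel)"
      by (intro set_integral_lebesgue_mult_smooth Dij dij sm) (use Dd in eventually_elim, simp)
    moreover have "distr_deriv j (distr_of UNIV (\<lambda>x. U x $ i)) \<phi> = distr_of UNIV (\<lambda>x. D x $ i $ j) \<phi>"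
      using D(1) \<phi> by (simp add: has_weak_gradient_def)
    ultimately show "(\<integral>x. u x $ i * partial_deriv j \<phi> x \<partial>lborel) = - (\<integral>x. d x $ i $ j * \<phi> x \<partial>lborel)"
      by (simp add: distr_deriv_def distr_of_def)
  next
    fix \<phi> :: "real^5 \<Rightarrow> real"
    assume \<phi>: "\<phi> \<in> test_functions UNIV" and nn: "\<And>x. \<phi> x \<ge> 0"
    note sm = test_functions_UNIV_D(1)[OF \<phi>]
    have lap: "smooth (laplacian \<phi>)"
      unfolding laplacian_def[abs_def] by (intro smooth_sum smooth_partial_deriv sm)
    have "(LINT x:UNIV|lebesgue. (norm (D x))\<^sup>2 * \<phi> x) = (\<integral>x. (norm (d x))\<^sup>2 * \<phi> x \<partial>lborel)"
      by (intro set_integral_lebesgue_mult_smooth norms sm)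
        (use Dd in eventually_elim, simp)
    moreover have "(LINT x:UNIV|lebesgue. (norm (U x))\<^sup>2 / 2 * laplacian \<phi> x) = (\<integral>x. (norm (u x))\<^sup>2 / 2 * laplacian \<phi> x \<partial>lborel)"
      by (intro set_integral_lebesgue_mult_smooth borel_measurable_divide borel_measurable_const norms lap) (use Uu in eventually_elim, simp)
    moreover have "(LINT x:UNIV|lebesgue. ((norm (U x))\<^sup>2 / 2 + P x) * (U x \<bullet> grad \<phi> x))
        = (\<integral>x. ((norm (u x))\<^sup>2 / 2 + p x) * (u x \<bullet> grad \<phi> x) \<partial>lborel)"
      unfolding inner_vec_def grad_def vec_lambda_beta inner_real_def
    proof (rule set_integral_lebesgue_eq)
      show "(\<lambda>x. ((norm (U x))\<^sup>2 / 2 + P x) * (\<Sum>i\<in>UNIV. U x $ i * partial_deriv i \<phi> x)) \<in> borel_measurable lebesgue"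
        by (intro borel_measurable_times borel_measurable_add borel_measurable_divide borel_measurable_const
            norms borel_measurable_sum P Ui smooth_leb smooth_partial_deriv sm)
      show "(\<lambda>x. ((norm (u x))\<^sup>2 / 2 + p x) * (\<Sum>i\<in>UNIV. u x $ i * partial_deriv i \<phi> x)) \<in> borel_measurable borel"
        by (intro borel_measurable_times borel_measurable_add borel_measurable_divide borel_measurable_const
            norms borel_measurable_sum p ui smooth_measurable smooth_partial_deriv sm)
    qed (use Uu Pp in eventually_elim, simp)
    ultimately show "(\<integral>x. (norm (d x))\<^sup>2 * \<phi> x \<partial>lborel) \<le> (\<integral>x. (norm (u x))\<^sup>2 / 2 * laplacian \<phi> x \<partial>lborel)
          + (\<integral>x. ((norm (u x))\<^sup>2 / 2 + p x) * (u x \<bullet> grad \<phi> x) \<partial>lborel)"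
      using energy[OF \<phi> nn] by simp
  qed (use M u_int p_int d_local in auto)
  have "AE x in lborel. U x = 0 \<and> P x = 0"
    using solution_vanishes Uu Pp by eventually_elim simp
  then show ?thesis by (simp add: AE_completion_iff)
qed

end
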